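(* Let $n\ge1$, $0\le m\le n$ and $r\in\mathbb{N}$. Let $a_j$, $b_{jk}$, $f_j$ ($1\le j,k\le n$) be real-valued $C^\infty$ functions on $[0,1]\times\mathbb{R}$ that are $2\pi$-periodic in $t$, and let $h_j:\mathbb{R}^n\to\mathbb{R}$ ($1\le j\le n$) be $C^\infty$ functions. Assume that: (1) $a_j>0$ on $[0,1]\times\mathbb{R}$ for all $j\le m$, and $a_j<0$ on $[0,1]\times\mathbb{R}$ for all $j>m$; (2) $\inf_{x,t}|a_j(x,t)|>0$ for all $j\le n$, the infimum being over $(x,t)\in[0,1]\times\mathbb{R}$; (3) for all $1\le j\ne k\le n$ there exists $p_{jk}\in C^1([0,1]\times\mathbb{R})$ such that $b_{jk}=p_{jk}(a_k-a_j)$, and $p_{jk}=0$ in the interior of the set $\{(x,t): a_j(x,t)=a_k(x,t)\}$; (4) for all $j\le n$, $x\in[0,1]$, $t\in\mathbb{R}$, $z\in\mathbb{R}^n$ and $l=0,1,\dots,r$, $$\exp\left\{\int_x^{x_j}\Big(\frac{b_{jj}}{a_j}-l\,\frac{\partial_t a_j}{a_j^2}\Big)(\eta,\omega_j(\eta;x,t))\,d\eta\right\}\sum_{k=1}^n\left|\partial_k h_j(z)\right|<1,$$ where $x_j=0$ for $j\le m$, $x_j=1$ for $j>m$, $\omega_j$ is the $j$-th characteristic defined in the context, and $\partial_k h_j$ is the partial derivative of $h_j$ with respect to its $k$-th argument. Consider the problem for $u=(u_1,\dots,u_n)$ $$\partial_t u_j+a_j(x,t)\,\partial_x u_j+\sum_{k=1}^n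 b_{jk}(x,t)\,u_k=f_j(x,t),\quad 1\le j\le n,\ 0<x<1,\ t\in\mathbb{R},$$ $$u_j(0,t)=h_j(z(t))\ \text{ for }1\le j\le m,\qquad u_j(1,t)=h_j(z(t))\ \text{ for } m<j\le n,$$ $$u(x,t+2\pi)=u(x,t),$$ where $z(t)=\left(u_1(1,t),\dots,u_m(1,t),u_{m+1}(0,t),\dots,u_n(0,t)\right)$. Then any continuous solution $u$ (in the integrated sense defined in the context) to this problem belongs to $C^r$ on $\{(x,t):0<x<1,\ t\in\mathbb{R}\}$, i.e., each component $u_j$ does.
   Context: Characteristics. For $j\le n$, $x\in[0,1]$ and $t\in\mathbb{R}$, the $j$-th characteristic through $(x,t)$ is the solution $\xi\in[0,1]\mapsto\omega_j(\xi;x,t)\in\mathbb{R}$ of $$\partial_\xi\omega_j(\xi;x,t)=\frac{1}{a_j(\xi,\omega_j(\xi;x,t))},\qquad \omega_j(x;x,t)=t.$$ The number $x_j$ ($x_j=0$ for $j\le m$, $x_j=1$ for $j>m$) is the abscissa of the point at which the characteristic, followed backward in time, reaches the boundary of the strip. Put $$c_j(\xi,x,t)=\exp\int_x^\xi\Big(\frac{b_{jj}}{a_j}\Big)(\eta,\omega_j(\eta;x,t))\,d\eta,\qquad d_j(\xi,x,t)=\frac{c_j(\xi,x,t)}{a_j(\xi,\omega_j(\xi;x,t))}.$$ Continuous solution. A continuous function $u:[0,1]\times\mathbb{R}\to\mathbb{R}^n$, $2\pi$-periodic in $t$, is called a continuous solution of the problem if for all $j\le n$ and all $(x,t)\in[0,1]\times\mathbb{R}$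 $$u_j(x,t)=c_j(x_j,x,t)\,h_j\big(z(\omega_j(x_j;x,t))\big)-\int_{x_j}^x d_j(\xi,x,t)\sum_{k\ne j}b_{jk}(\xi,\omega_j(\xi;x,t))\,u_k(\xi,\omega_j(\xi;x,t))\,d\xi+\int_{x_j}^x d_j(\xi,x,t)\,f_j(\xi,\omega_j(\xi;x,t))\,d\xi,$$ with $z(t)=\left(u_1(1,t),\dots,u_m(1,t),u_{m+1}(0,t),\dots,u_n(0,t)\right)$. *)

theory Defs
  imports "HOL-Analysis.Analysis"
begin

abbreviation strip :: "(real \<times> real) set" where
  "strip \<equiv> {0..1} \<times> UNIV"

(* Derivatives are taken within S, hence one-sided at boundary points of S. They are
   unique when S is open or is the strip, the only sets used below. On such an S,
   Ck_on k f S says that all partial derivatives of f of order at most k exist and are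
   continuous on S; values of f outside S play no role. *)
fun Ck_on :: "nat \<Rightarrow> ('a::euclidean_space \<Rightarrow> real) \<Rightarrow> 'a set \<Rightarrow> bool" where
  "Ck_on 0 f S \<longleftrightarrow> continuous_on S f"
| "Ck_on (Suc k) f S \<longleftrightarrow>
     (\<exists>f'. (\<forall>p\<in>S. (f has_derivative f' p) (at p within S)) \<and> (\<forall>v. Ck_on k (\<lambda>p. f' p v) S))"

definition smooth_on :: "('a::euclidean_space \<Rightarrow> real) \<Rightarrow> 'a set \<Rightarrow> bool" where
  "smooth_on f S \<longleftrightarrow> (\<forall>k. Ck_on k f S)"

definition partial :: "'n \<Rightarrow> (real ^ 'n \<Rightarrow> real) \<Rightarrow> real ^ 'n \<Rightarrow> real" where
  "partial k h z = deriv (\<lambda>s. h (z + s *\<^sub>R axis k 1)) 0"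

definition partial_t :: "(real \<times> real \<Rightarrow> real) \<Rightarrow> real \<times> real \<Rightarrow> real" where
  "partial_t g = (\<lambda>(x, t). deriv (\<lambda>s. g (x, s)) t)"

definition periodic_t :: "(real \<times> real \<Rightarrow> 'b) \<Rightarrow> bool" where
  "periodic_t g \<longleftrightarrow> (\<forall>x\<in>{0..1}. \<forall>t. g (x, t + 2 * pi) = g (x, t))"

definition is_characteristic ::
  "(real \<times> real \<Rightarrow> real) \<Rightarrow> real \<Rightarrow> real \<Rightarrow> (real \<Rightarrow> real) \<Rightarrow> bool" where
  "is_characteristic aj x t w \<longleftrightarrow>
     w x = t \<and>
     (\<forall>\<xi>\<in>{0..1}. (w has_real_derivative 1 / aj (\<xi>, w \<xi>)) (at \<xi> within {0..1}))"

(* The characteristic through (x, t). The initial value problem determines it uniquely on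
   [0,1] when aj is C^1 and bounded away from 0 on the strip; only arguments \<xi> in [0,1] are
   meaningful. *)
definition omega :: "(real \<times> real \<Rightarrow> real) \<Rightarrow> real \<Rightarrow> real \<Rightarrow> real \<Rightarrow> real" where
  "omega aj \<xi> x t = (SOME w. is_characteristic aj x t w) \<xi>"

(* The components 1, ..., n of a vector in real ^ 'n are numbered by a bijection
   num from 'n onto {1..CARD('n)}, so that n = CARD('n) and "j \<le> m" is num j \<le> m. The abscissa x_j is inflow num m j
   and the vector z(t) is outflow_trace num m u t. *)

definition inflow :: "('n \<Rightarrow> nat) \<Rightarrow> nat \<Rightarrow> 'n \<Rightarrow> real" where
  "inflow num m j = (if num j \<le> m then 0 else 1)"

definition outflow_trace ::
  "('n::finite \<Rightarrow> nat) \<Rightarrow> nat \<Rightarrow> (real \<times> real \<Rightarrow> real ^ 'n) \<Rightarrow> real \<Rightarrow> real ^ 'n" where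
  "outflow_trace num m u t = (\<chi> k. if num k \<le> m then u (1, t) $ k else u (0, t) $ k)"

(* LBINT over \<eta>=x..\<xi> is the oriented integral: it changes sign when its limits are swapped. *)
definition c_coeff ::
  "(real \<times> real \<Rightarrow> real) \<Rightarrow> (real \<times> real \<Rightarrow> real) \<Rightarrow> real \<Rightarrow> real \<Rightarrow> real \<Rightarrow> real" where
  "c_coeff aj bjj \<xi> x t =
     exp (LBINT \<eta>=x..\<xi>. bjj (\<eta>, omega aj \<eta> x t) / aj (\<eta>, omega aj \<eta> x t))"

definition d_coeff ::
  "(real \<times> real \<Rightarrow> real) \<Rightarrow> (real \<times> real \<Rightarrow> real) \<Rightarrow> real \<Rightarrow> real \<Rightarrow> real \<Rightarrow> real" where
  "d_coeff aj bjj \<xi> x t = c_coeff aj bjj \<xi> x t / aj (\<xi>, omega aj \<xi> x t)"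

definition continuous_solution ::
  "('n::finite \<Rightarrow> nat) \<Rightarrow> nat \<Rightarrow> ('n \<Rightarrow> real \<times> real \<Rightarrow> real) \<Rightarrow>
   ('n \<Rightarrow> 'n \<Rightarrow> real \<times> real \<Rightarrow> real) \<Rightarrow> ('n \<Rightarrow> real \<times> real \<Rightarrow> real) \<Rightarrow>
   ('n \<Rightarrow> real ^ 'n \<Rightarrow> real) \<Rightarrow> (real \<times> real \<Rightarrow> real ^ 'n) \<Rightarrow> bool" where
  "continuous_solution num m a b f h u \<longleftrightarrow>
     continuous_on strip u \<and> periodic_t u \<and>
     (\<forall>j. \<forall>x\<in>{0..1}. \<forall>t.
        u (x, t) $ j =
          c_coeff (a j) (b j j) (inflow num m j) x t
            * h j (outflow_trace num m u (omega (a j) (inflow num m j) x t))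
          - (LBINT \<xi>=inflow num m j..x. d_coeff (a j) (b j j) \<xi> x t *
               (\<Sum>k\<in>UNIV - {j}. b j k (\<xi>, omega (a j) \<xi> x t) * u (\<xi>, omega (a j) \<xi> x t) $ k))
          + (LBINT \<xi>=inflow num m j..x.
               d_coeff (a j) (b j j) \<xi> x t * f j (\<xi>, omega (a j) \<xi> x t)))"

end

theory Submission
  imports Defs
begin

text \<open>
Write \<open>\<alpha>\<^sub>j = 1 / a\<^sub>j\<close> and \<open>D\<^sub>j = \<partial>\<^sub>x + \<alpha>\<^sub>j \<partial>\<^sub>t\<close>. Along the \<open>j\<close>-th characteristics the integral equations say that
\<open>D\<^sub>j u\<^sub>j = G\<^sub>j - \<beta>\<^sub>j u\<^sub>j - \<Sum>\<^sub>k B\<^sub>j\<^sub>k u\<^sub>k\<close> (sum over \<open>k \<noteq> j\<close>), where \<open>G\<^sub>j = f\<^sub>j / a\<^sub>j\<close>, \<open>\<beta>\<^sub>j = b\<^sub>j\<^sub>j / a\<^sub>j\<close>,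
\<open>B\<^sub>j\<^sub>k = b\<^sub>j\<^sub>k / a\<^sub>j\<close>, and that \<open>u\<^sub>j\<close> equals \<open>h\<^sub>j\<close> of the outflow values \<open>z\<close> on its inflow boundary. Two obstacles
keep a continuous solution from being differentiable: the coupling of different components, and
irregularities that are reflected for ever between the two boundaries.

The first one is removed by the structure of the coupling coefficients. The hypothesis on them gives
\<open>B\<^sub>j\<^sub>k = P (\<alpha>\<^sub>j - \<alpha>\<^sub>k)\<close> with \<open>P\<close> of class \<open>C\<^sup>1\<close>, and \<open>(\<alpha>\<^sub>j - \<alpha>\<^sub>k) \<partial>\<^sub>t = D\<^sub>j - D\<^sub>k\<close>. If \<open>\<Phi>\<close> is a primitive of \<open>P u\<^sub>k\<close>
with respect to \<open>t\<close>, started on a characteristic of the \<open>k\<close>-th family, then \<open>D\<^sub>k \<Phi>\<close> has a continuous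
\<open>t\<close>-derivative because \<open>D\<^sub>k (P u\<^sub>k)\<close> is continuous (\<open>transport_primitive\<close>), and \<open>D\<^sub>j \<Phi> = D\<^sub>k \<Phi> + B\<^sub>j\<^sub>k u\<^sub>k\<close>.
Hence \<open>u\<^sub>j\<close> plus the sum of these primitives solves a scalar transport equation whose right-hand side is
differentiable in \<open>t\<close> except for the damping term \<open>- \<beta>\<^sub>j u\<^sub>j\<close> (\<open>absorb_coupling\<close>). An integrating factor
deals with that term (\<open>damped_transport\<close>). So the outflow values satisfy
\<open>z\<^sub>j(t) = \<gamma>\<^sub>j(t) h\<^sub>j(z(\<theta>\<^sub>j(t))) + g\<^sub>j(t)\<close> with \<open>\<gamma>\<^sub>j\<close>, \<open>\<theta>\<^sub>j\<close>, \<open>g\<^sub>j\<close> continuously differentiable, \<open>\<theta>\<^sub>j\<close> being the time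
at which the characteristic that leaves at time \<open>t\<close> has entered.

The second obstacle is removed by dissipativity. The conditions for \<open>l = 0\<close> and \<open>l = 1\<close> say that
\<open>\<gamma>\<^sub>j \<Sum>\<^sub>k \<bar>\<partial>\<^sub>k h\<^sub>j\<bar>\<close> is less than \<open>1\<close>, also after multiplication by \<open>\<theta>\<^sub>j'\<close>. So this functional equation and its
formal derivative are contractions in the maximum norm, and \<open>z\<close> is of class \<open>C\<^sup>1\<close>
(\<open>functional_equation_C1\<close>). Then \<open>u\<close> has a continuous \<open>t\<close>-derivative.

This \<open>t\<close>-derivative \<open>w\<close> solves a problem of the same type with the same coupling coefficients, with \<open>\<beta>\<^sub>j\<close>
replaced by \<open>\<beta>\<^sub>j + \<partial>\<^sub>t \<alpha>\<^sub>j\<close>, and with a boundary condition that is affine in the outflow values of \<open>w\<close>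
(\<open>mixed_solution_C1t\<close>). The condition with index \<open>l\<close> for the new problem is the one with \<open>l + 1\<close> for the
old one, since \<open>\<partial>\<^sub>t \<alpha>\<^sub>j = - \<partial>\<^sub>t a\<^sub>j / a\<^sub>j\<^sup>2\<close>; therefore the step can be repeated \<open>r\<close> times. Derivatives in \<open>x\<close>
come from the equation itself. The conclusion holds up to the boundary of the strip.
\<close>

section \<open>Calculus of the classes C^k\<close>

lemma Ck_on_SucI:
  assumes "\<And>p. p \<in> S \<Longrightarrow> (f has_derivative f' p) (at p within S)"
    and "\<And>v. Ck_on k (\<lambda>p. f' p v) S"
  shows "Ck_on (Suc k) f S"
  unfolding Ck_on.simps by (rule exI[of _ f']) (use assms in blast)

lemma Ck_on_SucE:
  assumes "Ck_on (Suc k) f S"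
  obtains f' where "\<And>p. p \<in> S \<Longrightarrow> (f has_derivative f' p) (at p within S)"
    and "\<And>v. Ck_on k (\<lambda>p. f' p v) S"
  using assms unfolding Ck_on.simps by blast

declare Ck_on.simps(2) [simp del]

lemma Ck_on_cong:
  assumes "Ck_on k f S" "\<And>p. p \<in> S \<Longrightarrow> f p = g p"
  shows "Ck_on k g S"
proof (cases k)
  case 0
  then show ?thesis using assms continuous_on_cong by force
next
  case (Suc k')
  from assms(1)[unfolded Suc] obtain f' where f': "\<And>p. p \<in> S \<Longrightarrow> (f has_derivative f' p) (at p within S)"
    "\<And>v. Ck_on k' (\<lambda>p. f' p v) S" by (rule Ck_on_SucE) (rule that)
  have "(g has_derivative f' p) (at p within S)" if "p \<in> S" for p
    by (rule has_derivative_transform[OF that _ f'(1)[OF that]]) (use assms(2) in auto)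
  then show ?thesis using f'(2) Suc by (auto intro: Ck_on_SucI)
qed

lemma Ck_on_SucD: "Ck_on (Suc k) f S \<Longrightarrow> Ck_on k f S"
proof (induction k arbitrary: f)
  case 0
  then show ?case
    by (auto simp: continuous_on_eq_continuous_within elim!: Ck_on_SucE
        intro: has_derivative_continuous)
next
  case (Suc k)
  from Suc.prems show ?case
    by (rule Ck_on_SucE) (rule Ck_on_SucI, assumption, rule Suc.IH, simp)
qed

lemma Ck_on_mono: "Ck_on k f S \<Longrightarrow> l \<le> k \<Longrightarrow> Ck_on l f S"
  by (induction k) (auto simp del: Ck_on.simps simp: le_Suc_eq dest: Ck_on_SucD)

lemma Ck_on_continuous_on: "Ck_on k f S \<Longrightarrow> continuous_on S f"
  using Ck_on_mono[of k f S 0] by simp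

lemma Ck_on_subset: "Ck_on k f S \<Longrightarrow> T \<subseteq> S \<Longrightarrow> Ck_on k f T"
proof (induction k arbitrary: f)
  case 0
  then show ?case using continuous_on_subset by auto
next
  case (Suc k)
  obtain f' where f': "\<And>p. p \<in> S \<Longrightarrow> (f has_derivative f' p) (at p within S)"
    "\<And>v. Ck_on k (\<lambda>p. f' p v) S" using Suc.prems(1) by (rule Ck_on_SucE) (rule that)
  show ?case
    by (rule Ck_on_SucI[where f'=f'])
      (use Suc.IH Suc.prems(2) f' in \<open>auto intro: has_derivative_subset\<close>)
qed

lemma Ck_on_const: "Ck_on k (\<lambda>p. c) S"
proof (induction k arbitrary: c)
  case (Suc k)
  show ?case by (rule Ck_on_SucI[where f'="\<lambda>p v. 0"]) (auto intro: Suc)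
qed simp

lemma Ck_on_add:
  "Ck_on k f S \<Longrightarrow> Ck_on k g S \<Longrightarrow> Ck_on k (\<lambda>p. f p + g p) S"
proof (induction k arbitrary: f g)
  case 0
  then show ?case by (auto intro!: continuous_on_add)
next
  case (Suc k)
  obtain f' where f': "\<And>p. p \<in> S \<Longrightarrow> (f has_derivative f' p) (at p within S)"
    "\<And>v. Ck_on k (\<lambda>p. f' p v) S" using Suc.prems(1) by (rule Ck_on_SucE) (rule that)
  obtain g' where g': "\<And>p. p \<in> S \<Longrightarrow> (g has_derivative g' p) (at p within S)"
    "\<And>v. Ck_on k (\<lambda>p. g' p v) S" using Suc.prems(2) by (rule Ck_on_SucE) (rule that)
  show ?case
    by (rule Ck_on_SucI[OF has_derivative_add[OF f'(1) g'(1)] Suc.IH[OF f'(2) g'(2)]])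
qed

lemma Ck_on_mult:
  "Ck_on k f S \<Longrightarrow> Ck_on k g S \<Longrightarrow> Ck_on k (\<lambda>p. f p * g p) S"
proof (induction k arbitrary: f g)
  case 0
  then show ?case by (auto intro!: continuous_on_mult)
next
  case (Suc k)
  obtain f' where f': "\<And>p. p \<in> S \<Longrightarrow> (f has_derivative f' p) (at p within S)"
    "\<And>v. Ck_on k (\<lambda>p. f' p v) S" using Suc.prems(1) by (rule Ck_on_SucE) (rule that)
  obtain g' where g': "\<And>p. p \<in> S \<Longrightarrow> (g has_derivative g' p) (at p within S)"
    "\<And>v. Ck_on k (\<lambda>p. g' p v) S" using Suc.prems(2) by (rule Ck_on_SucE) (rule that)
  show ?case
    by (rule Ck_on_SucI[OF has_derivative_mult[OF f'(1) g'(1)]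
          Ck_on_add[OF Suc.IH[OF Ck_on_SucD[OF Suc.prems(1)] g'(2)]
            Suc.IH[OF f'(2) Ck_on_SucD[OF Suc.prems(2)]]]])
qed

lemma Ck_on_minus: "Ck_on k f S \<Longrightarrow> Ck_on k (\<lambda>p. - f p) S"
  using Ck_on_mult[OF Ck_on_const[of k "-1"]] by simp

lemma Ck_on_diff:
  assumes "Ck_on k f S" "Ck_on k g S" shows "Ck_on k (\<lambda>p. f p - g p) S"
  using Ck_on_add[OF assms(1) Ck_on_minus[OF assms(2)]] by simp

lemma Ck_on_sum:
  "(\<And>i. i \<in> I \<Longrightarrow> Ck_on k (f i) S) \<Longrightarrow> Ck_on k (\<lambda>p. \<Sum>i\<in>I. f i p) S"
proof (induction I rule: infinite_finite_induct)
  case (insert i I)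
  then show ?case by (simp add: Ck_on_add)
qed (simp_all add: Ck_on_const)

lemma Ck_on_inverse:
  assumes "\<And>p. p \<in> S \<Longrightarrow> f p \<noteq> 0"
  shows "Ck_on k f S \<Longrightarrow> Ck_on k (\<lambda>p. inverse (f p)) S"
proof (induction k)
  case 0
  then show ?case using assms by (auto intro!: continuous_on_inverse)
next
  case (Suc k)
  obtain f' where f': "\<And>p. p \<in> S \<Longrightarrow> (f has_derivative f' p) (at p within S)"
    "\<And>v. Ck_on k (\<lambda>p. f' p v) S" using Suc.prems(1) by (rule Ck_on_SucE) (rule that)
  note inv = Suc.IH[OF Ck_on_SucD[OF Suc.prems]]
  show ?case
    by (rule Ck_on_SucI[OF Deriv.has_derivative_inverse[OF assms f'(1)]
          Ck_on_minus[OF Ck_on_mult[OF Ck_on_mult[OF inv f'(2)] inv]]])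
qed

lemma Ck_on_divide:
  assumes "Ck_on k f S" "Ck_on k g S" "\<And>p. p \<in> S \<Longrightarrow> g p \<noteq> 0"
  shows "Ck_on k (\<lambda>p. f p / g p) S"
  using Ck_on_mult[OF assms(1) Ck_on_inverse[OF assms(3,2)]] by (simp add: divide_inverse)

lemma has_derivative_vec_components:
  fixes z :: "'a::real_normed_vector \<Rightarrow> real ^ 'n"
  assumes "\<And>i. ((\<lambda>t. z t $ i) has_derivative z' i) (at a within S)"
  shows "(z has_derivative (\<lambda>s. \<chi> i. z' i s)) (at a within S)"
proof -
  have "((\<lambda>t. z t \<bullet> b) has_derivative (\<lambda>s. (\<chi> i. z' i s) \<bullet> b)) (at a within S)" if "b \<in> Basis" for b
  proof -
    from that obtain i where b: "b = axis i 1"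
      by (auto simp: Basis_vec_def)
    show ?thesis using assms[of i] unfolding b by (simp add: inner_axis)
  qed
  then show ?thesis
    by (subst has_derivative_componentwise_within) simp
qed

lemma Ck_on_compose_vec:
  fixes z :: "real \<Rightarrow> real ^ 'n"
  shows "Ck_on k h UNIV \<Longrightarrow> (\<And>i. Ck_on k (\<lambda>t. z t $ i) UNIV) \<Longrightarrow> Ck_on k (\<lambda>t. h (z t)) UNIV"
proof (induction k arbitrary: h)
  case 0
  have "continuous_on UNIV (\<lambda>t. \<chi> i. z t $ i)"
    by (rule continuous_on_vec_lambda) (use 0 in simp)
  then have "continuous_on UNIV z" by (simp only: vec_nth_inverse)
  with 0(1)[unfolded Ck_on.simps] show ?case
    unfolding Ck_on.simps by (rule continuous_on_compose2) simp
next
  case (Suc k)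
  obtain h' where h': "\<And>p. p \<in> UNIV \<Longrightarrow> (h has_derivative h' p) (at p)"
    "\<And>v. Ck_on k (\<lambda>p. h' p v) UNIV" using Suc.prems(1) by (rule Ck_on_SucE) (rule that)
  define d where "d i t = frechet_derivative (\<lambda>t. z t $ i) (at t)" for i t
  have d: "((\<lambda>t. z t $ i) has_derivative d i t) (at t) \<and> Ck_on k (\<lambda>t. d i t v) UNIV" for i t v
  proof -
    obtain e where e: "\<And>t. t \<in> UNIV \<Longrightarrow> ((\<lambda>t. z t $ i) has_derivative e t) (at t)"
      "\<And>v. Ck_on k (\<lambda>t. e t v) UNIV" using Suc.prems(2)[of i] by (rule Ck_on_SucE) (rule that)
    have "d i = e"
      unfolding d_def using frechet_derivative_at[OF e(1)[OF UNIV_I]] by (intro ext) (simp only:)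
    with e show ?thesis by blast
  qed
  have zd: "(z has_derivative (\<lambda>s. \<chi> i. d i t s)) (at t)" for t
    by (rule has_derivative_vec_components) (rule d[THEN conjunct1])
  have der: "((\<lambda>t. h (z t)) has_derivative (\<lambda>s. \<Sum>i\<in>UNIV. h' (z t) (axis i 1) * d i t s)) (at t)" for t
  proof -
    have "h' (z t) (\<chi> i. d i t s) = (\<Sum>i\<in>UNIV. h' (z t) (axis i 1) * d i t s)" for s
    proof -
      interpret bounded_linear "h' (z t)" using h'(1)[OF UNIV_I] by (rule has_derivative_bounded_linear)
      have "(\<chi> i. d i t s) = (\<Sum>i\<in>UNIV. d i t s *\<^sub>R axis i 1)"
        using basis_expansion[of "\<chi> i. d i t s"] by (simp add: scalar_mult_eq_scaleR)
      then show ?thesis by (simp only: sum scaleR real_scaleR_def mult.commute)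
    qed
    with has_derivative_compose[OF zd h'(1)[OF UNIV_I], of t] show ?thesis by (simp only:)
  qed
  show ?case
  proof (rule Ck_on_SucI[OF der])
    show "Ck_on k (\<lambda>t. \<Sum>i\<in>UNIV. h' (z t) (axis i 1) * d i t v) UNIV" for v
      by (rule Ck_on_sum[OF Ck_on_mult[OF Suc.IH[OF h'(2) Ck_on_SucD[OF Suc.prems(2)]]
              d[THEN conjunct2]]])
  qed
qed

lemma Ck_on_real_SucI:
  fixes g :: "real \<Rightarrow> real"
  assumes "\<And>t. (g has_real_derivative g' t) (at t)" "Ck_on k g' UNIV"
  shows "Ck_on (Suc k) g UNIV"
proof (rule Ck_on_SucI)
  show "(g has_derivative (*) (g' t)) (at t)" for t
    using assms(1) by (simp add: has_field_derivative_def)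
  show "Ck_on k (\<lambda>t. g' t * v) UNIV" for v
    by (rule Ck_on_mult[OF assms(2) Ck_on_const])
qed

lemma Ck_on_real_SucD:
  fixes g :: "real \<Rightarrow> real"
  assumes "Ck_on (Suc k) g UNIV" "\<And>t. (g has_real_derivative g' t) (at t)"
  shows "Ck_on k g' UNIV"
proof -
  obtain d where d: "\<And>t. t \<in> UNIV \<Longrightarrow> (g has_derivative d t) (at t)"
    "\<And>v. Ck_on k (\<lambda>t. d t v) UNIV" using assms(1) by (rule Ck_on_SucE) (rule that)
  have "d t 1 = g' t" for t
    using has_derivative_unique[OF d(1)[OF UNIV_I] assms(2)[unfolded has_field_derivative_def]]
    by simp
  with d(2)[of 1] show ?thesis by simp
qed

text \<open>Regularity is first gained in \<open>t\<close> only: \<open>C1t\<close> asks for a \<open>t\<close>-derivative that is continuous in both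
  variables and says nothing about \<open>x\<close>-derivatives.\<close>

definition C1t :: "(real \<times> real \<Rightarrow> real) \<Rightarrow> (real \<times> real \<Rightarrow> real) \<Rightarrow> bool" where
  "C1t v v' \<longleftrightarrow> continuous_on strip v \<and> continuous_on strip v' \<and>
     (\<forall>x\<in>{0..1}. \<forall>t. ((\<lambda>s. v (x, s)) has_real_derivative v' (x, t)) (at t))"

lemma C1tI:
  assumes "continuous_on strip v" "continuous_on strip v'"
    and "\<And>x t. x \<in> {0..1} \<Longrightarrow> ((\<lambda>s. v (x, s)) has_real_derivative v' (x, t)) (at t)"
  shows "C1t v v'"
  using assms by (simp add: C1t_def)

lemma C1tD:
  assumes "C1t v v'"
  shows "continuous_on strip v" "continuous_on strip v'"
    and "\<And>x t. x \<in> {0..1} \<Longrightarrow> ((\<lambda>s. v (x, s)) has_real_derivative v' (x, t)) (at t)"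
  using assms by (auto simp: C1t_def)

lemma C1t_unique: "C1t v v' \<Longrightarrow> C1t v v'' \<Longrightarrow> q \<in> strip \<Longrightarrow> v' q = v'' q"
  by (cases q) (auto dest!: C1tD(3) intro: DERIV_unique)

lemma C1t_add: "C1t f f' \<Longrightarrow> C1t g g' \<Longrightarrow> C1t (\<lambda>q. f q + g q) (\<lambda>q. f' q + g' q)"
  unfolding C1t_def by (auto intro!: continuous_on_add DERIV_add)

lemma C1t_diff: "C1t f f' \<Longrightarrow> C1t g g' \<Longrightarrow> C1t (\<lambda>q. f q - g q) (\<lambda>q. f' q - g' q)"
  unfolding C1t_def by (auto intro!: continuous_on_diff DERIV_diff)

lemma C1t_mult:
  "C1t f f' \<Longrightarrow> C1t g g' \<Longrightarrow> C1t (\<lambda>q. f q * g q) (\<lambda>q. f' q * g q + g' q * f q)"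
  unfolding C1t_def by (auto intro!: continuous_on_add continuous_on_mult DERIV_mult)

lemma C1t_exp: "C1t f f' \<Longrightarrow> C1t (\<lambda>q. exp (f q)) (\<lambda>q. exp (f q) * f' q)"
  unfolding C1t_def by (auto intro!: continuous_on_exp continuous_on_mult DERIV_fun_exp)

lemma C1t_minus: "C1t f f' \<Longrightarrow> C1t (\<lambda>q. - f q) (\<lambda>q. - f' q)"
  unfolding C1t_def by (auto intro!: continuous_on_minus DERIV_minus)

lemma C1t_sum:
  assumes "finite I" "\<And>i. i \<in> I \<Longrightarrow> C1t (f i) (f' i)"
  shows "C1t (\<lambda>q. \<Sum>i\<in>I. f i q) (\<lambda>q. \<Sum>i\<in>I. f' i q)"
  using assms unfolding C1t_def by (auto intro!: continuous_on_sum DERIV_sum)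

lemma C1t_if_joint:
  assumes "\<And>q. q \<in> strip \<Longrightarrow> (f has_derivative f' q) (at q within strip)"
    and "continuous_on strip (\<lambda>q. f' q (0, 1))"
  shows "C1t f (\<lambda>q. f' q (0, 1))"
proof (rule C1tI)
  show "continuous_on strip f"
    using assms(1) has_derivative_continuous continuous_on_eq_continuous_within by blast
next
  fix x t :: real assume x: "x \<in> {0..1}"
  have "((\<lambda>s. f (x, s)) has_derivative (\<lambda>s. f' (x, t) (0, s))) (at t within UNIV)"
    by (rule has_derivative_in_compose2[where g=f and f="Pair x" and t=strip and g'=f'])
      (use x assms(1) in \<open>auto intro!: derivative_eq_intros\<close>)
  moreover have "(\<lambda>s. f' (x, t) (0, s)) = (*) (f' (x, t) (0, 1))"
  proof
    fix s :: real
    have "bounded_linear (f' (x, t))" using has_derivative_bounded_linear[OF assms(1)] x by auto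
    from linear_scale[OF bounded_linear.linear[OF this], of s "(0, 1)"]
    show "f' (x, t) (0, s) = f' (x, t) (0, 1) * s" by simp
  qed
  ultimately show "((\<lambda>s. f (x, s)) has_real_derivative f' (x, t) (0, 1)) (at t)"
    by (simp add: has_field_derivative_def)
qed (rule assms(2))

lemma Ck_on_strip_SucE:
  assumes "Ck_on (Suc k) f strip"
  obtains fx ft where "C1t f ft" "Ck_on k fx strip" "Ck_on k ft strip"
    and "\<And>q. q \<in> strip \<Longrightarrow> (f has_derivative (\<lambda>d. fx q * fst d + ft q * snd d)) (at q within strip)"
proof -
  obtain f' where f': "\<And>q. q \<in> strip \<Longrightarrow> (f has_derivative f' q) (at q within strip)"
    "\<And>v. Ck_on k (\<lambda>q. f' q v) strip" using assms by (rule Ck_on_SucE) (rule that)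
  have eq: "f' q = (\<lambda>d. f' q (1, 0) * fst d + f' q (0, 1) * snd d)" if "q \<in> strip" for q
  proof
    fix d :: "real \<times> real"
    interpret bounded_linear "f' q" using f'(1)[OF that] by (rule has_derivative_bounded_linear)
    have "d = fst d *\<^sub>R (1, 0) + snd d *\<^sub>R (0, 1)" by (cases d) simp
    then have "f' q d = f' q (fst d *\<^sub>R (1, 0) + snd d *\<^sub>R (0, 1))" by simp
    then show "f' q d = f' q (1, 0) * fst d + f' q (0, 1) * snd d"
      by (simp only: add scaleR real_scaleR_def mult.commute)
  qed
  show ?thesis
  proof (rule that)
    show "C1t f (\<lambda>q. f' q (0, 1))" by (rule C1t_if_joint[OF f'(1) Ck_on_continuous_on[OF f'(2)]])
    show "(f has_derivative (\<lambda>d. f' q (1, 0) * fst d + f' q (0, 1) * snd d)) (at q within strip)"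
      if "q \<in> strip" for q
      using f'(1)[OF that] eq[OF that] by simp
  qed (rule f'(2))+
qed

lemma Ck_on_strip_SucI:
  assumes "\<And>q. q \<in> strip \<Longrightarrow> (f has_derivative (\<lambda>d. fx q * fst d + ft q * snd d)) (at q within strip)"
    and "Ck_on k fx strip" "Ck_on k ft strip"
  shows "Ck_on (Suc k) f strip"
proof (rule Ck_on_SucI[OF assms(1)])
  show "Ck_on k (\<lambda>q. fx q * fst v + ft q * snd v) strip" for v
    by (rule Ck_on_add[OF Ck_on_mult[OF assms(2) Ck_on_const] Ck_on_mult[OF assms(3) Ck_on_const]])
qed

lemma Ck_on_strip_C1t:
  assumes "Ck_on (Suc k) f strip" "C1t f f'"
  shows "Ck_on k f' strip"
proof -
  obtain ft where ft: "C1t f ft" "Ck_on k ft strip"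
    by (rule Ck_on_strip_SucE[OF assms(1)]) (rule that)
  show ?thesis by (rule Ck_on_cong[OF ft(2) C1t_unique[OF ft(1) assms(2)]])
qed

lemma Ck_on_strip_trace:
  assumes "Ck_on k f strip" "x \<in> {0..1}"
  shows "Ck_on k (\<lambda>t. f (x, t)) UNIV"
  using assms(1)
proof (induction k arbitrary: f)
  case 0
  then show ?case using assms(2)
    by (auto intro!: continuous_on_compose2[of strip f UNIV "Pair x"] continuous_intros)
next
  case (Suc k)
  obtain ft where ft: "C1t f ft" "Ck_on k ft strip"
    by (rule Ck_on_strip_SucE[OF Suc.prems]) (rule that)
  show ?case
    by (rule Ck_on_real_SucI[OF C1tD(3)[OF ft(1) assms(2)] Suc.IH[OF ft(2)]])
qed

lemma C1t_partial_t: "C1t f f' \<Longrightarrow> q \<in> strip \<Longrightarrow> partial_t f q = f' q"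
  by (cases q) (auto simp: partial_t_def dest!: C1tD(3) intro: DERIV_imp_deriv)

lemma C1t_cong: "C1t v v' \<Longrightarrow> (\<And>q. q \<in> strip \<Longrightarrow> v q = v2 q) \<Longrightarrow> (\<And>q. q \<in> strip \<Longrightarrow> v' q = v2' q) \<Longrightarrow> C1t v2 v2'"
  unfolding C1t_def by (auto cong: continuous_on_cong)

lemma C1t_partial_t_self: "C1t f f' \<Longrightarrow> C1t f (partial_t f)"
  by (rule C1t_cong) (simp_all add: C1t_partial_t)

lemma Ck_on_strip_partial_t:
  assumes "Ck_on (Suc k) f strip"
  shows "C1t f (partial_t f)" "Ck_on k (partial_t f) strip"
proof -
  obtain f' where "C1t f f'" by (rule Ck_on_strip_SucE[OF assms]) (rule that)
  then show C: "C1t f (partial_t f)" by (rule C1t_partial_t_self)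
  show "Ck_on k (partial_t f) strip" by (rule Ck_on_strip_C1t[OF assms C])
qed

lemma smooth_on_partial_t:
  assumes "smooth_on f strip"
  shows "C1t f (partial_t f)" "smooth_on (partial_t f) strip"
  using Ck_on_strip_partial_t assms unfolding smooth_on_def by blast+

lemma deriv_periodic:
  fixes g :: "real \<Rightarrow> real"
  assumes "\<And>t. (g has_real_derivative g' t) (at t)" "\<And>t. g (t + 2 * pi) = g t"
  shows "g' (t + 2 * pi) = g' t"
proof -
  have "((\<lambda>t. g (t + 2 * pi)) has_real_derivative g' (t + 2 * pi)) (at t)"
    using assms(1)[of "t + 2 * pi"] by (simp add: DERIV_shift)
  then show ?thesis unfolding assms(2) using assms(1) by (rule DERIV_unique)
qed

lemma periodic_t_C1t:
  assumes "C1t f f'" "periodic_t f"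
  shows "periodic_t f'"
  unfolding periodic_t_def
proof (intro ballI allI)
  fix x t :: real assume x: "x \<in> {0..1}"
  then show "f' (x, t + 2 * pi) = f' (x, t)"
    using assms(2) by (intro deriv_periodic[OF C1tD(3)[OF assms(1) x]]) (simp add: periodic_t_def)
qed

section \<open>Primitives of functions of two variables\<close>

text \<open>The integral of \<open>f\<close> from \<open>0\<close> to \<open>s\<close>, rescaled to the fixed interval \<open>[0, 1]\<close>. In this form
  the orientation for \<open>s < 0\<close> is automatic, and continuity and differentiability with respect to
  parameters follow from the corresponding facts on integrals over a fixed interval.\<close>

definition prim :: "(real \<Rightarrow> real) \<Rightarrow> real \<Rightarrow> real" where
  "prim f s = s * integral {0..1} (\<lambda>\<tau>. f (\<tau> * s))"

lemma prim_0 [simp]: "prim f 0 = 0"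
  by (simp add: prim_def)

lemma prim_eq_antiderivative:
  assumes "a \<le> 0" "0 \<le> b" "s \<in> {a..b}"
    and F: "\<And>r. r \<in> {a..b} \<Longrightarrow> (F has_real_derivative f r) (at r within {a..b})"
  shows "prim f s = F s - F 0"
proof -
  have seg: "\<tau> * s \<in> {a..b}" if "\<tau> \<in> {0..1}" for \<tau>
  proof -
    have "\<tau> * s + (1 - \<tau>) * 0 \<in> {a..b}"
      using convexD[of "{a..b}" s 0 \<tau> "1 - \<tau>"] that assms by simp
    then show ?thesis by simp
  qed
  have "((\<lambda>\<tau>. f (\<tau> * s) * s) has_integral F (1 * s) - F (0 * s)) {0..1}"
  proof (rule fundamental_theorem_of_calculus)
    fix \<tau> :: real assume "\<tau> \<in> {0..1}"
    have "((\<lambda>\<tau>. F (\<tau> * s)) has_real_derivative f (\<tau> * s) * s) (at \<tau> within {0..1})"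
    proof -
      have "(F has_real_derivative f (\<tau> * s)) (at (\<tau> * s) within (\<lambda>\<tau>. \<tau> * s) ` {0..1})"
        by (rule DERIV_subset[OF F]) (use seg \<open>\<tau> \<in> {0..1}\<close> in blast)+
      moreover have "((\<lambda>\<tau>. \<tau> * s) has_real_derivative s) (at \<tau> within {0..1})"
        using DERIV_cmult_right[OF DERIV_ident] by simp
      ultimately show ?thesis using DERIV_image_chain[of F _ "\<lambda>\<tau>. \<tau> * s"] by (simp add: o_def)
    qed
    then show "((\<lambda>\<tau>. F (\<tau> * s)) has_vector_derivative f (\<tau> * s) * s) (at \<tau> within {0..1})"
      by (simp add: has_real_derivative_iff_has_vector_derivative)
  qed simp
  from integral_unique[OF this] have "integral {0..1} (\<lambda>\<tau>. f (\<tau> * s)) * s = F s - F 0" by simp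
  then show ?thesis by (simp add: prim_def mult.commute)
qed

lemma prim_deriv_Icc:
  assumes "continuous_on {a..b} f" "a \<le> 0" "0 \<le> b" "s \<in> {a..b}"
  shows "(prim f has_real_derivative f s) (at s within {a..b})"
proof -
  obtain F where "\<And>r. r \<in> {a..b} \<Longrightarrow> (F has_vector_derivative f r) (at r within {a..b})"
    by (rule antiderivative_continuous[OF assms(1)]) (rule that)
  note F = this[folded has_real_derivative_iff_has_vector_derivative]
  have "((\<lambda>r. F r - F 0) has_real_derivative f s) (at s within {a..b})"
    using DERIV_diff[OF F[OF assms(4)] DERIV_const[of "F 0"]] by simp
  then show ?thesis
    by (rule has_field_derivative_transform_within[OF _ zero_less_one assms(4)])
      (use prim_eq_antiderivative[OF assms(2,3) _ F] in auto)
qed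

lemma prim_deriv_UNIV:
  assumes "continuous_on UNIV f"
  shows "(prim f has_real_derivative f s) (at s)"
proof -
  let ?N = "\<bar>s\<bar> + 1"
  have "(prim f has_real_derivative f s) (at s within {-?N..?N})"
    by (rule prim_deriv_Icc) (use assms continuous_on_subset in auto)
  then show ?thesis by (subst (asm) at_within_interior) auto
qed

lemma continuous_on_prim:
  fixes f :: "real \<Rightarrow> 'p::topological_space \<Rightarrow> real"
  assumes "continuous_on (S \<times> U) (\<lambda>(s, p). f s p)" "\<And>s \<tau>. s \<in> S \<Longrightarrow> \<tau> \<in> {0..1} \<Longrightarrow> \<tau> * s \<in> S"
  shows "continuous_on (S \<times> U) (\<lambda>(s, p). prim (\<lambda>r. f r p) s)"
proof -
  have "continuous_on ((S \<times> U) \<times> cbox 0 1) (\<lambda>(q, \<tau>). f (\<tau> * fst q) (snd q))"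
  proof -
    have c: "continuous_on ((S \<times> U) \<times> cbox 0 1) (\<lambda>(q, \<tau>). (\<tau> * fst q, snd q))"
      by (simp add: case_prod_unfold) (intro continuous_intros)
    have "(\<lambda>(q, \<tau>). (\<tau> * fst q, snd q)) ` ((S \<times> U) \<times> cbox (0::real) 1) \<subseteq> S \<times> U"
      using assms(2) by auto
    from continuous_on_compose2[OF assms(1) c this] show ?thesis by (simp add: case_prod_unfold)
  qed
  from integral_continuous_on_param[OF this] show ?thesis
    unfolding prim_def case_prod_unfold by (intro continuous_intros) (simp add: case_prod_unfold)
qed

lemma prim_deriv_param:
  fixes f :: "real \<Rightarrow> real \<Rightarrow> real"
  assumes "\<And>r p. r \<in> S \<Longrightarrow> p \<in> U \<Longrightarrow> ((\<lambda>p. f r p) has_real_derivative f' r p) (at p within U)"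
    and cf: "continuous_on (S \<times> U) (\<lambda>(s, p). f s p)" and cf': "continuous_on (S \<times> U) (\<lambda>(s, p). f' s p)"
    and seg: "\<And>s \<tau>. s \<in> S \<Longrightarrow> \<tau> \<in> {0..1} \<Longrightarrow> \<tau> * s \<in> S" and "convex U" "s \<in> S" "p \<in> U"
  shows "((\<lambda>p. prim (\<lambda>r. f r p) s) has_real_derivative prim (\<lambda>r. f' r p) s) (at p within U)"
proof -
  have "((\<lambda>p. integral (cbox 0 1) (\<lambda>\<tau>. f (\<tau> * s) p)) has_real_derivative
      integral (cbox 0 1) (\<lambda>\<tau>. f' (\<tau> * s) p)) (at p within U)"
  proof (rule leibniz_rule_field_derivative[where U=U])
    fix x :: real assume "x \<in> U"
    then have "continuous_on {0..1} (\<lambda>\<tau>. f (\<tau> * s) x)"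
    proof -
      have c: "continuous_on {0..1} (\<lambda>\<tau>. (\<tau> * s, x))" by (intro continuous_intros)
      have "(\<lambda>\<tau>. (\<tau> * s, x)) ` {0..1} \<subseteq> S \<times> U" using seg \<open>s \<in> S\<close> \<open>x \<in> U\<close> by auto
      from continuous_on_compose2[OF cf c this] show ?thesis by simp
    qed
    then show "(\<lambda>\<tau>. f (\<tau> * s) x) integrable_on cbox 0 1"
      by (simp add: integrable_continuous_interval)
  next
    show "continuous_on (U \<times> cbox 0 1) (\<lambda>(x, \<tau>). f' (\<tau> * s) x)"
    proof -
      have c: "continuous_on (U \<times> cbox 0 1) (\<lambda>(x, \<tau>). (\<tau> * s, x))"
        by (simp add: case_prod_unfold) (intro continuous_intros)
      have "(\<lambda>(x, \<tau>). (\<tau> * s, x)) ` (U \<times> cbox 0 1) \<subseteq> S \<times> U" using seg \<open>s \<in> S\<close> by auto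
      from continuous_on_compose2[OF cf' c this] show ?thesis by (simp add: case_prod_unfold)
    qed
  qed (use assms in auto)
  from DERIV_cmult[OF this, of s] show ?thesis by (simp add: prim_def)
qed

section \<open>Characteristics and their flow\<close>

lemma nonincreasing_from_0:
  fixes E :: "real \<Rightarrow> real"
  assumes "\<And>x. x \<in> {0..1} \<Longrightarrow> (E has_real_derivative E' x) (at x within {0..1})"
    and "\<And>x. x \<in> {0..1} \<Longrightarrow> E' x \<le> 0" and "x \<in> {0..1}"
  shows "E x \<le> E 0"
proof (cases "x = 0")
  case False
  have "\<exists>y\<in>{0<..<x}. E x - E 0 = (*) (E' y) (x - 0)"
  proof (rule mvt_simple)
    show "(E has_derivative (*) (E' y)) (at y within {0..x})" if "0 \<le> y" "y \<le> x" for y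
      using DERIV_subset[OF assms(1)[of y], of "{0..x}"] that assms(3)
      by (auto simp: has_field_derivative_def)
  qed (use False assms(3) in auto)
  then obtain y where "y \<in> {0<..<x}" "E x - E 0 = E' y * x" by auto
  with assms show ?thesis by (smt (verit) atLeastAtMost_iff greaterThanLessThan_iff mult_nonneg_nonneg
        mult_nonneg_nonpos2 mult.commute)
qed simp

lemma constant_from_0:
  fixes E :: "real \<Rightarrow> real"
  assumes "\<And>x. x \<in> {0..1} \<Longrightarrow> (E has_real_derivative 0) (at x within {0..1})" and "x \<in> {0..1}"
  shows "E x = E 0"
proof (rule antisym)
  show "E x \<le> E 0" by (rule nonincreasing_from_0[of E "\<lambda>x. 0"]) (use assms in auto)
  have "((\<lambda>x. - E x) has_real_derivative 0) (at y within {0..1})" if "y \<in> {0..1}" for y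
    using DERIV_minus[OF assms(1)[OF that]] by simp
  then have "- E x \<le> - E 0"
    by (rule nonincreasing_from_0[of "\<lambda>x. - E x" "\<lambda>x. 0"]) (use assms in auto)
  then show "E 0 \<le> E x" by simp
qed

lemma derivative_bound_from_0:
  fixes f g :: "real \<Rightarrow> real"
  assumes f: "\<And>x. x \<in> {0..1} \<Longrightarrow> (f has_real_derivative f' x) (at x within {0..1})"
    and g: "\<And>x. x \<in> {0..1} \<Longrightarrow> (g has_real_derivative g' x) (at x within {0..1})"
    and "\<And>x. x \<in> {0..1} \<Longrightarrow> \<bar>f' x\<bar> \<le> g' x" and "x \<in> {0..1}"
  shows "\<bar>f x - f 0\<bar> \<le> g x - g 0"
proof -
  have "f x - g x \<le> f 0 - g 0"
    by (rule nonincreasing_from_0[OF DERIV_diff[OF f g]]) (use assms(3,4) in \<open>force simp: abs_le_iff\<close>)+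
  moreover have "- f x - g x \<le> - f 0 - g 0"
    by (rule nonincreasing_from_0[OF DERIV_diff[OF DERIV_minus[OF f] g]])
      (use assms(3,4) in \<open>force simp: abs_le_iff\<close>)+
  ultimately show ?thesis by linarith
qed

lemma has_real_derivative_uniform_limit:
  fixes f :: "nat \<Rightarrow> real \<Rightarrow> real"
  assumes "convex S" "\<And>n x. x \<in> S \<Longrightarrow> (f n has_real_derivative f' n x) (at x within S)"
    and u: "uniform_limit S f' g' sequentially"
    and lim: "\<And>x. x \<in> S \<Longrightarrow> (\<lambda>n. f n x) \<longlonglongrightarrow> g x" and "x \<in> S"
  shows "(g has_real_derivative g' x) (at x within S)"
proof -
  have "\<exists>h. \<forall>x\<in>S. (\<lambda>n. f n x) \<longlonglongrightarrow> h x \<and> (h has_derivative (*) (g' x)) (at x within S)"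
  proof (rule has_derivative_sequence[OF \<open>convex S\<close>, where f'="\<lambda>n x. (*) (f' n x)"])
    show "(f n has_derivative (*) (f' n y)) (at y within S)" if "y \<in> S" for n y
      using assms(2)[OF that] by (simp add: has_field_derivative_def)
    show "\<forall>\<^sub>F n in sequentially. \<forall>x\<in>S. \<forall>h. norm (f' n x * h - g' x * h) \<le> e * norm h" if "e > 0" for e
      using uniform_limitD[OF u that]
    proof eventually_elim
      case (elim n)
      then have "\<bar>f' n x - g' x\<bar> * \<bar>h\<bar> \<le> e * \<bar>h\<bar>" if "x \<in> S" for x h
        using that by (intro mult_right_mono) (auto simp: dist_real_def less_imp_le)
      then show ?case by (simp add: abs_mult flip: left_diff_distrib)
    qed
    show "(\<lambda>n. f n x) \<longlonglongrightarrow> g x" by (rule lim) fact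
  qed fact
  then obtain h where h: "\<And>x. x \<in> S \<Longrightarrow> (\<lambda>n. f n x) \<longlonglongrightarrow> h x"
    "\<And>x. x \<in> S \<Longrightarrow> (h has_real_derivative g' x) (at x within S)"
    by (auto simp: has_field_derivative_def)
  have "h y = g y" if "y \<in> S" for y using h(1)[OF that] lim[OF that] by (rule LIMSEQ_unique)
  then show ?thesis
    using has_field_derivative_transform_within[OF h(2)[OF \<open>x \<in> S\<close>] zero_less_one \<open>x \<in> S\<close>] by blast
qed

lemma continuous_on_strip_compose:
  assumes "continuous_on strip g" "continuous_on A p" "continuous_on A k" "\<And>y. y \<in> A \<Longrightarrow> p y \<in> {0..1}"
  shows "continuous_on A (\<lambda>y. g (p y, k y))"
  by (rule continuous_on_compose2[OF assms(1) continuous_on_Pair[OF assms(2,3)]])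
    (use assms(4) in auto)

lemma continuous_on_strip_Lipschitz:
  fixes g :: "real \<times> real \<Rightarrow> real"
  assumes "\<And>x s y t. x \<in> {0..1} \<Longrightarrow> y \<in> {0..1} \<Longrightarrow> \<bar>g (x, s) - g (y, t)\<bar> \<le> A * (\<bar>x - y\<bar> + \<bar>s - t\<bar>)"
  shows "continuous_on strip g"
proof (cases "A = 0")
  case True
  then have "g q = g (0, 0)" if "q \<in> strip" for q
    using assms[of "fst q" 0 "snd q" 0] that by (cases q) auto
  then show ?thesis by (metis continuous_on_cong continuous_on_const)
next
  case False
  with assms[of 0 0 0 1] have "A > 0" by (simp add: less_le)
  have "dist (g p) (g q) \<le> (2 * A) * dist p q" if "p \<in> strip" "q \<in> strip" for p q
  proof -
    have "\<bar>fst p - fst q\<bar> \<le> dist p q" "\<bar>snd p - snd q\<bar> \<le> dist p q"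
      using dist_fst_le[of p q] dist_snd_le[of p q] by (simp_all add: dist_real_def)
    then have "A * (\<bar>fst p - fst q\<bar> + \<bar>snd p - snd q\<bar>) \<le> A * (2 * dist p q)"
      using \<open>A > 0\<close> by (intro mult_left_mono) auto
    moreover have "\<bar>g p - g q\<bar> \<le> A * (\<bar>fst p - fst q\<bar> + \<bar>snd p - snd q\<bar>)"
      using assms[of "fst p" "fst q" "snd p" "snd q"] that by auto
    ultimately show ?thesis by (simp add: dist_real_def)
  qed
  then have "(2 * A)-lipschitz_on strip g" using \<open>A > 0\<close> by (intro lipschitz_onI) auto
  then show ?thesis by (rule lipschitz_on_continuous_on)
qed

definition is_char :: "(real \<times> real \<Rightarrow> real) \<Rightarrow> (real \<Rightarrow> real) \<Rightarrow> bool" where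
  "is_char \<alpha> w \<longleftrightarrow> (\<forall>x\<in>{0..1}. (w has_real_derivative \<alpha> (x, w x)) (at x within {0..1}))"

lemma is_charD: "is_char \<alpha> w \<Longrightarrow> x \<in> {0..1} \<Longrightarrow> (w has_real_derivative \<alpha> (x, w x)) (at x within {0..1})"
  by (simp add: is_char_def)

lemma is_char_continuous: "is_char \<alpha> w \<Longrightarrow> continuous_on {0..1} w"
  by (rule DERIV_continuous_on) (rule is_charD)

lemma continuous_on_char:
  assumes "continuous_on strip g" "is_char \<alpha> w"
  shows "continuous_on {0..1} (\<lambda>x. g (x, w x))"
  by (rule continuous_on_strip_compose[OF assms(1) continuous_on_id is_char_continuous[OF assms(2)]]) simp

text \<open>Characteristics are written as graphs over \<open>x\<close>, so \<open>\<alpha>\<close> is the slope \<open>dt/dx\<close>, the reciprocal of the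
  propagation speed. The global bounds yield characteristics on all of \<open>[0, 1]\<close>.\<close>

locale speed =
  fixes \<alpha> \<alpha>' :: "real \<times> real \<Rightarrow> real"
  assumes C1: "C1t \<alpha> \<alpha>'" and bounded: "\<exists>L. \<forall>q\<in>strip. \<bar>\<alpha> q\<bar> \<le> L \<and> \<bar>\<alpha>' q\<bar> \<le> L"
begin

definition L :: real where
  "L = (SOME L. 0 < L \<and> (\<forall>q\<in>strip. \<bar>\<alpha> q\<bar> \<le> L \<and> \<bar>\<alpha>' q\<bar> \<le> L))"

lemma L: "0 < L" "\<And>q. q \<in> strip \<Longrightarrow> \<bar>\<alpha> q\<bar> \<le> L" "\<And>q. q \<in> strip \<Longrightarrow> \<bar>\<alpha>' q\<bar> \<le> L"
proof -
  obtain K where K: "\<forall>q\<in>strip. \<bar>\<alpha> q\<bar> \<le> K \<and> \<bar>\<alpha>' q\<bar> \<le> K" using bounded by blast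
  have "\<bar>\<alpha> q\<bar> \<le> \<bar>K\<bar> + 1 \<and> \<bar>\<alpha>' q\<bar> \<le> \<bar>K\<bar> + 1" if "q \<in> strip" for q
  proof -
    have "\<bar>\<alpha> q\<bar> \<le> K \<and> \<bar>\<alpha>' q\<bar> \<le> K" using K that by (rule bspec)
    then show ?thesis by linarith
  qed
  then have "0 < \<bar>K\<bar> + 1 \<and> (\<forall>q\<in>strip. \<bar>\<alpha> q\<bar> \<le> \<bar>K\<bar> + 1 \<and> \<bar>\<alpha>' q\<bar> \<le> \<bar>K\<bar> + 1)" by simp
  from someI[of "\<lambda>L. 0 < L \<and> (\<forall>q\<in>strip. \<bar>\<alpha> q\<bar> \<le> L \<and> \<bar>\<alpha>' q\<bar> \<le> L)", OF this, folded L_def]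
  show "0 < L" "\<And>q. q \<in> strip \<Longrightarrow> \<bar>\<alpha> q\<bar> \<le> L" "\<And>q. q \<in> strip \<Longrightarrow> \<bar>\<alpha>' q\<bar> \<le> L" by blast+
qed

lemma Lipschitz: "x \<in> {0..1} \<Longrightarrow> \<bar>\<alpha> (x, s) - \<alpha> (x, t)\<bar> \<le> L * \<bar>s - t\<bar>"
  using field_differentiable_bound[of UNIV "\<lambda>s. \<alpha> (x, s)" "\<lambda>t. \<alpha>' (x, t)" L s t] C1tD(3)[OF C1] L(3)
  by simp

text \<open>Gronwall's inequality in both directions: the weighted squared gaps \<open>d\<^sup>2 exp (\<mp>2Lx)\<close> are
  monotone.\<close>

lemma char_gap:
  assumes "is_char \<alpha> w" "is_char \<alpha> v" "x \<in> {0..1}"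
  shows "\<bar>w x - v x\<bar> \<le> exp L * \<bar>w 0 - v 0\<bar>" "\<bar>w 0 - v 0\<bar> \<le> exp L * \<bar>w x - v x\<bar>"
proof -
  define d where "d x = w x - v x" for x
  have d: "(d has_real_derivative \<alpha> (x, w x) - \<alpha> (x, v x)) (at x within {0..1})" if "x \<in> {0..1}" for x
    unfolding d_def using assms that by (intro DERIV_diff is_charD)
  have dL: "\<bar>d x * (\<alpha> (x, w x) - \<alpha> (x, v x))\<bar> \<le> L * (d x)\<^sup>2" if "x \<in> {0..1}" for x
  proof -
    have "\<bar>d x\<bar> * \<bar>\<alpha> (x, w x) - \<alpha> (x, v x)\<bar> \<le> \<bar>d x\<bar> * (L * \<bar>d x\<bar>)"
      using Lipschitz[OF that] by (intro mult_left_mono) (auto simp: d_def)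
    then have "\<bar>d x\<bar> * \<bar>\<alpha> (x, w x) - \<alpha> (x, v x)\<bar> \<le> L * \<bar>d x\<bar>\<^sup>2"
      by (simp only: power2_eq_square mult.left_commute)
    then show ?thesis by (simp add: abs_mult)
  qed
  have weighted: "((\<lambda>x. (d x)\<^sup>2 * exp (c * x)) has_real_derivative
      (2 * (d x * (\<alpha> (x, w x) - \<alpha> (x, v x))) + c * (d x)\<^sup>2) * exp (c * x)) (at x within {0..1})"
    if "x \<in> {0..1}" for x c
    by (rule derivative_eq_intros d[OF that] refl)+ (simp add: power2_eq_square algebra_simps)
  have "(d x)\<^sup>2 * exp (- 2 * L * x) \<le> (d 0)\<^sup>2 * exp (- 2 * L * 0)"
  proof (rule nonincreasing_from_0[OF weighted])
    fix y :: real assume "y \<in> {0..1}"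
    with dL[OF this] show "(2 * (d y * (\<alpha> (y, w y) - \<alpha> (y, v y))) + - 2 * L * (d y)\<^sup>2) * exp (- 2 * L * y) \<le> 0"
      by (intro mult_nonpos_nonneg) auto
  qed (use assms in auto)
  then have "(d x)\<^sup>2 \<le> (d 0)\<^sup>2 * exp (2 * L * x)" by (simp add: exp_minus field_simps)
  also have "\<dots> \<le> (d 0)\<^sup>2 * exp (2 * L)"
    using assms(3) L(1) by (intro mult_left_mono) auto
  finally have "(d x)\<^sup>2 \<le> (exp L * \<bar>d 0\<bar>)\<^sup>2" by (simp add: power_mult_distrib mult.commute flip: exp_double)
  then show "\<bar>w x - v x\<bar> \<le> exp L * \<bar>w 0 - v 0\<bar>" using abs_le_square_iff[of "d x" "exp L * \<bar>d 0\<bar>"] by (simp add: d_def)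
  have "- ((d x)\<^sup>2 * exp (2 * L * x)) \<le> - ((d 0)\<^sup>2 * exp (2 * L * 0))"
  proof (rule nonincreasing_from_0[OF DERIV_minus[OF weighted]])
    fix y :: real assume "y \<in> {0..1}"
    with dL[OF this] have "0 \<le> (2 * (d y * (\<alpha> (y, w y) - \<alpha> (y, v y))) + 2 * L * (d y)\<^sup>2) * exp (2 * L * y)"
      by (intro mult_nonneg_nonneg) auto
    then show "- ((2 * (d y * (\<alpha> (y, w y) - \<alpha> (y, v y))) + 2 * L * (d y)\<^sup>2) * exp (2 * L * y)) \<le> 0" by simp
  qed (use assms in auto)
  then have "(d 0)\<^sup>2 \<le> (d x)\<^sup>2 * exp (2 * L * x)" by simp
  also have "\<dots> \<le> (d x)\<^sup>2 * exp (2 * L)"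
    using assms(3) L(1) by (intro mult_left_mono) auto
  finally have "(d 0)\<^sup>2 \<le> (exp L * \<bar>d x\<bar>)\<^sup>2" by (simp add: power_mult_distrib mult.commute flip: exp_double)
  then show "\<bar>w 0 - v 0\<bar> \<le> exp L * \<bar>w x - v x\<bar>" using abs_le_square_iff[of "d 0" "exp L * \<bar>d x\<bar>"] by (simp add: d_def)
qed


lemma char_unique:
  "is_char \<alpha> w \<Longrightarrow> is_char \<alpha> v \<Longrightarrow> w y = v y \<Longrightarrow> y \<in> {0..1} \<Longrightarrow> x \<in> {0..1} \<Longrightarrow> w x = v x"
  using char_gap(2)[of w v y] char_gap(1)[of w v x] by simp

primrec picard :: "real \<Rightarrow> nat \<Rightarrow> real \<Rightarrow> real" where
  "picard \<sigma> 0 = (\<lambda>x. \<sigma>)"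
| "picard \<sigma> (Suc n) = (\<lambda>x. \<sigma> + prim (\<lambda>\<xi>. \<alpha> (\<xi>, picard \<sigma> n \<xi>)) x)"

lemma picard_deriv:
  "x \<in> {0..1} \<Longrightarrow> (picard \<sigma> (Suc n) has_real_derivative \<alpha> (x, picard \<sigma> n x)) (at x within {0..1})"
proof (induction n arbitrary: x)
  case 0
  have "continuous_on {0..1} (\<lambda>\<xi>. \<alpha> (\<xi>, \<sigma>))"
    by (rule continuous_on_strip_compose[OF C1tD(1)[OF C1]]) (auto intro: continuous_intros)
  from DERIV_add[OF DERIV_const prim_deriv_Icc[OF this, of x]] 0 show ?case by simp
next
  case (Suc n)
  have "continuous_on {0..1} (picard \<sigma> (Suc n))" by (rule DERIV_continuous_on) (rule Suc.IH)
  then have "continuous_on {0..1} (\<lambda>\<xi>. \<alpha> (\<xi>, picard \<sigma> (Suc n) \<xi>))"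
    by (intro continuous_on_strip_compose[OF C1tD(1)[OF C1]]) (auto intro: continuous_intros)
  from DERIV_add[OF DERIV_const prim_deriv_Icc[OF this, of x]] Suc.prems show ?case
    by (simp only: picard.simps(2)[of \<sigma> "Suc n"]) simp
qed

lemma picard_at_0: "picard \<sigma> n 0 = \<sigma>"
  by (cases n) auto

text \<open>Relative to the weight \<open>exp (2Lx)\<close> the Picard map halves distances on the whole interval at once, so
  that no subdivision into short intervals is required.\<close>

lemma picard_step:
  "x \<in> {0..1} \<Longrightarrow> \<bar>picard \<sigma> (Suc n) x - picard \<sigma> n x\<bar> \<le> L * (1/2) ^ n * exp (2 * L * x)"
proof (induction n arbitrary: x)
  case 0
  have "\<bar>picard \<sigma> (Suc 0) x - picard \<sigma> (Suc 0) 0\<bar> \<le> L * x - L * 0"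
  proof (rule derivative_bound_from_0[OF picard_deriv _ _ 0])
    show "((*) L has_real_derivative L) (at y within {0..1})" for y
      using DERIV_cmult[OF DERIV_ident, of L] by simp
  qed (use L(2) in auto)
  also have "\<dots> \<le> L * exp (2 * L * x)"
    using 0 L(1) exp_ge_add_one_self[of "2 * L * x"] by (smt (verit) atLeastAtMost_iff
        mult_left_mono mult_nonneg_nonneg)
  finally show ?case by (simp only: picard_at_0) simp
next
  case (Suc n)
  let ?K = "L * (1/2) ^ Suc n"
  let ?d = "\<lambda>x. picard \<sigma> (Suc (Suc n)) x - picard \<sigma> (Suc n) x"
  have "\<bar>?d x - ?d 0\<bar> \<le> ?K * exp (2 * L * x) - ?K * exp (2 * L * 0)"
  proof (rule derivative_bound_from_0[OF DERIV_diff[OF picard_deriv picard_deriv] _ _ Suc.prems])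
    show "((\<lambda>x. ?K * exp (2 * L * x)) has_real_derivative L * (L * (1/2) ^ n * exp (2 * L * y)))
        (at y within {0..1})" for y
      by (rule derivative_eq_intros refl)+ simp
    show "\<bar>\<alpha> (y, picard \<sigma> (Suc n) y) - \<alpha> (y, picard \<sigma> n y)\<bar> \<le> L * (L * (1/2) ^ n * exp (2 * L * y))"
      if "y \<in> {0..1}" for y
      using Lipschitz[OF that] Suc.IH[OF that] L(1)
      by (meson less_imp_le mult_left_mono order_trans)
  qed
  moreover have "?d 0 = 0" by (simp only: picard_at_0)
  moreover have "0 \<le> ?K * exp (2 * L * 0)" using L(1) by simp
  ultimately show ?case by linarith
qed

lemma char_exists: "\<exists>w. is_char \<alpha> w \<and> w 0 = \<sigma>"
proof -
  let ?p = "picard \<sigma>"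
  define M where "M n = L * exp (2 * L) * (1/2) ^ n" for n :: nat
  have M: "norm (?p (Suc n) x - ?p n x) \<le> M n" if "x \<in> {0..1}" for n x
  proof -
    have "\<bar>?p (Suc n) x - ?p n x\<bar> \<le> L * (1/2) ^ n * exp (2 * L * x)" by (rule picard_step[OF that])
    also have "\<dots> \<le> L * (1/2) ^ n * exp (2 * L)"
      using that L(1) by (intro mult_left_mono) auto
    finally show ?thesis by (simp add: M_def mult.commute mult.left_commute)
  qed
  have "summable M" unfolding M_def by (intro summable_mult summable_geometric) simp
  from Weierstrass_m_test[OF M this]
  obtain s where "uniform_limit {0..1} (\<lambda>n x. \<Sum>i<n. ?p (Suc i) x - ?p i x) s sequentially" ..
  then have "uniform_limit {0..1} (\<lambda>n x. ?p n x - \<sigma>) s sequentially"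
    using sum_lessThan_telescope[of "\<lambda>i. ?p i x" for x] by simp
  then have "uniform_limit {0..1} (\<lambda>n x. (?p n x - \<sigma>) + \<sigma>) (\<lambda>x. s x + \<sigma>) sequentially"
    by (intro uniform_limit_add uniform_limit_const)
  then have u: "uniform_limit {0..1} ?p (\<lambda>x. s x + \<sigma>) sequentially" by simp
  define w where "w x = s x + \<sigma>" for x
  have lim: "(\<lambda>n. ?p n x) \<longlonglongrightarrow> w x" if "x \<in> {0..1}" for x
    using tendsto_uniform_limitI[OF u that] by (simp add: w_def)
  have u': "uniform_limit {0..1} (\<lambda>n x. \<alpha> (x, ?p n x)) (\<lambda>x. \<alpha> (x, w x)) sequentially"
  proof (rule uniform_limitI)
    fix e :: real assume "e > 0"
    from uniform_limitD[OF u, of "e / L"] \<open>e > 0\<close> L(1)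
    have "\<forall>\<^sub>F n in sequentially. \<forall>x\<in>{0..1}. dist (?p n x) (w x) < e / L" by (simp add: w_def)
    then show "\<forall>\<^sub>F n in sequentially. \<forall>x\<in>{0..1}. dist (\<alpha> (x, ?p n x)) (\<alpha> (x, w x)) < e"
    proof eventually_elim
      case (elim n)
      show ?case
      proof
        fix x :: real assume x: "x \<in> {0..1}"
        have "L * \<bar>?p n x - w x\<bar> < e"
          using elim[rule_format, OF x] L(1) by (simp add: dist_real_def field_simps)
        with Lipschitz[OF x, of "?p n x" "w x"] show "dist (\<alpha> (x, ?p n x)) (\<alpha> (x, w x)) < e"
          by (simp add: dist_real_def)
      qed
    qed
  qed
  have "is_char \<alpha> w" unfolding is_char_def
  proof
    fix x :: real assume "x \<in> {0..1}"
    from has_real_derivative_uniform_limit[OF _ picard_deriv u' LIMSEQ_Suc[OF lim] this]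
    show "(w has_real_derivative \<alpha> (x, w x)) (at x within {0..1})" by simp
  qed
  moreover have "w 0 = \<sigma>" using LIMSEQ_unique[OF lim[of 0]] by (simp add: picard_at_0)
  ultimately show ?thesis by blast
qed

text \<open>Every characteristic is labelled by its value at \<open>x = 0\<close>.\<close>

definition flow :: "real \<times> real \<Rightarrow> real" where
  "flow = (\<lambda>(x, \<sigma>). (SOME w. is_char \<alpha> w \<and> w 0 = \<sigma>) x)"

lemma flow_char: "is_char \<alpha> (\<lambda>x. flow (x, \<sigma>))" and flow_0 [simp]: "flow (0, \<sigma>) = \<sigma>"
  using someI_ex[OF char_exists[of \<sigma>]] by (simp_all add: flow_def)

lemma char_eq_flow: "is_char \<alpha> w \<Longrightarrow> x \<in> {0..1} \<Longrightarrow> w x = flow (x, w 0)"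
  using char_unique[OF _ flow_char, of w 0 "w 0" x] by simp

lemma flow_gap:
  assumes "x \<in> {0..1}"
  shows "\<bar>flow (x, s) - flow (x, t)\<bar> \<le> exp L * \<bar>s - t\<bar>"
    and "\<bar>s - t\<bar> \<le> exp L * \<bar>flow (x, s) - flow (x, t)\<bar>"
  using char_gap[OF flow_char[of s] flow_char[of t] assms] by simp_all

lemma flow_Lipschitz_x:
  assumes "x \<in> {0..1}" "y \<in> {0..1}"
  shows "\<bar>flow (x, s) - flow (y, s)\<bar> \<le> L * \<bar>x - y\<bar>"
  using field_differentiable_bound[of "{0..1}" "\<lambda>x. flow (x, s)" "\<lambda>x. \<alpha> (x, flow (x, s))" L x y]
    is_charD[OF flow_char] L(2) assms by simp

lemma continuous_flow: "continuous_on strip flow"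
proof (rule continuous_on_strip_Lipschitz[where A="exp L + L"])
  fix x s y t :: real assume xy: "x \<in> {0..1}" "y \<in> {0..1}"
  have "\<bar>flow (x, s) - flow (y, t)\<bar> \<le> exp L * \<bar>s - t\<bar> + L * \<bar>x - y\<bar>"
    using flow_gap(1)[OF xy(1), of s t] flow_Lipschitz_x[OF xy, of t] by linarith
  also have "\<dots> \<le> (exp L + L) * (\<bar>x - y\<bar> + \<bar>s - t\<bar>)"
    using L(1) by (simp add: distrib_left distrib_right)
  finally show "\<bar>flow (x, s) - flow (y, t)\<bar> \<le> (exp L + L) * (\<bar>x - y\<bar> + \<bar>s - t\<bar>)" .
qed

definition flow_deriv :: "real \<times> real \<Rightarrow> real" where
  "flow_deriv = (\<lambda>(x, \<sigma>). exp (prim (\<lambda>\<xi>. \<alpha>' (\<xi>, flow (\<xi>, \<sigma>))) x))"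

lemma flow_deriv_pos [simp]: "0 < flow_deriv q" "flow_deriv q \<noteq> 0"
  by (simp_all add: flow_deriv_def case_prod_unfold)

lemma continuous_along_flow:
  "continuous_on strip g \<Longrightarrow> continuous_on strip (\<lambda>q. g (fst q, flow q))"
  by (rule continuous_on_strip_compose) (auto intro: continuous_intros continuous_flow)

lemma continuous_flow_deriv: "continuous_on strip flow_deriv"
proof -
  have "continuous_on strip (\<lambda>(x, \<sigma>). prim (\<lambda>\<xi>. \<alpha>' (\<xi>, flow (\<xi>, \<sigma>))) x)"
    by (rule continuous_on_prim)
      (use continuous_along_flow[OF C1tD(2)[OF C1]] in \<open>auto simp: case_prod_unfold mult_le_one\<close>)
  then show ?thesis unfolding flow_deriv_def case_prod_unfold by (rule continuous_on_exp)
qed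

lemma flow_deriv_char:
  assumes "x \<in> {0..1}"
  shows "((\<lambda>x. flow_deriv (x, \<sigma>)) has_real_derivative \<alpha>' (x, flow (x, \<sigma>)) * flow_deriv (x, \<sigma>))
    (at x within {0..1})"
  unfolding flow_deriv_def prod.case
  by (rule derivative_eq_intros prim_deriv_Icc continuous_on_char[OF C1tD(2)[OF C1] flow_char] refl
      | use assms in simp)+

text \<open>The gap \<open>d\<close> of two characteristics solves the linear equation \<open>d' = q d\<close>, where \<open>q\<close> is the mean
  of \<open>\<alpha>'\<close> over the segment between them; hence \<open>d\<close> is the initial gap times an exponential, and this
  exponential is continuous in the initial values.\<close>

lemma flow_has_derivative:
  assumes x: "x \<in> {0..1}"
  shows "((\<lambda>s. flow (x, s)) has_real_derivative flow_deriv (x, \<sigma>)) (at \<sigma>)"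
proof -
  define q where
    "q \<xi> s = integral {0..1} (\<lambda>\<theta>. \<alpha>' (\<xi>, flow (\<xi>, \<sigma>) + \<theta> * (flow (\<xi>, s) - flow (\<xi>, \<sigma>))))" for \<xi> s
  have \<alpha>'_line: "continuous_on UNIV (\<lambda>r. \<alpha>' (\<xi>, c + r))" if "\<xi> \<in> {0..1}" for \<xi> c
    by (rule continuous_on_strip_compose[OF C1tD(2)[OF C1]]) (use that in \<open>auto intro!: continuous_intros\<close>)
  have mean: "\<alpha> (\<xi>, t) - \<alpha> (\<xi>, c) = (t - c) * integral {0..1} (\<lambda>\<theta>. \<alpha>' (\<xi>, c + \<theta> * (t - c)))"
    if "\<xi> \<in> {0..1}" for \<xi> c t
  proof -
    have "prim (\<lambda>r. \<alpha>' (\<xi>, c + r)) (t - c) = (\<lambda>r. \<alpha> (\<xi>, c + r)) (t - c) - (\<lambda>r. \<alpha> (\<xi>, c + r)) 0"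
    proof (rule prim_eq_antiderivative[of "-\<bar>t - c\<bar>" "\<bar>t - c\<bar>"])
      show "((\<lambda>r. \<alpha> (\<xi>, c + r)) has_real_derivative \<alpha>' (\<xi>, c + r)) (at r within A)" for r A
        using C1tD(3)[OF C1 that, of "c + r"] DERIV_shift[of "\<lambda>s. \<alpha> (\<xi>, s)" _ r c]
        by (auto simp: add.commute intro: DERIV_subset)
    qed auto
    then show ?thesis by (simp add: prim_def)
  qed
  have cq: "continuous_on strip (\<lambda>(\<xi>, s). q \<xi> s)"
  proof -
    have "continuous_on (strip \<times> cbox 0 1)
        (\<lambda>y. \<alpha>' (fst (fst y), flow (fst (fst y), \<sigma>) + snd y * (flow (fst (fst y), snd (fst y)) - flow (fst (fst y), \<sigma>))))"
      by (intro continuous_on_strip_compose[OF C1tD(2)[OF C1]] continuous_intros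
            continuous_on_strip_compose[OF continuous_flow]) auto
    then have "continuous_on (strip \<times> cbox 0 1)
        (\<lambda>(p, \<theta>). \<alpha>' (fst p, flow (fst p, \<sigma>) + \<theta> * (flow (fst p, snd p) - flow (fst p, \<sigma>))))"
      by (simp add: case_prod_unfold)
    from integral_continuous_on_param[OF this] show ?thesis by (simp add: q_def case_prod_unfold)
  qed
  have cq1: "continuous_on {0..1} (\<lambda>\<xi>. q \<xi> s)" for s
    using continuous_on_strip_compose[OF cq, of "{0..1}" "\<lambda>\<xi>. \<xi>" "\<lambda>\<xi>. s"] by (simp add: continuous_on_id)
  have gap: "flow (x, s) - flow (x, \<sigma>) = (s - \<sigma>) * exp (prim (\<lambda>\<xi>. q \<xi> s) x)" for s
  proof -
    define d where "d x = flow (x, s) - flow (x, \<sigma>)" for x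
    have d': "(d has_real_derivative d y * q y s) (at y within {0..1})" if "y \<in> {0..1}" for y
      using DERIV_diff[OF is_charD[OF flow_char[of s] that] is_charD[OF flow_char[of \<sigma>] that]]
      unfolding mean[OF that] by (simp add: d_def[abs_def] q_def)
    have "((\<lambda>x. d x * exp (- prim (\<lambda>\<xi>. q \<xi> s) x)) has_real_derivative 0) (at y within {0..1})"
      if "y \<in> {0..1}" for y
      by (rule derivative_eq_intros prim_deriv_Icc cq1 d'[OF that] refl | use that in simp)+
    from constant_from_0[OF this x] have "d x * exp (- prim (\<lambda>\<xi>. q \<xi> s) x) = s - \<sigma>"
      by (simp add: d_def)
    then show ?thesis by (simp add: d_def exp_minus field_simps)
  qed
  have "continuous_on strip (\<lambda>(x, s). prim (\<lambda>\<xi>. q \<xi> s) x)"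
    by (rule continuous_on_prim[OF cq]) (auto simp: mult_le_one)
  from continuous_on_strip_compose[OF this, of UNIV "\<lambda>s. x" "\<lambda>s. s"] x
  have "continuous_on UNIV (\<lambda>s. exp (prim (\<lambda>\<xi>. q \<xi> s) x))"
    by (intro continuous_on_exp) (simp add: continuous_on_id continuous_on_const)
  then have "(\<lambda>s. exp (prim (\<lambda>\<xi>. q \<xi> s) x)) \<midarrow>\<sigma>\<rightarrow> exp (prim (\<lambda>\<xi>. q \<xi> \<sigma>) x)"
    by (simp add: continuous_on_eq_continuous_at isCont_def)
  moreover have "exp (prim (\<lambda>\<xi>. q \<xi> \<sigma>) x) = flow_deriv (x, \<sigma>)" by (simp add: flow_deriv_def q_def)
  ultimately have "(\<lambda>s. exp (prim (\<lambda>\<xi>. q \<xi> s) x)) \<midarrow>\<sigma>\<rightarrow> flow_deriv (x, \<sigma>)" by simp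
  then have "(\<lambda>s. (flow (x, s) - flow (x, \<sigma>)) / (s - \<sigma>)) \<midarrow>\<sigma>\<rightarrow> flow_deriv (x, \<sigma>)"
    by (rule Lim_transform_eventually) (auto simp: gap eventually_at_filter)
  then show ?thesis by (simp add: has_field_derivative_iff)
qed

text \<open>The inverse of the flow: the time at which the characteristic through \<open>(x, t)\<close> meets \<open>x = 0\<close>.\<close>

definition foot :: "real \<times> real \<Rightarrow> real" where
  "foot = (\<lambda>(x, t). SOME \<sigma>. flow (x, \<sigma>) = t)"

lemma flow_foot [simp]: assumes "x \<in> {0..1}" shows "flow (x, foot (x, t)) = t"
proof -
  have near: "\<bar>flow (x, s) - s\<bar> \<le> L" for s
  proof -
    have "\<bar>flow (x, s) - flow (0, s)\<bar> \<le> L * \<bar>x - 0\<bar>" by (rule flow_Lipschitz_x) (use assms in auto)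
    also have "\<dots> \<le> L" using assms L(1) by (simp add: mult_left_le)
    finally show ?thesis by simp
  qed
  have "\<exists>\<sigma>\<ge>t - L. \<sigma> \<le> t + L \<and> flow (x, \<sigma>) = t"
  proof (rule IVT')
    show "continuous_on {t - L..t + L} (\<lambda>\<sigma>. flow (x, \<sigma>))"
      by (rule continuous_on_strip_compose[OF continuous_flow])
        (use assms in \<open>auto intro: continuous_intros\<close>)
  qed (use near[of "t - L"] near[of "t + L"] L(1) in auto)
  then have "\<exists>\<sigma>. flow (x, \<sigma>) = t" by blast
  from someI_ex[OF this] show ?thesis by (simp add: foot_def)
qed

lemma foot_flow [simp]: assumes "x \<in> {0..1}" shows "foot (x, flow (x, \<sigma>)) = \<sigma>"
  using flow_gap(2)[OF assms, of "foot (x, flow (x, \<sigma>))" \<sigma>] assms by simp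

lemma continuous_foot: "continuous_on strip foot"
proof (rule continuous_on_strip_Lipschitz[where A="exp L * (1 + L)"])
  fix x s y t :: real assume xy: "x \<in> {0..1}" "y \<in> {0..1}"
  let ?\<sigma> = "foot (y, t)"
  have "\<bar>foot (x, s) - ?\<sigma>\<bar> \<le> exp L * \<bar>s - flow (x, ?\<sigma>)\<bar>"
    using flow_gap(2)[OF xy(1), of "foot (x, s)" ?\<sigma>] xy by simp
  also have "\<dots> \<le> exp L * (\<bar>s - t\<bar> + L * \<bar>x - y\<bar>)"
    using flow_Lipschitz_x[OF xy, of ?\<sigma>] xy by (intro mult_left_mono) auto
  also have "\<dots> \<le> exp L * ((1 + L) * (\<bar>x - y\<bar> + \<bar>s - t\<bar>))"
    using L(1) by (intro mult_left_mono) (simp_all add: distrib_left distrib_right)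
  finally show "\<bar>foot (x, s) - foot (y, t)\<bar> \<le> exp L * (1 + L) * (\<bar>x - y\<bar> + \<bar>s - t\<bar>)" by simp
qed

lemma C1t_foot: "C1t foot (\<lambda>q. 1 / flow_deriv (fst q, foot q))"
proof (rule C1tI[OF continuous_foot])
  show "continuous_on strip (\<lambda>q. 1 / flow_deriv (fst q, foot q))"
    by (intro continuous_on_divide continuous_on_const continuous_on_strip_compose[OF continuous_flow_deriv]
        continuous_on_fst continuous_on_id continuous_foot) auto
  fix x t :: real assume x: "x \<in> {0..1}"
  have "isCont (\<lambda>s. foot (x, s)) t"
    using continuous_on_strip_compose[OF continuous_foot, of UNIV "\<lambda>s. x" "\<lambda>s. s"] x
    by (simp add: continuous_on_eq_continuous_at continuous_on_id continuous_on_const)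
  then have "((\<lambda>s. foot (x, s)) has_real_derivative inverse (flow_deriv (x, foot (x, t)))) (at t)"
    by (intro DERIV_inverse_function[where f="\<lambda>s. flow (x, s)" and a="t - 1" and b="t + 1"]
        flow_has_derivative x) (use x in auto)
  then show "((\<lambda>s. foot (x, s)) has_real_derivative 1 / flow_deriv (fst (x, t), foot (x, t))) (at t)"
    by (simp add: inverse_eq_divide)
qed

end

section \<open>Transport equations\<close>

text \<open>\<open>transport \<alpha> v g\<close> is the meaning given here to \<open>\<partial>\<^sub>x v + \<alpha> \<partial>\<^sub>t v = g\<close> for functions that are merely
  continuous: \<open>v\<close> need only be differentiable along the characteristics of \<open>\<alpha>\<close>.\<close>

definition transport ::
  "(real \<times> real \<Rightarrow> real) \<Rightarrow> (real \<times> real \<Rightarrow> real) \<Rightarrow> (real \<times> real \<Rightarrow> real) \<Rightarrow> bool" where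
  "transport \<alpha> v g \<longleftrightarrow> continuous_on strip v \<and> continuous_on strip g \<and>
     (\<forall>w. is_char \<alpha> w \<longrightarrow>
       (\<forall>x\<in>{0..1}. ((\<lambda>x. v (x, w x)) has_real_derivative g (x, w x)) (at x within {0..1})))"

lemma transportI:
  assumes "continuous_on strip v" "continuous_on strip g"
    and "\<And>w x. is_char \<alpha> w \<Longrightarrow> x \<in> {0..1} \<Longrightarrow>
      ((\<lambda>x. v (x, w x)) has_real_derivative g (x, w x)) (at x within {0..1})"
  shows "transport \<alpha> v g"
  using assms by (simp add: transport_def)

lemma transportD:
  assumes "transport \<alpha> v g"
  shows "continuous_on strip v" "continuous_on strip g"
    and "\<And>w x. is_char \<alpha> w \<Longrightarrow> x \<in> {0..1} \<Longrightarrow>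
      ((\<lambda>x. v (x, w x)) has_real_derivative g (x, w x)) (at x within {0..1})"
  using assms by (simp_all add: transport_def)

lemma transport_cong:
  assumes "transport \<alpha> v g" "\<And>q. q \<in> strip \<Longrightarrow> v q = v2 q" "\<And>q. q \<in> strip \<Longrightarrow> g q = g2 q"
  shows "transport \<alpha> v2 g2"
proof (rule transportI)
  show "continuous_on strip v2" "continuous_on strip g2"
    using continuous_on_cong[OF refl assms(2), THEN iffD1, OF _ transportD(1)[OF assms(1)]]
      continuous_on_cong[OF refl assms(3), THEN iffD1, OF _ transportD(2)[OF assms(1)]] by simp_all
  fix w x assume "is_char \<alpha> w" and x: "x \<in> {0..(1::real)}"
  from has_field_derivative_transform_within[OF transportD(3)[OF assms(1) this] zero_less_one x]
  show "((\<lambda>x. v2 (x, w x)) has_real_derivative g2 (x, w x)) (at x within {0..1})"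
    using assms(2,3) x by simp
qed

lemma transport_add:
  "transport \<alpha> v g \<Longrightarrow> transport \<alpha> v2 g2 \<Longrightarrow> transport \<alpha> (\<lambda>q. v q + v2 q) (\<lambda>q. g q + g2 q)"
  unfolding transport_def by (auto intro!: continuous_on_add DERIV_add)

lemma transport_sum:
  assumes "finite I" "\<And>i. i \<in> I \<Longrightarrow> transport \<alpha> (v i) (g i)"
  shows "transport \<alpha> (\<lambda>q. \<Sum>i\<in>I. v i q) (\<lambda>q. \<Sum>i\<in>I. g i q)"
  using assms unfolding transport_def by (auto intro!: continuous_on_sum DERIV_sum)

lemma transport_mult:
  "transport \<alpha> v g \<Longrightarrow> transport \<alpha> v2 g2 \<Longrightarrow>
    transport \<alpha> (\<lambda>q. v q * v2 q) (\<lambda>q. g q * v2 q + g2 q * v q)"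
  unfolding transport_def by (auto intro!: continuous_on_add continuous_on_mult DERIV_mult)

lemma transport_exp: "transport \<alpha> v g \<Longrightarrow> transport \<alpha> (\<lambda>q. exp (v q)) (\<lambda>q. exp (v q) * g q)"
  unfolding transport_def
  by (auto intro!: continuous_on_exp continuous_on_mult DERIV_chain2[OF DERIV_exp])

lemma transport_if_joint:
  assumes v: "\<And>q. q \<in> strip \<Longrightarrow> (v has_derivative (\<lambda>d. vx q * fst d + vt q * snd d)) (at q within strip)"
    and c: "continuous_on strip vx" "continuous_on strip vt" "continuous_on strip \<alpha>"
  shows "transport \<alpha> v (\<lambda>q. vx q + \<alpha> q * vt q)"
proof (rule transportI)
  show "continuous_on strip v"
    using v has_derivative_continuous continuous_on_eq_continuous_within by blast
  show "continuous_on strip (\<lambda>q. vx q + \<alpha> q * vt q)"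
    by (intro continuous_on_add continuous_on_mult c)
  fix w x assume w: "is_char \<alpha> w" and x: "x \<in> {0..(1::real)}"
  have w': "((\<lambda>x. (x, w x)) has_derivative (\<lambda>h. (h, \<alpha> (x, w x) * h))) (at x within {0..1})"
    using is_charD[OF w x] by (intro has_derivative_Pair has_derivative_ident) (simp add: has_field_derivative_def)
  have "((\<lambda>x. v (x, w x)) has_derivative
      (\<lambda>h. vx (x, w x) * fst (h, \<alpha> (x, w x) * h) + vt (x, w x) * snd (h, \<alpha> (x, w x) * h))) (at x within {0..1})"
    by (rule has_derivative_in_compose2[OF v _ x w']) (use x in auto)
  then show "((\<lambda>x. v (x, w x)) has_real_derivative vx (x, w x) + \<alpha> (x, w x) * vt (x, w x)) (at x within {0..1})"
    by (rule has_derivative_imp_has_field_derivative) (simp add: algebra_simps)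
qed

lemma C1t_prim_x:
  assumes "C1t F F'"
  shows "C1t (\<lambda>(x, \<sigma>). prim (\<lambda>\<xi>. F (\<xi>, \<sigma>)) x) (\<lambda>(x, \<sigma>). prim (\<lambda>\<xi>. F' (\<xi>, \<sigma>)) x)"
proof (rule C1tI)
  have c: "continuous_on strip (\<lambda>(s, p). F (s, p))" "continuous_on strip (\<lambda>(s, p). F' (s, p))"
    using C1tD(1,2)[OF assms] by simp_all
  note seg = mult_le_one[of "\<tau>::real" s for \<tau> s]
  show "continuous_on strip (\<lambda>(x, \<sigma>). prim (\<lambda>\<xi>. F (\<xi>, \<sigma>)) x)"
    "continuous_on strip (\<lambda>(x, \<sigma>). prim (\<lambda>\<xi>. F' (\<xi>, \<sigma>)) x)"
    by (rule continuous_on_prim[OF c(1)], use seg in force) (rule continuous_on_prim[OF c(2)], use seg in force)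
  fix x t :: real assume x: "x \<in> {0..1}"
  have "((\<lambda>s. prim (\<lambda>\<xi>. F (\<xi>, s)) x) has_real_derivative prim (\<lambda>\<xi>. F' (\<xi>, t)) x) (at t within UNIV)"
  proof (rule prim_deriv_param[where S="{0..1}"])
    show "((\<lambda>p. F (r, p)) has_real_derivative F' (r, p)) (at p within UNIV)" if "r \<in> {0..1}" for r p
      using C1tD(3)[OF assms that] by simp
  qed (use seg c x in auto)
  then show "((\<lambda>s. case (x, s) of (x, \<sigma>) \<Rightarrow> prim (\<lambda>\<xi>. F (\<xi>, \<sigma>)) x) has_real_derivative
      (case (x, t) of (x, \<sigma>) \<Rightarrow> prim (\<lambda>\<xi>. F' (\<xi>, \<sigma>)) x)) (at t)" by simp
qed

lemma continuous_strip_swap: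
  "continuous_on strip F \<Longrightarrow> continuous_on (UNIV \<times> {0..1}) (\<lambda>(s, x). F (x, s))"
  unfolding case_prod_unfold
  by (rule continuous_on_strip_compose) (auto intro!: continuous_on_fst continuous_on_snd continuous_on_id)

lemma C1t_prim_t:
  assumes "continuous_on strip F"
  shows "C1t (\<lambda>(x, \<sigma>). prim (\<lambda>s. F (x, s)) \<sigma>) F"
proof (rule C1tI)
  have "continuous_on (UNIV \<times> {0..1}) (\<lambda>(s, x). prim (\<lambda>r. F (x, r)) s)"
    by (rule continuous_on_prim[OF continuous_strip_swap[OF assms]]) simp
  moreover have "continuous_on strip (\<lambda>q. (snd q, fst q))"
    by (intro continuous_on_Pair continuous_on_fst continuous_on_snd continuous_on_id)
  ultimately have "continuous_on strip (\<lambda>q. (\<lambda>(s, x). prim (\<lambda>r. F (x, r)) s) (snd q, fst q))"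
    by (rule continuous_on_compose2) auto
  then show "continuous_on strip (\<lambda>(x, \<sigma>). prim (\<lambda>s. F (x, s)) \<sigma>)"
    by (simp add: case_prod_unfold)
  fix x t :: real assume "x \<in> {0..1}"
  then have "continuous_on UNIV (\<lambda>s. F (x, s))"
    by (intro continuous_on_strip_compose[OF assms]) (auto intro: continuous_intros)
  from prim_deriv_UNIV[OF this]
  show "((\<lambda>s. case (x, s) of (x, \<sigma>) \<Rightarrow> prim (\<lambda>s. F (x, s)) \<sigma>) has_real_derivative F (x, t)) (at t)" by simp
qed (rule assms)

lemma prim_t_deriv_x:
  assumes "continuous_on strip F" "continuous_on strip F'" "x \<in> {0..1}"
    and "\<And>x s. x \<in> {0..1} \<Longrightarrow> ((\<lambda>x. F (x, s)) has_real_derivative F' (x, s)) (at x within {0..1})"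
  shows "((\<lambda>x. prim (\<lambda>s. F (x, s)) \<sigma>) has_real_derivative prim (\<lambda>s. F' (x, s)) \<sigma>) (at x within {0..1})"
  by (rule prim_deriv_param[where S=UNIV])
    (use assms continuous_strip_swap[OF assms(1)] continuous_strip_swap[OF assms(2)] in auto)

context speed
begin

lemma char_through:
  assumes "x \<in> {0..1}"
  obtains w where "is_char \<alpha> w" "w x = t"
  using flow_char[of "foot (x, t)"] flow_foot[OF assms] that by blast

lemma transportI_flow:
  assumes c: "continuous_on strip v" "continuous_on strip g"
    and d: "\<And>\<sigma> x. x \<in> {0..1} \<Longrightarrow>
      ((\<lambda>x. v (x, flow (x, \<sigma>))) has_real_derivative g (x, flow (x, \<sigma>))) (at x within {0..1})"
  shows "transport \<alpha> v g"
proof (rule transportI[OF c])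
  fix w x assume w: "is_char \<alpha> w" and x: "x \<in> {0..(1::real)}"
  from has_field_derivative_transform_within[OF d[OF x, of "w 0"] zero_less_one x]
  show "((\<lambda>x. v (x, w x)) has_real_derivative g (x, w x)) (at x within {0..1})"
    using char_eq_flow[OF w, symmetric] x by simp
qed

lemma C1t_along_flow:
  assumes "C1t F F'"
  shows "C1t (\<lambda>q. F (fst q, flow q)) (\<lambda>q. F' (fst q, flow q) * flow_deriv q)"
proof (rule C1tI)
  show "continuous_on strip (\<lambda>q. F (fst q, flow q))"
    "continuous_on strip (\<lambda>q. F' (fst q, flow q) * flow_deriv q)"
    by (rule continuous_along_flow[OF C1tD(1)[OF assms]])
      (rule continuous_on_mult[OF continuous_along_flow[OF C1tD(2)[OF assms]] continuous_flow_deriv])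
  show "((\<lambda>s. F (fst (x, s), flow (x, s))) has_real_derivative
      F' (fst (x, t), flow (x, t)) * flow_deriv (x, t)) (at t)" if "x \<in> {0..1}" for x t
    using DERIV_chain2[OF C1tD(3)[OF assms that] flow_has_derivative[OF that]] by simp
qed

lemma continuous_at_foot: "continuous_on strip N \<Longrightarrow> continuous_on strip (\<lambda>q. N (fst q, foot q))"
  by (rule continuous_on_strip_compose) (auto intro: continuous_intros continuous_foot)

lemma C1t_at_foot:
  assumes "C1t N N'"
  shows "C1t (\<lambda>q. N (fst q, foot q)) (\<lambda>q. N' (fst q, foot q) / flow_deriv (fst q, foot q))"
proof (rule C1tI)
  show "continuous_on strip (\<lambda>q. N (fst q, foot q))"
    "continuous_on strip (\<lambda>q. N' (fst q, foot q) / flow_deriv (fst q, foot q))"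
    by (intro continuous_at_foot C1tD[OF assms])
      (rule continuous_on_divide[OF continuous_at_foot[OF C1tD(2)[OF assms]]
          continuous_at_foot[OF continuous_flow_deriv]], simp)
  show "((\<lambda>s. N (fst (x, s), foot (x, s))) has_real_derivative
      N' (fst (x, t), foot (x, t)) / flow_deriv (fst (x, t), foot (x, t))) (at t)" if "x \<in> {0..1}" for x t
    using DERIV_chain2[OF C1tD(3)[OF assms that] C1tD(3)[OF C1t_foot that]] by simp
qed

text \<open>Derivatives along characteristics and in \<open>t\<close> together give joint differentiability: in
  coordinates sheared along the characteristic through the point, both partial derivatives are at
  hand and the second one is continuous.\<close>

lemma transport_C1t_joint:
  assumes T: "transport \<alpha> v g" and C: "C1t v v'" and q: "q \<in> strip"
  shows "(v has_derivative (\<lambda>d. (g q - \<alpha> q * v' q) * fst d + v' q * snd d)) (at q within strip)"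
proof -
  obtain x t where qq: "q = (x, t)" and x: "x \<in> {0..1}" using q by auto
  obtain w where w: "is_char \<alpha> w" "w x = t" by (rule char_through[OF x])
  let ?fy = "\<lambda>y s. blinfun_mult_right (v' (y, w y + s))"
  have V: "((\<lambda>(y, s). v (y, w y + s)) has_derivative (\<lambda>(tx, ty). g q * tx + blinfun_apply (?fy x 0) ty))
      (at (x, 0) within strip)"
  proof (rule has_derivative_partialsI[where fy="?fy"])
    show "((\<lambda>y. v (y, w y + 0)) has_derivative (*) (g q)) (at x within {0..1})"
      using transportD(3)[OF T w(1) x] w(2) by (simp add: has_field_derivative_def qq)
    show "((\<lambda>s. v (y, w y + s)) has_derivative blinfun_apply (?fy y s)) (at s within UNIV)"
      if "y \<in> {0..1}" for y s
      using C1tD(3)[OF C that, of "w y + s"] DERIV_shift[of "\<lambda>s. v (y, s)" "v' (y, w y + s)" s "w y"]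
      by (simp add: has_field_derivative_def add.commute)
    have "continuous_on strip (\<lambda>y. v' (fst y, w (fst y) + snd y))"
      by (intro continuous_on_strip_compose[OF C1tD(2)[OF C]] continuous_intros
          continuous_on_compose2[OF is_char_continuous[OF w(1)]]) auto
    then have "continuous_on strip (\<lambda>(y, s). ?fy y s)"
      by (simp add: case_prod_unfold bounded_linear.continuous_on[OF bounded_linear_blinfun_mult_right])
    then show "continuous (at (x, 0) within strip) (\<lambda>(y, s). ?fy y s)"
      using x by (simp add: continuous_on_eq_continuous_within)
  qed auto
  have wd: "((\<lambda>p. w (fst p)) has_derivative (\<lambda>d. \<alpha> q * fst d)) (at q within strip)"
    by (rule has_derivative_in_compose2[where g=w and t="{0..1}" and g'="\<lambda>y. (*) (\<alpha> (y, w y))" and f=fst and f'=fst and x=q,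
          unfolded qq fst_conv w(2), folded qq])
      (use is_charD[OF w(1)] x qq in \<open>auto simp: has_field_derivative_def intro!: derivative_intros\<close>)
  have S: "((\<lambda>p. (fst p, snd p - w (fst p))) has_derivative (\<lambda>d. (fst d, snd d - \<alpha> q * fst d))) (at q within strip)"
    by (intro has_derivative_Pair has_derivative_diff wd has_derivative_fst has_derivative_snd has_derivative_ident)
  have "((\<lambda>p. (\<lambda>(y, s). v (y, w y + s)) (fst p, snd p - w (fst p))) has_derivative
      (\<lambda>d. (\<lambda>(tx, ty). g q * tx + blinfun_apply (?fy x 0) ty) (fst d, snd d - \<alpha> q * fst d))) (at q within strip)"
  proof (rule has_derivative_in_compose[OF S])
    show "((\<lambda>(y, s). v (y, w y + s)) has_derivative (\<lambda>(tx, ty). g q * tx + blinfun_apply (?fy x 0) ty))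
      (at (fst q, snd q - w (fst q)) within (\<lambda>p. (fst p, snd p - w (fst p))) ` strip)"
      by (rule has_derivative_subset[where s=strip]) (use V w(2) qq in auto)
  qed
  moreover have "(\<lambda>p. (\<lambda>(y, s). v (y, w y + s)) (fst p, snd p - w (fst p))) = v" by auto
  moreover have "(\<lambda>d. (\<lambda>(tx, ty). g q * tx + blinfun_apply (?fy x 0) ty) (fst d, snd d - \<alpha> q * fst d))
      = (\<lambda>d. (g q - \<alpha> q * v' q) * fst d + v' q * snd d)"
    using w(2) by (auto simp: qq algebra_simps)
  ultimately show ?thesis by simp
qed

text \<open>The two directional derivatives differ by \<open>(\<alpha>2 - \<alpha>) \<partial>\<^sub>t\<close>.\<close>

lemma transport_change_speed:
  assumes "transport \<alpha> v g" "C1t v v'" "continuous_on strip \<alpha>2"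
  shows "transport \<alpha>2 v (\<lambda>q. g q + (\<alpha>2 q - \<alpha> q) * v' q)"
proof -
  have "transport \<alpha>2 v (\<lambda>q. (g q - \<alpha> q * v' q) + \<alpha>2 q * v' q)"
    by (rule transport_if_joint[OF transport_C1t_joint[OF assms(1,2)]])
      (auto intro!: continuous_on_diff continuous_on_mult transportD[OF assms(1)] C1tD[OF assms(2)]
        C1tD(1)[OF C1] assms(3))
  then show ?thesis by (rule transport_cong) (simp_all add: algebra_simps)
qed

text \<open>The primitive in \<open>t\<close> of a solution \<open>q\<close> of a transport equation, started on a characteristic,
  solves a transport equation whose right-hand side is itself differentiable in \<open>t\<close>, although \<open>q\<close> and its
  right-hand side \<open>g\<close> are merely continuous. In the label coordinates of the flow, both are primitives over the
  same interval, and the equation is differentiation under the integral sign.\<close>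

lemma transport_primitive:
  assumes T: "transport \<alpha> q g"
  obtains \<Phi> R where "C1t \<Phi> q" "C1t R (\<lambda>p. g p + \<alpha>' p * q p)" "transport \<alpha> \<Phi> R"
proof -
  define N where "N p = q (fst p, flow p) * flow_deriv p" for p
  define M where "M p = (g (fst p, flow p) + \<alpha>' (fst p, flow p) * q (fst p, flow p)) * flow_deriv p" for p
  have cN: "continuous_on strip N" and cM: "continuous_on strip M" unfolding N_def[abs_def] M_def[abs_def]
    by (intro continuous_on_mult continuous_on_add continuous_flow_deriv
        continuous_along_flow[OF transportD(1)[OF T]] continuous_along_flow[OF transportD(2)[OF T]]
        continuous_along_flow[OF C1tD(2)[OF C1]])+
  have NM: "((\<lambda>x. N (x, s)) has_real_derivative M (x, s)) (at x within {0..1})" if "x \<in> {0..1}" for x s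
    using DERIV_mult[OF transportD(3)[OF T flow_char that] flow_deriv_char[OF that], of s s]
    by (simp add: N_def M_def algebra_simps)
  define prN where "prN = (\<lambda>(x, \<sigma>). prim (\<lambda>s. N (x, s)) \<sigma>)"
  define prM where "prM = (\<lambda>(x, \<sigma>). prim (\<lambda>s. M (x, s)) \<sigma>)"
  have CN: "C1t prN N" and CM: "C1t prM M"
    unfolding prN_def prM_def by (rule C1t_prim_t, fact)+
  show ?thesis
  proof (rule that)
    show C\<Phi>: "C1t (\<lambda>p. prN (fst p, foot p)) q"
      by (rule C1t_cong[OF C1t_at_foot[OF CN]]) (auto simp: N_def)
    show CR: "C1t (\<lambda>p. prM (fst p, foot p)) (\<lambda>p. g p + \<alpha>' p * q p)"
      by (rule C1t_cong[OF C1t_at_foot[OF CM]]) (auto simp: M_def)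
    show "transport \<alpha> (\<lambda>p. prN (fst p, foot p)) (\<lambda>p. prM (fst p, foot p))"
    proof (rule transportI_flow[OF C1tD(1)[OF C\<Phi>] C1tD(1)[OF CR]])
      fix \<sigma> x :: real assume x: "x \<in> {0..1}"
      have "((\<lambda>x. prN (x, \<sigma>)) has_real_derivative prM (x, \<sigma>)) (at x within {0..1})"
        unfolding prN_def prM_def prod.case by (rule prim_t_deriv_x[OF cN cM x NM])
      from has_field_derivative_transform_within[OF this zero_less_one x]
      show "((\<lambda>x. prN (fst (x, flow (x, \<sigma>)), foot (x, flow (x, \<sigma>)))) has_real_derivative
          prM (fst (x, flow (x, \<sigma>)), foot (x, flow (x, \<sigma>)))) (at x within {0..1})"
        using x by simp
    qed
  qed
qed

text \<open>Solutions of transport equations with right-hand side in \<open>C1t\<close> inherit this regularity from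
  their values on one vertical line.\<close>

lemma transport_C1t:
  assumes T: "transport \<alpha> v F" and F: "C1t F F'" and c: "c \<in> {0..1}"
    and b: "\<And>t. ((\<lambda>s. v (c, s)) has_real_derivative b' t) (at t)" "continuous_on UNIV b'"
  obtains v' where "C1t v v'" "transport \<alpha> v' (\<lambda>q. F' q - \<alpha>' q * v' q)"
proof -
  define I where "I = (\<lambda>(x, \<sigma>). prim (\<lambda>\<xi>. F (\<xi>, flow (\<xi>, \<sigma>))) x)"
  define I' where "I' = (\<lambda>(x, \<sigma>). prim (\<lambda>\<xi>. F' (\<xi>, flow (\<xi>, \<sigma>)) * flow_deriv (\<xi>, \<sigma>)) x)"
  have CI: "C1t I I'"
    using C1t_prim_x[OF C1t_along_flow[OF F]] by (simp add: I_def I'_def)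
  have dI: "((\<lambda>x. I (x, \<sigma>)) has_real_derivative F (x, flow (x, \<sigma>))) (at x within {0..1})" if "x \<in> {0..1}" for x \<sigma>
    unfolding I_def prod.case
    by (rule prim_deriv_Icc) (use continuous_on_char[OF C1tD(1)[OF F] flow_char] that in auto)
  have dI': "((\<lambda>x. I' (x, \<sigma>)) has_real_derivative F' (x, flow (x, \<sigma>)) * flow_deriv (x, \<sigma>)) (at x within {0..1})"
    if "x \<in> {0..1}" for x \<sigma>
    unfolding I'_def prod.case
  proof (rule prim_deriv_Icc)
    show "continuous_on {0..1} (\<lambda>\<xi>. F' (\<xi>, flow (\<xi>, \<sigma>)) * flow_deriv (\<xi>, \<sigma>))"
      using continuous_on_char[OF C1tD(2)[OF F] flow_char] 
        continuous_on_strip_compose[OF continuous_flow_deriv, of "{0..1}" "\<lambda>x. x" "\<lambda>x. \<sigma>"]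
      by (intro continuous_on_mult) (auto intro: continuous_intros)
  qed (use that in auto)
  define N where "N p = v (c, flow (c, snd p)) + I p - I (c, snd p)" for p
  define N' where "N' p = b' (flow (c, snd p)) * flow_deriv (c, snd p) + I' p - I' (c, snd p)" for p
  have vN: "v (x, flow (x, \<sigma>)) = N (x, \<sigma>)" if "x \<in> {0..1}" for x \<sigma>
  proof -
    have "((\<lambda>x. v (x, flow (x, \<sigma>)) - I (x, \<sigma>)) has_real_derivative 0) (at y within {0..1})" if "y \<in> {0..1}" for y
      using DERIV_diff[OF transportD(3)[OF T flow_char that] dI[OF that], of \<sigma> \<sigma>] by simp
    note const = constant_from_0[of "\<lambda>x. v (x, flow (x, \<sigma>)) - I (x, \<sigma>)", OF this]
    show ?thesis using const[OF _ that] const[OF _ c] by (simp add: N_def)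
  qed
  have CN: "C1t N N'"
  proof (rule C1tI)
    have lineI: "continuous_on strip (\<lambda>p. G (c, snd p))" if "continuous_on strip G" for G :: "real \<times> real \<Rightarrow> real"
      by (rule continuous_on_strip_compose[OF that]) (use c in \<open>auto intro: continuous_intros\<close>)
    have "continuous_on strip (\<lambda>p. v (c, flow (c, snd p)))"
      by (rule continuous_on_strip_compose[OF transportD(1)[OF T]])
        (use c in \<open>auto intro: continuous_intros lineI[OF continuous_flow]\<close>)
    then show "continuous_on strip N" unfolding N_def[abs_def]
      by (rule continuous_on_diff[OF continuous_on_add[OF _ C1tD(1)[OF CI]] lineI[OF C1tD(1)[OF CI]]])
    have "continuous_on strip (\<lambda>p. b' (flow (c, snd p)))"
      by (rule continuous_on_compose2[OF b(2) lineI[OF continuous_flow]]) simp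
    then show "continuous_on strip N'" unfolding N'_def[abs_def]
      by (rule continuous_on_diff[OF continuous_on_add[OF continuous_on_mult[OF _
                lineI[OF continuous_flow_deriv]] C1tD(2)[OF CI]] lineI[OF C1tD(2)[OF CI]]])
    fix x t :: real assume x: "x \<in> {0..1}"
    show "((\<lambda>s. N (x, s)) has_real_derivative N' (x, t)) (at t)"
      unfolding N_def N'_def snd_conv
      by (intro DERIV_add DERIV_diff DERIV_chain2[OF b(1) flow_has_derivative[OF c]] C1tD(3)[OF CI] c x)
  qed
  define v' where "v' p = N' (fst p, foot p) / flow_deriv (fst p, foot p)" for p
  have Cv: "C1t v v'"
  proof (rule C1t_cong[OF C1t_at_foot[OF CN]])
    fix q :: "real \<times> real" assume "q \<in> strip"
    then show "N (fst q, foot q) = v q" using vN[of "fst q" "foot q"] by (cases q) auto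
  qed (simp add: v'_def)
  have "transport \<alpha> v' (\<lambda>q. F' q - \<alpha>' q * v' q)"
  proof (rule transportI_flow)
    show "continuous_on strip v'" by (rule C1tD(2)[OF Cv])
    then show "continuous_on strip (\<lambda>q. F' q - \<alpha>' q * v' q)"
      by (intro continuous_on_diff continuous_on_mult C1tD(2)[OF F] C1tD(2)[OF C1])
    fix \<sigma> x :: real assume x: "x \<in> {0..1}"
    have "((\<lambda>x. N' (x, \<sigma>)) has_real_derivative F' (x, flow (x, \<sigma>)) * flow_deriv (x, \<sigma>)) (at x within {0..1})"
      unfolding N'_def snd_conv
      by (rule derivative_eq_intros dI'[OF x] refl)+ simp
    from DERIV_divide[OF this flow_deriv_char[OF x, of \<sigma>] flow_deriv_pos(2)]
    moreover have "(A * fd * fd - N * (B * fd)) / (fd * fd) = A - B * (N / fd)"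
      if "fd \<noteq> 0" for A B N fd :: real
      using that by (simp add: field_simps)
    ultimately have "((\<lambda>x. N' (x, \<sigma>) / flow_deriv (x, \<sigma>)) has_real_derivative
        F' (x, flow (x, \<sigma>)) - \<alpha>' (x, flow (x, \<sigma>)) * (N' (x, \<sigma>) / flow_deriv (x, \<sigma>))) (at x within {0..1})"
      by simp
    from has_field_derivative_transform_within[OF this zero_less_one x]
    show "((\<lambda>x. v' (x, flow (x, \<sigma>))) has_real_derivative
        F' (x, flow (x, \<sigma>)) - \<alpha>' (x, flow (x, \<sigma>)) * v' (x, flow (x, \<sigma>))) (at x within {0..1})"
      using x by (simp add: v'_def)
  qed
  with Cv show ?thesis by (rule that)
qed

lemma transport_solvable:
  assumes F: "continuous_on strip F" and c: "c \<in> {0..1}"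
  obtains A where "transport \<alpha> A F" "\<And>t. A (c, t) = 0"
proof -
  define I where "I = (\<lambda>(x, \<sigma>). prim (\<lambda>\<xi>. F (\<xi>, flow (\<xi>, \<sigma>))) x)"
  have cI: "continuous_on strip I"
    unfolding I_def using continuous_on_prim[of "{0..1}" UNIV "\<lambda>\<xi> \<sigma>. F (\<xi>, flow (\<xi>, \<sigma>))"]
      continuous_along_flow[OF F] by (auto simp: case_prod_unfold mult_le_one)
  have dI: "((\<lambda>x. I (x, \<sigma>)) has_real_derivative F (x, flow (x, \<sigma>))) (at x within {0..1})" if "x \<in> {0..1}" for x \<sigma>
    unfolding I_def prod.case
    by (rule prim_deriv_Icc) (use continuous_on_char[OF F flow_char] that in auto)
  have "transport \<alpha> (\<lambda>p. I (fst p, foot p) - I (c, foot p)) F"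
  proof (rule transportI_flow[OF _ F])
    show "continuous_on strip (\<lambda>p. I (fst p, foot p) - I (c, foot p))"
      by (rule continuous_on_diff[OF continuous_at_foot[OF cI] continuous_on_strip_compose[OF cI
              continuous_on_const continuous_foot]]) (use c in auto)
    fix \<sigma> x :: real assume x: "x \<in> {0..1}"
    have "((\<lambda>x. I (x, \<sigma>) - I (c, \<sigma>)) has_real_derivative F (x, flow (x, \<sigma>))) (at x within {0..1})"
      using DERIV_diff[OF dI[OF x] DERIV_const] by simp
    from has_field_derivative_transform_within[OF this zero_less_one x]
    show "((\<lambda>x. I (fst (x, flow (x, \<sigma>)), foot (x, flow (x, \<sigma>))) - I (c, foot (x, flow (x, \<sigma>))))
        has_real_derivative F (x, flow (x, \<sigma>))) (at x within {0..1})" using x by simp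
  qed
  then show ?thesis by (rule that) simp
qed

end

section \<open>Regularity of solutions of a functional equation\<close>

lemma periodic_reduce:
  fixes f :: "real \<Rightarrow> 'b"
  assumes "\<And>t. f (t + 2 * pi) = f t"
  shows "f (t - 2 * pi * of_int \<lfloor>t / (2 * pi)\<rfloor>) = f t"
proof -
  have nat: "f (s + 2 * pi * of_nat n) = f s" for s n
  proof (induction n)
    case (Suc n)
    have "s + 2 * pi * of_nat (Suc n) = (s + 2 * pi * of_nat n) + 2 * pi" by (simp add: algebra_simps)
    then show ?case by (simp only: assms Suc)
  qed simp
  have "f (s + 2 * pi * of_int k) = f s" for s k
  proof (cases "k \<ge> 0")
    case True
    then show ?thesis using nat[of s "nat k"] by simp
  next
    case False
    then show ?thesis using nat[of "s + 2 * pi * of_int k" "nat (- k)"] by simp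
  qed
  from this[of t "- \<lfloor>t / (2 * pi)\<rfloor>"] show ?thesis by simp
qed

lemma reduced_mem: "t - 2 * pi * of_int \<lfloor>t / (2 * pi)\<rfloor> \<in> {0..2 * pi}"
proof -
  let ?k = "real_of_int \<lfloor>t / (2 * pi)\<rfloor>"
  have "2 * pi * ?k \<le> 2 * pi * (t / (2 * pi))" "2 * pi * (t / (2 * pi)) \<le> 2 * pi * (?k + 1)"
    by (rule mult_left_mono, linarith, simp)+
  then show ?thesis by (simp add: distrib_left)
qed

text \<open>Functions that are periodic in \<open>t\<close> behave on a slab as on its compact part with \<open>0 \<le> t \<le> 2\<pi>\<close>.\<close>

definition slab :: "real \<Rightarrow> (real \<times> (real ^ 'n)) set" where
  "slab R = {p. \<forall>k. \<bar>snd p $ k\<bar> \<le> R}"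

lemma slab_compact_part:
  "compact ({0..2 * pi} \<times> {y :: real ^ 'n. \<forall>k. \<bar>y $ k\<bar> \<le> R})"
proof -
  have "{y :: real ^ 'n. \<forall>k. \<bar>y $ k\<bar> \<le> R} = cbox (\<chi> k. - R) (\<chi> k. R)"
    by (auto simp: mem_box_cart abs_le_iff minus_le_iff)
  then show ?thesis by (simp add: compact_Times compact_cbox)
qed

lemma slab_attains_sup:
  fixes F :: "real \<times> (real ^ 'n) \<Rightarrow> real"
  assumes "continuous_on UNIV F" and per: "\<And>t y. F (t + 2 * pi, y) = F (t, y)" and "R \<ge> 0"
  obtains p where "p \<in> slab R" "\<And>p'. p' \<in> slab R \<Longrightarrow> F p' \<le> F p"
proof -
  let ?Q = "{0..2 * pi} \<times> {y :: real ^ 'n. \<forall>k. \<bar>y $ k\<bar> \<le> R}"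
  have "(0, 0) \<in> ?Q" using \<open>R \<ge> 0\<close> by simp
  then obtain p where p: "p \<in> ?Q" "\<And>p'. p' \<in> ?Q \<Longrightarrow> F p' \<le> F p"
    using continuous_attains_sup[OF slab_compact_part, of R F] continuous_on_subset[OF assms(1)] by blast
  have "F p' \<le> F p" if "p' \<in> slab R" for p'
  proof -
    obtain t y where p': "p' = (t, y)" by (cases p')
    have "F p' = F (t - 2 * pi * of_int \<lfloor>t / (2 * pi)\<rfloor>, y)"
      using periodic_reduce[of "\<lambda>t. F (t, y)" t] per by (simp add: p')
    also have "\<dots> \<le> F p"
      by (rule p(2)) (use that reduced_mem[of t] in \<open>simp add: slab_def p'\<close>)
    finally show ?thesis .
  qed
  with p(1) show ?thesis by (intro that[of p]) (auto simp: slab_def)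
qed

lemma slab_bounded:
  fixes F :: "real \<times> (real ^ 'n) \<Rightarrow> real"
  assumes "continuous_on UNIV F" "\<And>t y. F (t + 2 * pi, y) = F (t, y)" "R \<ge> 0"
  shows "\<exists>C. \<forall>p\<in>slab R. \<bar>F p\<bar> \<le> C"
proof -
  have c: "continuous_on UNIV (\<lambda>p. \<bar>F p\<bar>)" by (intro continuous_on_rabs assms)
  obtain p :: "real \<times> (real ^ 'n)" where "\<And>p'. p' \<in> slab R \<Longrightarrow> \<bar>F p'\<bar> \<le> \<bar>F p\<bar>"
    by (rule slab_attains_sup[OF c _ assms(3)]) (use assms(2) in auto)
  then show ?thesis by blast
qed

lemma slab_uniformly_continuous:
  fixes F :: "real \<times> (real ^ 'n) \<Rightarrow> real"
  assumes "continuous_on UNIV F" and per: "\<And>t y. F (t + 2 * pi, y) = F (t, y)" and "e > 0"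
  shows "\<exists>d>0. \<forall>t y y'. (t, y) \<in> slab R \<longrightarrow> (t, y') \<in> slab R \<longrightarrow> (\<forall>k. \<bar>y $ k - y' $ k\<bar> < d) \<longrightarrow>
    \<bar>F (t, y) - F (t, y')\<bar> < e"
proof -
  let ?Q = "{0..2 * pi} \<times> {y :: real ^ 'n. \<forall>k. \<bar>y $ k\<bar> \<le> R}"
  have "uniformly_continuous_on ?Q F"
    by (rule compact_uniformly_continuous[OF continuous_on_subset[OF assms(1)] slab_compact_part]) simp
  then have "\<exists>d>0. \<forall>p\<in>?Q. \<forall>p'\<in>?Q. dist p' p < d \<longrightarrow> dist (F p') (F p) < e"
    unfolding uniformly_continuous_on_def using \<open>e > 0\<close> by (elim allE impE)
  then obtain d where d: "d > 0" "\<And>p p'. p \<in> ?Q \<Longrightarrow> p' \<in> ?Q \<Longrightarrow> dist p' p < d \<Longrightarrow> dist (F p') (F p) < e"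
    by blast
  define d' where "d' = d / real CARD('n)"
  have "d' > 0" using d(1) by (simp add: d'_def)
  moreover have "\<bar>F (t, y) - F (t, y')\<bar> < e"
    if "(t, y) \<in> slab R" "(t, y') \<in> slab R" "\<forall>k. \<bar>y $ k - y' $ k\<bar> < d'" for t y y'
  proof -
    let ?s = "t - 2 * pi * of_int \<lfloor>t / (2 * pi)\<rfloor>"
    have red: "F (?s, x) = F (t, x)" for x by (rule periodic_reduce[of "\<lambda>t. F (t, x)"]) (rule per)
    have "norm (y - y') \<le> (\<Sum>k\<in>UNIV. \<bar>(y - y') $ k\<bar>)" by (rule norm_le_l1_cart)
    also have "\<dots> < (\<Sum>k\<in>(UNIV::'n set). d')"
      by (rule sum_strict_mono) (use that(3) in auto)
    also have "\<dots> = d" by (simp add: d'_def)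
    finally have "dist (?s, y') (?s, y) < d" by (simp add: dist_Pair_Pair dist_norm norm_minus_commute)
    then have "dist (F (?s, y')) (F (?s, y)) < e"
      by (intro d(2)) (use that reduced_mem[of t] in \<open>auto simp: slab_def\<close>)
    then show ?thesis by (simp add: red dist_real_def abs_minus_commute)
  qed
  ultimately show ?thesis by blast
qed

lemma periodic_derivatives:
  fixes K :: "real \<times> (real ^ 'n) \<Rightarrow> real"
  assumes K: "\<And>p. (K has_derivative (\<lambda>d. Kt p * fst d + (\<Sum>k\<in>UNIV. Kz k p * snd d $ k))) (at p)"
    and per: "\<And>t y. K (t + 2 * pi, y) = K (t, y)"
  shows "Kt (t + 2 * pi, y) = Kt (t, y)" "Kz k (t + 2 * pi, y) = Kz k (t, y)"
proof -
  let ?D = "\<lambda>p d. Kt p * fst d + (\<Sum>k\<in>UNIV. Kz k p * snd d $ k)"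
  have "((\<lambda>p. K (p + (2 * pi, 0))) has_derivative ?D ((t, y) + (2 * pi, 0))) (at (t, y))"
    by (rule has_derivative_compose[OF _ K, of "\<lambda>p. p + (2 * pi, 0)" "\<lambda>d. d"])
      (auto intro!: derivative_eq_intros)
  moreover have "(\<lambda>p. K (p + (2 * pi, 0))) = K" using per by auto
  ultimately have eq: "?D (t + 2 * pi, y) = ?D (t, y)"
    using has_derivative_unique[OF _ K] by fastforce
  from fun_cong[OF this, of "(1, 0)"] show "Kt (t + 2 * pi, y) = Kt (t, y)" by simp
  from fun_cong[OF eq, of "(0, axis k 1)"] show "Kz k (t + 2 * pi, y) = Kz k (t, y)"
    by (simp add: axis_def if_distrib cong: if_cong)
qed

text \<open>The iterates of the contraction \<open>z \<mapsto> K (\<sqdot>, z \<circ> \<theta>)\<close> started at \<open>0\<close> converge to \<open>z\<close>. Their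
  derivatives solve the formally differentiated equation, in which the unknown is multiplied by
  \<open>\<partial>K/\<partial>z\<close> and by \<open>\<theta>'\<close>; this is again a contraction, so that the derivatives converge uniformly.\<close>

lemma functional_equation_C1:
  fixes z :: "real \<Rightarrow> real ^ 'n" and K :: "'n \<Rightarrow> real \<times> (real ^ 'n) \<Rightarrow> real"
  assumes K: "\<And>j p. (K j has_derivative (\<lambda>d. Kt j p * fst d + (\<Sum>k\<in>UNIV. Kz j k p * snd d $ k))) (at p)"
    and cKt: "\<And>j. continuous_on UNIV (Kt j)" and cKz: "\<And>j k. continuous_on UNIV (Kz j k)"
    and perK: "\<And>j t y. K j (t + 2 * pi, y) = K j (t, y)"
    and \<theta>: "\<And>j t. (\<theta> j has_real_derivative \<theta>' j t) (at t)" and c\<theta>': "\<And>j. continuous_on UNIV (\<theta>' j)"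
    and per\<theta>: "\<And>j t. \<theta> j (t + 2 * pi) = \<theta> j t + 2 * pi"
    and contr0: "\<And>j t y. (\<Sum>k\<in>UNIV. \<bar>Kz j k (t, y)\<bar>) < 1"
    and contr1: "\<And>j t y. (\<Sum>k\<in>UNIV. \<bar>Kz j k (t, y)\<bar>) * \<bar>\<theta>' j t\<bar> < 1"
    and cz: "continuous_on UNIV z" and perz: "\<And>t. z (t + 2 * pi) = z t"
    and eq: "\<And>t j. z t $ j = K j (t, z (\<theta> j t))"
  obtains z' :: "real \<Rightarrow> real ^ 'n" where "continuous_on UNIV z'"
    "\<And>t k. ((\<lambda>t. z t $ k) has_real_derivative z' t $ k) (at t)"
proof -
  have per\<theta>': "\<theta>' j (t + 2 * pi) = \<theta>' j t" for j t
    using deriv_periodic[OF DERIV_diff[OF \<theta>[of j] DERIV_ident], of t] per\<theta> by simp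
  note perKt = periodic_derivatives(1)[OF K perK] and perKz = periodic_derivatives(2)[OF K perK]
  have c\<theta>'2: "continuous_on UNIV (\<lambda>p :: real \<times> (real ^ 'n). \<theta>' j (fst p))" for j
    by (rule continuous_on_compose2[OF c\<theta>' continuous_on_fst[OF continuous_on_id]]) simp
  have cz1: "continuous_on UNIV (\<lambda>t. z t $ k)" for k
    using continuous_on_component[OF cz] .

  \<comment> \<open>The iterates start at \<open>0\<close> and approach \<open>z\<close>, so they stay within distance \<open>R\<close> of \<open>z\<close>; on this
    bounded region the pointwise strict inequalities become uniform ones.\<close>
  obtain R where R: "\<And>t k. \<bar>z t $ k\<bar> \<le> R" "R \<ge> 0"
  proof -
    have "\<exists>C. \<forall>p\<in>slab 0. \<bar>z (fst (p :: real \<times> (real ^ 'n))) $ k\<bar> \<le> C" for k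
      by (rule slab_bounded) (auto simp: perz intro!: continuous_on_compose2[OF cz1] continuous_on_fst continuous_on_id)
    then obtain C where C: "\<And>k p. p \<in> slab 0 \<Longrightarrow> \<bar>z (fst (p :: real \<times> (real ^ 'n))) $ k\<bar> \<le> C k" by metis
    have "\<bar>z t $ k\<bar> \<le> \<bar>C k\<bar>" for t k using C[of "(t, 0)" k] by (simp add: slab_def)
    also have "\<bar>C k\<bar> \<le> (\<Sum>k\<in>UNIV. \<bar>C k\<bar>)" for k by (rule member_le_sum) auto
    finally show ?thesis by (intro that[of "\<Sum>k\<in>UNIV. \<bar>C k\<bar>"]) (auto intro: sum_nonneg)
  qed
  define S :: "(real \<times> (real ^ 'n)) set" where "S = slab (2 * R)"
  have small: "\<exists>q. 0 \<le> q \<and> q < 1 \<and> (\<forall>j. \<forall>p\<in>S. F j p \<le> q)"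
    if "\<And>j. continuous_on UNIV (F j)" "\<And>j t y. F j (t + 2 * pi, y) = F j (t, y)" "\<And>j p. F j p < 1"
    for F :: "'n \<Rightarrow> real \<times> (real ^ 'n) \<Rightarrow> real"
  proof -
    have "\<exists>q<1. \<forall>p\<in>S. F j p \<le> q" for j
      using slab_attains_sup[of "F j" "2 * R"] that R(2) unfolding S_def by (metis mult_nonneg_nonneg zero_le_numeral)
    then obtain q where q: "\<And>j. q j < 1" "\<And>j p. p \<in> S \<Longrightarrow> F j p \<le> q j" by metis
    have "F j p \<le> Max (insert 0 (range q))" if "p \<in> S" for j p
      by (rule order_trans[OF q(2)[OF that, of j]]) (rule Max_ge, simp_all)
    moreover have "Max (insert 0 (range q)) < 1" by (subst Max_less_iff) (use q(1) in auto)
    ultimately show ?thesis by (intro exI[of _ "Max (insert 0 (range q))"]) auto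
  qed
  have cK: "continuous_on UNIV (\<lambda>p. \<Sum>k\<in>UNIV. \<bar>Kz j k p\<bar>)" for j
    by (intro continuous_on_sum continuous_on_rabs cKz)
  have "\<exists>q0\<ge>0. q0 < 1 \<and> (\<forall>j. \<forall>p\<in>S. (\<Sum>k\<in>UNIV. \<bar>Kz j k p\<bar>) \<le> q0)"
    by (rule small[of "\<lambda>j p. \<Sum>k\<in>UNIV. \<bar>Kz j k p\<bar>"]) (use cK contr0 perKz in auto)
  then obtain q0 where q0: "0 \<le> q0" "q0 < 1" "\<And>j p. p \<in> S \<Longrightarrow> (\<Sum>k\<in>UNIV. \<bar>Kz j k p\<bar>) \<le> q0"
    by blast
  have "\<exists>q\<ge>0. q < 1 \<and> (\<forall>j. \<forall>p\<in>S. (\<Sum>k\<in>UNIV. \<bar>Kz j k p\<bar>) * \<bar>\<theta>' j (fst p)\<bar> \<le> q)"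
  proof (rule small[of "\<lambda>j p. (\<Sum>k\<in>UNIV. \<bar>Kz j k p\<bar>) * \<bar>\<theta>' j (fst p)\<bar>"])
    show "continuous_on UNIV (\<lambda>p. (\<Sum>k\<in>UNIV. \<bar>Kz j k p\<bar>) * \<bar>\<theta>' j (fst p)\<bar>)" for j
      by (intro continuous_on_mult cK continuous_on_rabs c\<theta>'2)
  qed (use contr1 perKz per\<theta>' in auto)
  then obtain q where q: "0 \<le> q" "q < 1"
    "\<And>j p. p \<in> S \<Longrightarrow> (\<Sum>k\<in>UNIV. \<bar>Kz j k p\<bar>) * \<bar>\<theta>' j (fst p)\<bar> \<le> q"
    by blast
  obtain C where C: "\<And>j p. p \<in> S \<Longrightarrow> \<bar>Kt j p\<bar> \<le> C" "C \<ge> 0"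
  proof -
    have "\<exists>C. \<forall>p\<in>S. \<bar>Kt j p\<bar> \<le> C" for j
      unfolding S_def by (rule slab_bounded) (use cKt perKt R(2) in auto)
    then obtain C where C: "\<And>j p. p \<in> S \<Longrightarrow> \<bar>Kt j p\<bar> \<le> C j" by metis
    have "\<bar>Kt j p\<bar> \<le> \<bar>C j\<bar>" if "p \<in> S" for j p using C[OF that, of j] by simp
    moreover have "\<bar>C k\<bar> \<le> (\<Sum>k\<in>UNIV. \<bar>C k\<bar>)" for k by (rule member_le_sum) auto
    ultimately have "\<bar>Kt j p\<bar> \<le> (\<Sum>k\<in>UNIV. \<bar>C k\<bar>)" if "p \<in> S" for j p
      using that order_trans by blast
    then show ?thesis by (intro that[of "\<Sum>k\<in>UNIV. \<bar>C k\<bar>"]) (auto intro: sum_nonneg)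
  qed

  define Z where "Z = rec_nat (\<lambda>t. 0) (\<lambda>n Zn t. \<chi> j. K j (t, Zn (\<theta> j t)))"
  have Z0: "Z 0 t = 0" and ZS: "Z (Suc n) t $ j = K j (t, Z n (\<theta> j t))" for n t j by (simp_all add: Z_def)
  have K_contr: "\<bar>K j (t, x) - K j (t, y)\<bar> \<le> q0 * e"
    if "(t, x) \<in> S" "(t, y) \<in> S" "\<And>k. \<bar>x $ k - y $ k\<bar> \<le> e" for j t x y e
  proof -
    define p where "p s = y + s *\<^sub>R (x - y)" for s
    have pS: "(t, p s) \<in> S" if "s \<in> {0..1}" for s
    proof -
      have "\<bar>p s $ k\<bar> \<le> 2 * R" for k
      proof -
        have "p s $ k = (1 - s) * y $ k + s * x $ k" by (simp add: p_def algebra_simps)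
        moreover have "(1 - s) * y $ k + s * x $ k \<in> {- (2 * R)..2 * R}"
          using convexD[of "{- (2 * R)..2 * R}" "y $ k" "x $ k" "1 - s" s] that \<open>(t, x) \<in> S\<close> \<open>(t, y) \<in> S\<close>
          by (auto simp: S_def slab_def abs_le_iff minus_le_iff)
        ultimately show ?thesis by (auto simp: abs_le_iff)
      qed
      then show ?thesis by (simp add: S_def slab_def)
    qed
    have "((\<lambda>s. K j (t, p s)) has_real_derivative (\<Sum>k\<in>UNIV. Kz j k (t, p s) * (x $ k - y $ k))) (at s within {0..1})"
      for s
    proof -
      have "((\<lambda>s. (t, p s)) has_derivative (\<lambda>h. (0, h *\<^sub>R (x - y)))) (at s within {0..1})"
        unfolding p_def by (auto intro!: derivative_eq_intros)
      from has_derivative_compose[OF this K[of j]]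
      show ?thesis
        by (rule has_derivative_imp_has_field_derivative) (simp add: sum_distrib_left mult_ac)
    qed
    moreover have "norm (\<Sum>k\<in>UNIV. Kz j k (t, p s) * (x $ k - y $ k)) \<le> q0 * e" if "s \<in> {0..1}" for s
    proof -
      have e: "0 \<le> e" using \<open>\<And>k. \<bar>x $ k - y $ k\<bar> \<le> e\<close> abs_ge_zero order_trans by blast
      have "norm (\<Sum>k\<in>UNIV. Kz j k (t, p s) * (x $ k - y $ k)) \<le> (\<Sum>k\<in>UNIV. \<bar>Kz j k (t, p s)\<bar> * e)"
        by (rule sum_norm_le) (use \<open>\<And>k. \<bar>x $ k - y $ k\<bar> \<le> e\<close> in \<open>simp add: abs_mult mult_left_mono\<close>)
      also have "\<dots> \<le> q0 * e" unfolding sum_distrib_right[symmetric]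
        by (rule mult_right_mono[OF q0(3)[OF pS[OF that]] e])
      finally show ?thesis .
    qed
    ultimately have "norm (K j (t, p 1) - K j (t, p 0)) \<le> q0 * e * norm (1 - 0 :: real)"
      by (intro field_differentiable_bound[where S="{0..1}"]) auto
    then show ?thesis by (simp add: p_def)
  qed
  have zS: "(t, z s) \<in> S" for t s
  proof -
    have "\<bar>z s $ k\<bar> \<le> 2 * R" for k using R(1)[of s k] R(2) by linarith
    then show ?thesis by (simp add: S_def slab_def)
  qed
  have q0n: "q0 ^ n * R \<le> R" for n
    using q0(1,2) R(2) by (simp add: mult_left_le_one_le power_le_one)
  have in_S: "(t, y) \<in> S" if "\<And>k. \<bar>y $ k - z s $ k\<bar> \<le> q0 ^ n * R" for t y s n
    unfolding S_def slab_def
  proof (clarsimp)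
    fix k show "\<bar>y $ k\<bar> \<le> 2 * R" using that[of k] q0n[of n] R(1)[of s k] by linarith
  qed
  have Zz: "\<bar>Z n t $ k - z t $ k\<bar> \<le> q0 ^ n * R" for n t k
  proof (induction n arbitrary: t k)
    case 0
    then show ?case using R(1)[of t k] by (simp add: Z0)
  next
    case (Suc n)
    from K_contr[OF in_S[OF Suc.IH] zS Suc.IH, of k t "\<theta> k t"]
    show ?case by (simp add: ZS eq[of t k] mult.assoc)
  qed
  have ZS': "(t, Z n s) \<in> S" for t n s by (rule in_S[OF Zz])
  have Zlim: "(\<lambda>n. Z n t $ k) \<longlonglongrightarrow> z t $ k" for t k
  proof -
    have "(\<lambda>n. q0 ^ n * R) \<longlonglongrightarrow> 0 * R"
      by (intro tendsto_mult_right LIMSEQ_realpow_zero q0)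
    then have q0lim: "(\<lambda>n. q0 ^ n * R) \<longlonglongrightarrow> 0" by simp
    have "(\<lambda>n. Z n t $ k - z t $ k) \<longlonglongrightarrow> 0"
      by (rule Lim_null_comparison[OF _ q0lim]) (simp add: Zz)
    then show ?thesis by (simp add: LIM_zero_iff)
  qed

  define Y where "Y = rec_nat (\<lambda>t. 0) (\<lambda>n Yn t. \<chi> j. Kt j (t, Z n (\<theta> j t)) +
    (\<Sum>k\<in>UNIV. Kz j k (t, Z n (\<theta> j t)) * (Yn (\<theta> j t) $ k * \<theta>' j t)))"
  have Y0: "Y 0 t = 0" and YS: "Y (Suc n) t $ j = Kt j (t, Z n (\<theta> j t)) +
    (\<Sum>k\<in>UNIV. Kz j k (t, Z n (\<theta> j t)) * (Y n (\<theta> j t) $ k * \<theta>' j t))" for n t j by (simp_all add: Y_def)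
  have ZY: "((\<lambda>t. Z n t $ j) has_real_derivative Y n t $ j) (at t)" for n t j
  proof (induction n arbitrary: t j)
    case 0
    then show ?case by (simp add: Z0 Y0)
  next
    case (Suc n)
    have "((\<lambda>t. Z n (\<theta> j t) $ k) has_derivative (*) (Y n (\<theta> j t) $ k * \<theta>' j t)) (at t)" for k
      using DERIV_chain2[OF Suc.IH[of k "\<theta> j t"] \<theta>[of j t]] by (simp add: has_field_derivative_def)
    then have "((\<lambda>t. (t, Z n (\<theta> j t))) has_derivative (\<lambda>h. (h, \<chi> k. (Y n (\<theta> j t) $ k * \<theta>' j t) * h))) (at t)"
      by (intro has_derivative_Pair has_derivative_ident has_derivative_vec_components)
    from has_derivative_compose[OF this K[of j]]
    show ?case unfolding ZS
      by (rule has_derivative_imp_has_field_derivative) (simp add: YS distrib_left sum_distrib_left mult_ac)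
  qed
  have cY: "continuous_on UNIV (\<lambda>t. Y n t $ j)" for n j
  proof (induction n arbitrary: j)
    case 0
    then show ?case by (simp add: Y0)
  next
    case (Suc n)
    have c\<theta>: "continuous_on UNIV (\<theta> j)" by (rule DERIV_continuous_on[OF has_field_derivative_at_within[OF \<theta>]])
    have "continuous_on UNIV (\<lambda>t. \<chi> k. Z n t $ k)"
      by (intro continuous_on_vec_lambda DERIV_continuous_on) (rule has_field_derivative_at_within[OF ZY])
    then have cZ: "continuous_on UNIV (Z n)" by (simp only: vec_nth_inverse)
    have "continuous_on UNIV (\<lambda>t. Z n (\<theta> j t))" by (rule continuous_on_compose2[OF cZ c\<theta>]) simp
    then have pair: "continuous_on UNIV (\<lambda>t. (t, Z n (\<theta> j t)))" by (intro continuous_on_Pair continuous_on_id)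
    have 1: "continuous_on UNIV (\<lambda>t. Kt j (t, Z n (\<theta> j t)))"
      by (rule continuous_on_compose2[OF cKt pair]) simp
    have 2: "continuous_on UNIV (\<lambda>t. Kz j k (t, Z n (\<theta> j t)))" for k
      by (rule continuous_on_compose2[OF cKz pair]) simp
    have 3: "continuous_on UNIV (\<lambda>t. Y n (\<theta> j t) $ k)" for k
      by (rule continuous_on_compose2[OF Suc.IH c\<theta>]) simp
    show ?case unfolding YS by (intro continuous_on_add continuous_on_sum continuous_on_mult 1 2 3 c\<theta>')
  qed
  have lin: "\<bar>\<Sum>k\<in>UNIV. Kz j k p * (v k * \<theta>' j (fst p))\<bar> \<le> q * B"
    if "p \<in> S" "\<And>k. \<bar>v k\<bar> \<le> B" for j p v B
  proof -
    have B: "0 \<le> B" using that(2) abs_ge_zero order_trans by blast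
    have "\<bar>\<Sum>k\<in>UNIV. Kz j k p * (v k * \<theta>' j (fst p))\<bar> \<le> (\<Sum>k\<in>UNIV. \<bar>Kz j k p\<bar> * \<bar>\<theta>' j (fst p)\<bar> * B)"
    proof (rule order_trans[OF sum_abs sum_mono])
      fix k
      have "\<bar>Kz j k p\<bar> * \<bar>\<theta>' j (fst p)\<bar> * \<bar>v k\<bar> \<le> \<bar>Kz j k p\<bar> * \<bar>\<theta>' j (fst p)\<bar> * B"
        by (rule mult_left_mono[OF that(2)]) simp
      then show "\<bar>Kz j k p * (v k * \<theta>' j (fst p))\<bar> \<le> \<bar>Kz j k p\<bar> * \<bar>\<theta>' j (fst p)\<bar> * B"
        by (simp add: abs_mult mult_ac)
    qed
    also have "\<dots> = ((\<Sum>k\<in>UNIV. \<bar>Kz j k p\<bar>) * \<bar>\<theta>' j (fst p)\<bar>) * B" by (simp add: sum_distrib_right)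
    also have "\<dots> \<le> q * B" by (rule mult_right_mono[OF q(3)[OF that(1)] B])
    finally show ?thesis .
  qed
  define B where "B = C / (1 - q)"
  have B: "C + q * B = B" "B \<ge> 0" using q(1,2) C(2) by (simp_all add: B_def field_simps)
  have YB: "\<bar>Y n t $ j\<bar> \<le> B" for n t j
  proof (induction n arbitrary: t j)
    case 0
    then show ?case using B by (simp add: Y0)
  next
    case (Suc n)
    have "\<bar>Y (Suc n) t $ j\<bar> \<le> C + q * B" unfolding YS
      using C(1)[OF ZS'[of t n "\<theta> j t"], of j] lin[of _ "\<lambda>k. Y n (\<theta> j t) $ k", OF ZS'[of t n "\<theta> j t"] Suc.IH[of "\<theta> j t"], of j] by simp
    then show ?case using B by simp
  qed
  have close: "\<exists>N. \<forall>n\<ge>N. \<forall>m\<ge>N. \<forall>t s. \<bar>F (t, Z n s) - F (t, Z m s)\<bar> < e"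
    if F: "continuous_on UNIV F" "\<And>t y. F (t + 2 * pi, y) = F (t, y)" "e > 0"
    for F :: "real \<times> (real ^ 'n) \<Rightarrow> real" and e :: real
  proof -
    obtain d where d: "d > 0" "\<And>t y y'. (t, y) \<in> S \<Longrightarrow> (t, y') \<in> S \<Longrightarrow> (\<forall>k. \<bar>y $ k - y' $ k\<bar> < d) \<Longrightarrow>
        \<bar>F (t, y) - F (t, y')\<bar> < e"
      using slab_uniformly_continuous[OF F, of "2 * R"] unfolding S_def by blast
    have "(\<lambda>n. q0 ^ n * R) \<longlonglongrightarrow> 0 * R"
      by (intro tendsto_mult_right LIMSEQ_realpow_zero q0)
    then have "\<forall>\<^sub>F n in sequentially. q0 ^ n * R < d / 2"
      by (rule order_tendstoD) (use d(1) in simp)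
    then obtain N where N: "\<And>n. n \<ge> N \<Longrightarrow> q0 ^ n * R < d / 2" unfolding eventually_sequentially by blast
    have "\<bar>F (t, Z n s) - F (t, Z m s)\<bar> < e" if "n \<ge> N" "m \<ge> N" for n m t s
    proof (rule d(2)[OF ZS' ZS'], rule allI)
      fix k show "\<bar>Z n s $ k - Z m s $ k\<bar> < d"
        using Zz[of n s k] Zz[of m s k] N[OF that(1)] N[OF that(2)] by linarith
    qed
    then show ?thesis by blast
  qed
  define E where "E j n m t = (Kt j (t, Z n (\<theta> j t)) - Kt j (t, Z m (\<theta> j t))) +
      (\<Sum>k\<in>UNIV. (Kz j k (t, Z n (\<theta> j t)) - Kz j k (t, Z m (\<theta> j t))) * (Y m (\<theta> j t) $ k * \<theta>' j t))" for j n m t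
  have step: "\<exists>N. \<forall>n\<ge>N. \<forall>m\<ge>N. \<forall>t. \<bar>E j n m t\<bar> \<le> e"
    if "e > 0" for j e
  proof -
    have "\<exists>T. \<forall>p\<in>slab 0. \<bar>\<theta>' j (fst (p :: real \<times> (real ^ 'n)))\<bar> \<le> T"
      by (rule slab_bounded) (use c\<theta>'2 per\<theta>' in auto)
    then obtain T where T0: "\<And>p :: real \<times> (real ^ 'n). p \<in> slab 0 \<Longrightarrow> \<bar>\<theta>' j (fst p)\<bar> \<le> T" by blast
    have T: "\<bar>\<theta>' j t\<bar> \<le> T" for t using T0[of "(t, 0)"] by (simp add: slab_def)
    have T_nonneg: "0 \<le> T" using T[of 0] by linarith
    define d where "d = e / (2 * (real CARD('n) * (B * T) + 1))"
    have pos: "real CARD('n) * (B * T) + 1 > 0"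
      using B(2) T_nonneg by (intro add_nonneg_pos mult_nonneg_nonneg) auto
    then have d: "d > 0" using \<open>e > 0\<close> by (simp add: d_def)
    obtain N0 where N0: "\<And>n m t s. n \<ge> N0 \<Longrightarrow> m \<ge> N0 \<Longrightarrow> \<bar>Kt j (t, Z n s) - Kt j (t, Z m s)\<bar> < e / 2"
    proof -
      have "e / 2 > 0" using \<open>e > 0\<close> by simp
      from close[OF cKt perKt this, of j] show ?thesis using that by blast
    qed
    have "\<exists>N. \<forall>n\<ge>N. \<forall>m\<ge>N. \<forall>t s. \<bar>Kz j k (t, Z n s) - Kz j k (t, Z m s)\<bar> < d" for k
      by (rule close[OF cKz perKz d])
    then obtain N where N: "\<And>k n m t s. n \<ge> N k \<Longrightarrow> m \<ge> N k \<Longrightarrow> \<bar>Kz j k (t, Z n s) - Kz j k (t, Z m s)\<bar> < d" by metis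
    define M where "M = Max (insert N0 (range N))"
    have M: "M \<ge> N0" "\<And>k. M \<ge> N k" unfolding M_def by (rule Max_ge; simp)+
    show ?thesis
    proof (intro exI[of _ M] allI impI)
      fix n m t assume nm: "n \<ge> M" "m \<ge> M"
      have "\<bar>\<Sum>k\<in>UNIV. (Kz j k (t, Z n (\<theta> j t)) - Kz j k (t, Z m (\<theta> j t))) * (Y m (\<theta> j t) $ k * \<theta>' j t)\<bar>
          \<le> (\<Sum>k\<in>(UNIV :: 'n set). d * (B * T))"
      proof (rule order_trans[OF sum_abs sum_mono])
        fix k
        have "\<bar>Kz j k (t, Z n (\<theta> j t)) - Kz j k (t, Z m (\<theta> j t))\<bar> \<le> d"
          using N[of k n m] nm M(2)[of k] by (meson le_trans less_imp_le)
        then show "\<bar>(Kz j k (t, Z n (\<theta> j t)) - Kz j k (t, Z m (\<theta> j t))) * (Y m (\<theta> j t) $ k * \<theta>' j t)\<bar> \<le> d * (B * T)"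
          unfolding abs_mult using d B(2) T_nonneg by (intro mult_mono YB T) auto
      qed
      also have "\<dots> = d * (real CARD('n) * (B * T))" by simp
      also have "\<dots> \<le> d * (real CARD('n) * (B * T) + 1)" using d by (intro mult_left_mono) auto
      also have "\<dots> = e / 2" using pos by (simp add: d_def field_simps)
      finally show "\<bar>E j n m t\<bar> \<le> e" unfolding E_def
        using N0[of n m t "\<theta> j t"] nm M(1) by linarith
    qed
  qed
  \<comment> \<open>Beyond index \<open>M\<close> each further iteration shrinks the distance of two derivative iterates by \<open>q\<close> up to an
    error \<open>(1 - q) e / 2\<close>, and these errors add up to at most \<open>e / 2\<close>.\<close>
  have Cauchy: "\<exists>N. \<forall>n\<ge>N. \<forall>m\<ge>N. \<forall>t j. \<bar>Y n t $ j - Y m t $ j\<bar> < e" if "e > 0" for e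
  proof -
    define e' where "e' = (1 - q) * (e / 2)"
    have e': "e' > 0" using q(2) that by (simp add: e'_def)
    from choice[OF allI[OF step[OF e']]] obtain N
      where N: "\<forall>j. \<forall>n\<ge>N j. \<forall>m\<ge>N j. \<forall>t. \<bar>E j n m t\<bar> \<le> e'" ..
    define M where "M = Max (range N)"
    have M: "M \<ge> N j" for j by (auto simp: M_def)
    have it: "\<bar>Y (n + p) t $ j - Y (m + p) t $ j\<bar> \<le> q ^ p * (2 * B) + e / 2" if "n \<ge> M" "m \<ge> M" for n m p t j
    proof (induction p arbitrary: t j)
      case 0
      then show ?case using YB[of n t j] YB[of m t j] \<open>e > 0\<close> by simp
    next
      case (Suc p)
      let ?n = "n + p" and ?m = "m + p" and ?s = "\<theta> j t"
      let ?E = "E j ?n ?m t"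
      have split: "Y (Suc ?n) t $ j - Y (Suc ?m) t $ j =
          (\<Sum>k\<in>UNIV. Kz j k (t, Z ?n ?s) * ((Y ?n ?s $ k - Y ?m ?s $ k) * \<theta>' j (fst (t, Z ?n ?s)))) + ?E"
        unfolding YS E_def by (simp add: algebra_simps sum_subtractf sum.distrib)
      have "\<bar>?E\<bar> \<le> e'" using N M[of j] that by (meson le_trans trans_le_add1)
      moreover have "\<bar>\<Sum>k\<in>UNIV. Kz j k (t, Z ?n ?s) * ((Y ?n ?s $ k - Y ?m ?s $ k) * \<theta>' j (fst (t, Z ?n ?s)))\<bar>
          \<le> q * (q ^ p * (2 * B) + e / 2)"
        by (rule lin[OF ZS' Suc.IH])
      ultimately have "\<bar>Y (Suc ?n) t $ j - Y (Suc ?m) t $ j\<bar> \<le> q * (q ^ p * (2 * B) + e / 2) + e'"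
        unfolding split by linarith
      also have "\<dots> = q ^ Suc p * (2 * B) + e / 2" by (simp add: e'_def field_simps)
      finally show ?case by simp
    qed
    have "(\<lambda>p. q ^ p * (2 * B)) \<longlonglongrightarrow> 0 * (2 * B)"
      by (intro tendsto_mult_right LIMSEQ_realpow_zero q)
    then have "\<forall>\<^sub>F p in sequentially. q ^ p * (2 * B) < e / 2"
      by (rule order_tendstoD) (use that in simp)
    then obtain p where p: "q ^ p * (2 * B) < e / 2" by (auto simp: eventually_sequentially)
    have "\<bar>Y n t $ j - Y m t $ j\<bar> < e" if "n \<ge> M + p" "m \<ge> M + p" for n m t j
    proof -
      have "n - p \<ge> M" "m - p \<ge> M" "n - p + p = n" "m - p + p = m" using that by auto
      with it[of "n - p" "m - p" p t j] p show ?thesis by simp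
    qed
    then show ?thesis by blast
  qed
  have "\<exists>y. uniform_limit UNIV (\<lambda>n t. Y n t $ j) y sequentially" for j
  proof -
    have "uniformly_Cauchy_on UNIV (\<lambda>n t. Y n t $ j)"
      unfolding uniformly_Cauchy_on_def dist_real_def using Cauchy by blast
    then show ?thesis using Cauchy_uniformly_convergent uniformly_convergent_on_def by blast
  qed
  then obtain y where y: "\<And>j. uniform_limit UNIV (\<lambda>n t. Y n t $ j) (y j) sequentially" by metis
  show ?thesis
  proof (rule that[of "\<lambda>t. \<chi> j. y j t"])
    show "continuous_on UNIV (\<lambda>t. \<chi> j. y j t)"
      by (intro continuous_on_vec_lambda uniform_limit_theorem[OF _ y]) (auto simp: cY)
    show "((\<lambda>t. z t $ k) has_real_derivative (\<chi> j. y j t) $ k) (at t)" for t k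
      using has_real_derivative_uniform_limit[of UNIV "\<lambda>n t. Z n t $ k" "\<lambda>n t. Y n t $ k" "y k" "\<lambda>t. z t $ k" t]
        ZY y Zlim by simp
  qed
qed

section \<open>Damped transport along one family of characteristics\<close>

context speed
begin

text \<open>When \<open>c\<close> is the inflow end, this is the time at which the characteristic leaving at time \<open>t\<close> has
  entered.\<close>

definition backtrace :: "real \<Rightarrow> real \<Rightarrow> real" where
  "backtrace c t = flow (c, foot (1 - c, t))"

definition backtrace_deriv :: "real \<Rightarrow> real \<Rightarrow> real" where
  "backtrace_deriv c t = flow_deriv (c, foot (1 - c, t)) / flow_deriv (1 - c, foot (1 - c, t))"

lemma backtrace_has_derivative:
  assumes "c \<in> {0, 1}"
  shows "(backtrace c has_real_derivative backtrace_deriv c t) (at t)"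
  using DERIV_chain2[OF flow_has_derivative C1tD(3)[OF C1t_foot], of c "1 - c" t] assms
  unfolding backtrace_def[abs_def] backtrace_deriv_def by auto

lemma continuous_backtrace_deriv:
  assumes "c \<in> {0, 1}"
  shows "continuous_on UNIV (backtrace_deriv c)"
proof -
  have "continuous_on UNIV (\<lambda>t. foot (1 - c, t))"
    by (rule continuous_on_strip_compose[OF continuous_foot]) (use assms in \<open>auto intro: continuous_intros\<close>)
  then have "continuous_on UNIV (\<lambda>t. flow_deriv (b, foot (1 - c, t)))" if "b \<in> {0, 1}" for b
    by (rule continuous_on_strip_compose[OF continuous_flow_deriv continuous_on_const]) (use that in auto)
  from continuous_on_divide[OF this this, of c "1 - c"] show ?thesis
    using assms unfolding backtrace_deriv_def[abs_def] by auto
qed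

lemma backtrace_deriv_eq_exp:
  assumes "c \<in> {0, 1}"
  shows "backtrace_deriv c t = exp ((2 * c - 1) * integral {0..1} (\<lambda>\<eta>. \<alpha>' (\<eta>, flow (\<eta>, foot (1 - c, t)))))"
proof (cases "c = 0")
  case True
  then show ?thesis
    by (simp add: backtrace_deriv_def flow_deriv_def prim_def exp_minus inverse_eq_divide)
next
  case False
  with assms have "c = 1" by simp
  then show ?thesis by (simp add: backtrace_deriv_def flow_deriv_def prim_def)
qed

lemma transport_integral:
  assumes "transport \<alpha> b \<beta>" "is_char \<alpha> w"
  shows "integral {0..1} (\<lambda>\<eta>. \<beta> (\<eta>, w \<eta>)) = b (1, w 1) - b (0, w 0)"
  using fundamental_theorem_of_calculus[of 0 1 "\<lambda>x. b (x, w x)" "\<lambda>\<eta>. \<beta> (\<eta>, w \<eta>)"] transportD(3)[OF assms]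
  by (intro integral_unique) (simp add: has_real_derivative_iff_has_vector_derivative)

lemma flow_shift:
  assumes "periodic_t \<alpha>" "x \<in> {0..1}"
  shows "flow (x, \<sigma> + 2 * pi) = flow (x, \<sigma>) + 2 * pi"
proof -
  have "is_char \<alpha> (\<lambda>x. flow (x, \<sigma>) + 2 * pi)" unfolding is_char_def
  proof
    fix y :: real assume y: "y \<in> {0..1}"
    from DERIV_add[OF is_charD[OF flow_char y] DERIV_const]
    show "((\<lambda>x. flow (x, \<sigma>) + 2 * pi) has_real_derivative \<alpha> (y, flow (y, \<sigma>) + 2 * pi)) (at y within {0..1})"
      using assms(1) y by (simp add: periodic_t_def)
  qed
  from char_eq_flow[OF this assms(2)] show ?thesis by simp
qed

lemma foot_shift:
  assumes "periodic_t \<alpha>" "x \<in> {0..1}"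
  shows "foot (x, t + 2 * pi) = foot (x, t) + 2 * pi"
  using flow_shift[OF assms, of "foot (x, t)"] foot_flow[OF assms(2), of "foot (x, t) + 2 * pi"] assms(2)
  by simp

lemma backtrace_shift:
  assumes "periodic_t \<alpha>" "c \<in> {0, 1}"
  shows "backtrace c (t + 2 * pi) = backtrace c t + 2 * pi"
  using assms by (auto simp: backtrace_def foot_shift flow_shift)

text \<open>The integral of \<open>\<beta>\<close> along the characteristic from its outflow to its inflow end, exponentiated; the
  factor \<open>2c - 1\<close> is the orientation sign.\<close>

definition damping :: "real \<Rightarrow> (real \<times> real \<Rightarrow> real) \<Rightarrow> real \<Rightarrow> real" where
  "damping c \<beta> t = exp ((2 * c - 1) * integral {0..1} (\<lambda>\<eta>. \<beta> (\<eta>, flow (\<eta>, foot (1 - c, t)))))"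

lemma damping_shift:
  assumes "periodic_t \<alpha>" "periodic_t \<beta>" "c \<in> {0, 1}"
  shows "damping c \<beta> (t + 2 * pi) = damping c \<beta> t"
proof -
  have "integral {0..1} (\<lambda>\<eta>. \<beta> (\<eta>, flow (\<eta>, foot (1 - c, t + 2 * pi))))
      = integral {0..1} (\<lambda>\<eta>. \<beta> (\<eta>, flow (\<eta>, foot (1 - c, t))))"
    by (rule integral_cong)
      (use assms in \<open>auto simp: foot_shift flow_shift periodic_t_def\<close>)
  then show ?thesis by (simp add: damping_def)
qed

text \<open>If \<open>e\<close> solves \<open>\<partial>\<^sub>x e + \<alpha> \<partial>\<^sub>t e = \<beta> e\<close>, then \<open>e (v + S)\<close> solves a transport equation with right-hand side
  \<open>e (E + \<beta> S)\<close>, which is in \<open>C1t\<close> and does not involve \<open>v\<close>. So the outflow values of \<open>v\<close> are a damped and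
  delayed copy of the inflow values up to a differentiable function, and the regularity of \<open>v\<close> is decided on
  the inflow boundary.\<close>

lemma damped_transport:
  assumes T: "transport \<alpha> (\<lambda>q. v q + S q) (\<lambda>q. E q - \<beta> q * v q)"
    and S: "C1t S S'" and E: "C1t E E'" and \<beta>: "C1t \<beta> \<beta>'" and c: "c \<in> {0, 1}"
  shows "\<exists>\<gamma>'. continuous_on UNIV \<gamma>' \<and> (\<forall>t. (damping c \<beta> has_real_derivative \<gamma>' t) (at t))"
    and "\<exists>g g'. continuous_on UNIV g' \<and> (\<forall>t. (g has_real_derivative g' t) (at t)) \<and>
      (\<forall>t. v (1 - c, t) = damping c \<beta> t * v (c, backtrace c t) + g t)"
    and "\<And>b'. continuous_on UNIV b' \<Longrightarrow> (\<And>t. ((\<lambda>s. v (c, s)) has_real_derivative b' t) (at t)) \<Longrightarrow>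
      C1t v (partial_t v)"
proof -
  have c01: "c \<in> {0..1}" "1 - c \<in> {0..1}" using c by auto
  have line: "continuous_on UNIV (\<lambda>t. F (x, k t))"
    if "continuous_on strip F" "x \<in> {0..1}" "continuous_on UNIV k" for F k x
    by (rule continuous_on_strip_compose[OF that(1) continuous_on_const that(3)]) (rule that(2))
  obtain b where b: "transport \<alpha> b \<beta>" "\<And>t. b (c, t) = 0"
    by (rule transport_solvable[OF C1tD(1)[OF \<beta>] c01(1)]) (rule that)
  obtain b' where b': "C1t b b'"
    by (rule transport_C1t[OF b(1) \<beta> c01(1), of "\<lambda>t. 0"]) (use b(2) in auto)
  have damp: "damping c \<beta> t = exp (- b (1 - c, t))" for t
  proof -
    let ?w = "\<lambda>\<eta>. flow (\<eta>, foot (1 - c, t))"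
    have "integral {0..1} (\<lambda>\<eta>. \<beta> (\<eta>, ?w \<eta>)) = b (1, ?w 1) - b (0, ?w 0)"
      by (rule transport_integral[OF b(1) flow_char])
    moreover have "?w (1 - c) = t" using c01 by simp
    ultimately show ?thesis using c b(2) unfolding damping_def by auto
  qed
  note damp_C1 = C1tD[OF C1t_exp[OF C1t_minus[OF b']]]
  have damp': "(damping c \<beta> has_real_derivative exp (- b (1 - c, t)) * - b' (1 - c, t)) (at t)" for t
    using damp_C1(3)[OF c01(2), of t] by (simp add: damp[abs_def])
  then show "\<exists>\<gamma>'. continuous_on UNIV \<gamma>' \<and> (\<forall>t. (damping c \<beta> has_real_derivative \<gamma>' t) (at t))"
    using line[OF damp_C1(2) c01(2) continuous_on_id] by blast
  define e where "e q = exp (b q)" for q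
  have e: "transport \<alpha> e (\<lambda>q. e q * \<beta> q)" using transport_exp[OF b(1)] by (simp add: e_def[abs_def])
  have Ce: "C1t e (\<lambda>q. e q * b' q)" using C1t_exp[OF b'] by (simp add: e_def[abs_def])
  define f where "f q = e q * (E q + \<beta> q * S q)" for q
  obtain f' where f': "C1t f f'"
    using C1t_mult[OF Ce C1t_add[OF E C1t_mult[OF \<beta> S]]] by (simp add: f_def[abs_def])
  have ev: "transport \<alpha> (\<lambda>q. e q * (v q + S q)) f"
    by (rule transport_cong[OF transport_mult[OF e T]]) (simp_all add: f_def algebra_simps)
  obtain A where A: "transport \<alpha> A f" "\<And>t. A (c, t) = 0"
    by (rule transport_solvable[OF C1tD(1)[OF f'] c01(1)]) (rule that)
  obtain A' where A': "C1t A A'"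
    by (rule transport_C1t[OF A(1) f' c01(1), of "\<lambda>t. 0"]) (use A(2) in auto)
  let ?\<theta> = "backtrace c" and ?\<theta>' = "backtrace_deriv c"
  note \<theta>' = backtrace_has_derivative[OF c]
  define k where "k t = A (1 - c, t) + S (c, ?\<theta> t)" for t
  have c\<theta>: "continuous_on UNIV ?\<theta>"
    by (rule DERIV_continuous_on[OF has_field_derivative_at_within[OF \<theta>']])
  have k': "(k has_real_derivative A' (1 - c, t) + S' (c, ?\<theta> t) * ?\<theta>' t) (at t)" for t
    unfolding k_def[abs_def]
    by (intro DERIV_add C1tD(3)[OF A'] c01 DERIV_chain2[OF C1tD(3)[OF S] \<theta>'])
  have ck: "continuous_on UNIV k"
    by (rule DERIV_continuous_on[OF has_field_derivative_at_within[OF k']])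
  let ?g = "\<lambda>t. damping c \<beta> t * k t - S (1 - c, t)"
  let ?g' = "\<lambda>t. (exp (- b (1 - c, t)) * - b' (1 - c, t)) * k t
      + (A' (1 - c, t) + S' (c, ?\<theta> t) * ?\<theta>' t) * damping c \<beta> t - S' (1 - c, t)"
  have g': "(?g has_real_derivative ?g' t) (at t)" for t
    by (intro DERIV_diff DERIV_mult damp' k' C1tD(3)[OF S] c01)
  have cg': "continuous_on UNIV ?g'"
    by (intro line[OF damp_C1(2) c01(2) continuous_on_id] continuous_on_diff continuous_on_add
        continuous_on_mult ck line[OF C1tD(2)[OF A'] c01(2) continuous_on_id]
        line[OF C1tD(2)[OF S] c01(1) c\<theta>] line[OF C1tD(2)[OF S] c01(2) continuous_on_id]
        continuous_backtrace_deriv[OF c] DERIV_continuous_on[OF has_field_derivative_at_within[OF damp']])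
  have "v (1 - c, t) = damping c \<beta> t * v (c, ?\<theta> t) + ?g t" for t
  proof -
    let ?w = "\<lambda>\<eta>. flow (\<eta>, foot (1 - c, t))"
    let ?h = "\<lambda>q. e q * (v q + S q) - A q"
    have "((\<lambda>x. ?h (x, ?w x)) has_real_derivative 0) (at x within {0..1})" if "x \<in> {0..1}" for x
      using DERIV_diff[OF transportD(3)[OF ev flow_char that] transportD(3)[OF A(1) flow_char that],
          of "foot (1 - c, t)" "foot (1 - c, t)"] by simp
    note const = constant_from_0[of "\<lambda>x. ?h (x, ?w x)", OF this]
    have "?h (1 - c, ?w (1 - c)) = ?h (c, ?w c)" using const[OF _ c01(1)] const[OF _ c01(2)] by simp
    then have "e (1 - c, t) * (v (1 - c, t) + S (1 - c, t)) - A (1 - c, t) = v (c, ?\<theta> t) + S (c, ?\<theta> t)"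
      using c01(2) A(2) b(2) by (simp add: e_def backtrace_def)
    moreover have "damping c \<beta> t * e (1 - c, t) = 1" by (simp add: damp e_def exp_minus)
    ultimately have "v (1 - c, t) + S (1 - c, t) = damping c \<beta> t * (v (c, ?\<theta> t) + S (c, ?\<theta> t) + A (1 - c, t))"
      by (metis (no_types, opaque_lifting) add_diff_cancel_right' diff_add_cancel mult.assoc mult_1)
    then show ?thesis by (simp add: k_def algebra_simps)
  qed
  with g' cg' show "\<exists>g g'. continuous_on UNIV g' \<and> (\<forall>t. (g has_real_derivative g' t) (at t)) \<and>
      (\<forall>t. v (1 - c, t) = damping c \<beta> t * v (c, backtrace c t) + g t)"
    by (intro exI[of _ ?g] exI[of _ ?g']) blast
  fix d assume d: "continuous_on UNIV d" "\<And>t. ((\<lambda>s. v (c, s)) has_real_derivative d t) (at t)"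
  obtain V' where V': "C1t (\<lambda>q. e q * (v q + S q)) V'"
  proof (rule transport_C1t[OF ev f' c01(1)])
    show "((\<lambda>s. e (c, s) * (v (c, s) + S (c, s))) has_real_derivative d t + S' (c, t)) (at t)" for t
      using DERIV_add[OF d(2) C1tD(3)[OF S c01(1)], of t] b(2) by (simp add: e_def)
    show "continuous_on UNIV (\<lambda>t. d t + S' (c, t))"
      by (intro continuous_on_add d(1) line[OF C1tD(2)[OF S] c01(1) continuous_on_id])
  qed
  have "C1t v (\<lambda>q. (exp (- b q) * - b' q) * (e q * (v q + S q)) + V' q * exp (- b q) - S' q)"
    by (rule C1t_cong[OF C1t_diff[OF C1t_mult[OF C1t_exp[OF C1t_minus[OF b']] V'] S]])
      (simp_all add: e_def flip: mult.assoc exp_add)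
  then show "C1t v (partial_t v)" by (rule C1t_partial_t_self)
qed

end

section \<open>One more derivative for mixed problems\<close>

text \<open>In this and the following definitions \<open>c k\<close>, either \<open>0\<close> or \<open>1\<close>, is the inflow end of the \<open>k\<close>-th family.\<close>

definition out_trace :: "('n \<Rightarrow> real) \<Rightarrow> ('n \<Rightarrow> real \<times> real \<Rightarrow> real) \<Rightarrow> real \<Rightarrow> real ^ 'n" where
  "out_trace c v t = (\<chi> k. v k (1 - c k, t))"

definition mixed_solution ::
  "('n::finite \<Rightarrow> real \<times> real \<Rightarrow> real) \<Rightarrow> ('n \<Rightarrow> real) \<Rightarrow> ('n \<Rightarrow> real \<times> real \<Rightarrow> real) \<Rightarrow>
   ('n \<Rightarrow> 'n \<Rightarrow> real \<times> real \<Rightarrow> real) \<Rightarrow> ('n \<Rightarrow> real \<times> real \<Rightarrow> real) \<Rightarrow>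
   ('n \<Rightarrow> real \<times> (real ^ 'n) \<Rightarrow> real) \<Rightarrow> ('n \<Rightarrow> real \<times> real \<Rightarrow> real) \<Rightarrow> bool" where
  "mixed_solution \<alpha> c \<beta> B G H v \<longleftrightarrow> (\<forall>j. periodic_t (v j)) \<and>
     (\<forall>j. transport (\<alpha> j) (v j) (\<lambda>q. G j q - \<beta> j q * v j q - (\<Sum>k\<in>UNIV - {j}. B j k q * v k q))) \<and>
     (\<forall>j t. v j (c j, t) = H j (t, out_trace c v t))"

text \<open>The functions \<open>Hz j k\<close> stand for the partial derivatives of the boundary map \<open>H j\<close> with respect to the
  outflow values. The exponential is the damping along a characteristic times the \<open>l\<close>-th power of the derivative of
  its delay map; these are the factors that the \<open>l\<close>-th \<open>t\<close>-derivative picks up in one passage.\<close>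

definition dissipative ::
  "('n::finite \<Rightarrow> real \<times> real \<Rightarrow> real) \<Rightarrow> ('n \<Rightarrow> real \<times> real \<Rightarrow> real) \<Rightarrow> ('n \<Rightarrow> real) \<Rightarrow>
   ('n \<Rightarrow> real \<times> real \<Rightarrow> real) \<Rightarrow> ('n \<Rightarrow> 'n \<Rightarrow> real \<times> (real ^ 'n) \<Rightarrow> real) \<Rightarrow> nat \<Rightarrow> bool" where
  "dissipative \<alpha> \<alpha>' c \<beta> Hz l \<longleftrightarrow> (\<forall>j w z. is_char (\<alpha> j) w \<longrightarrow>
     exp ((2 * c j - 1) * integral {0..1} (\<lambda>\<eta>. \<beta> j (\<eta>, w \<eta>) + real l * \<alpha>' j (\<eta>, w \<eta>)))
       * (\<Sum>k\<in>UNIV. \<bar>Hz j k (w (c j), z)\<bar>) < 1)"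

text \<open>Here \<open>p\<close> is a coefficient with \<open>b = p (\<alpha>\<^sub>j - \<alpha>\<^sub>k)\<close>. Since \<open>(\<alpha>\<^sub>j - \<alpha>\<^sub>k) \<partial>\<^sub>t\<close> is the difference of the
  derivatives along the \<open>j\<close>-th and the \<open>k\<close>-th characteristics, the primitive of \<open>p v\<close> absorbs the
  coupling term \<open>b v\<close> of the \<open>j\<close>-th equation up to a remainder that is differentiable in \<open>t\<close>.\<close>

lemma absorb_coupling:
  assumes \<alpha>k: "speed \<alpha>k \<alpha>k'" and c\<alpha>j: "continuous_on strip \<alpha>j"
    and v: "transport \<alpha>k v g" and p: "Ck_on 1 p strip"
    and b: "\<And>q. q \<in> strip \<Longrightarrow> b q = p q * (\<alpha>j q - \<alpha>k q)"
  obtains \<Phi> R where "C1t \<Phi> (partial_t \<Phi>)" "C1t R (partial_t R)" "transport \<alpha>j \<Phi> (\<lambda>q. R q + b q * v q)"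
proof -
  interpret k: speed \<alpha>k \<alpha>k' by (rule \<alpha>k)
  obtain px pt where pd: "\<And>q. q \<in> strip \<Longrightarrow> (p has_derivative (\<lambda>d. px q * fst d + pt q * snd d)) (at q within strip)"
    and pc: "Ck_on 0 px strip" "Ck_on 0 pt strip"
    by (rule Ck_on_strip_SucE[OF p[unfolded One_nat_def]]) (rule that)
  have P: "transport \<alpha>k p (\<lambda>q. px q + \<alpha>k q * pt q)"
    by (rule transport_if_joint[OF pd]) (use pc C1tD(1)[OF k.C1] in auto)
  show ?thesis
  proof (rule k.transport_primitive[OF transport_mult[OF P v]])
    fix \<Phi> R
    assume \<Phi>: "C1t \<Phi> (\<lambda>q. p q * v q)" "transport \<alpha>k \<Phi> R"
      and R: "C1t R (\<lambda>q. (px q + \<alpha>k q * pt q) * v q + g q * p q + \<alpha>k' q * (p q * v q))"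
    have "transport \<alpha>j \<Phi> (\<lambda>q. R q + b q * v q)"
      by (rule transport_cong[OF k.transport_change_speed[OF \<Phi>(2,1) c\<alpha>j]]) (simp_all add: b algebra_simps)
    with C1t_partial_t_self[OF \<Phi>(1)] C1t_partial_t_self[OF R] show ?thesis by (rule that)
  qed
qed

locale hyperbolic =
  fixes \<alpha> \<alpha>' :: "'n::finite \<Rightarrow> real \<times> real \<Rightarrow> real" and c :: "'n \<Rightarrow> real"
  assumes speed: "\<And>j. speed (\<alpha> j) (\<alpha>' j)" and periodic: "\<And>j. periodic_t (\<alpha> j)"
    and end_point: "\<And>j. c j \<in> {0, 1}"
begin

lemma end_points: "c j \<in> {0..1}" "1 - c j \<in> {0..1}"
  using end_point[of j] by auto

lemma out_trace_periodic:
  assumes "\<And>j. periodic_t (v j)"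
  shows "out_trace c v (t + 2 * pi) = out_trace c v t"
  using assms end_points unfolding out_trace_def periodic_t_def by (simp add: vec_eq_iff)

lemma continuous_out_trace:
  assumes "\<And>j. continuous_on strip (v j)"
  shows "continuous_on UNIV (out_trace c v)"
  unfolding out_trace_def
  by (intro continuous_on_vec_lambda continuous_on_strip_compose[OF assms] continuous_on_const
      continuous_on_id end_points)

text \<open>The derivative exists because the outflow values solve a functional equation with differentiable data.
  Its equation results from differentiating along characteristics, where the commutator of \<open>\<partial>\<^sub>t\<close> with
  \<open>\<partial>\<^sub>x + \<alpha> \<partial>\<^sub>t\<close> adds \<open>\<alpha>'\<close> to the damping.\<close>

lemma mixed_solution_C1t:
  assumes sol: "mixed_solution \<alpha> c \<beta> B G H v"
    and \<beta>: "\<And>j. C1t (\<beta> j) (\<beta>' j)" "\<And>j. periodic_t (\<beta> j)"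
    and B: "\<And>j k. j \<noteq> k \<Longrightarrow> C1t (B j k) (B' j k)"
    and p: "\<And>j k. j \<noteq> k \<Longrightarrow> Ck_on 1 (p j k) strip"
      "\<And>j k q. j \<noteq> k \<Longrightarrow> q \<in> strip \<Longrightarrow> B j k q = p j k q * (\<alpha> j q - \<alpha> k q)"
    and G: "\<And>j. C1t (G j) (G' j)"
    and H: "\<And>j p. (H j has_derivative (\<lambda>d. Ht j p * fst d + (\<Sum>k\<in>UNIV. Hz j k p * snd d $ k))) (at p)"
      "\<And>j. continuous_on UNIV (Ht j)" "\<And>j k. continuous_on UNIV (Hz j k)"
      "\<And>j t y. H j (t + 2 * pi, y) = H j (t, y)"
    and diss: "dissipative \<alpha> \<alpha>' c \<beta> Hz 0" "dissipative \<alpha> \<alpha>' c \<beta> Hz 1"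
  obtains v' where "\<And>j. C1t (v j) (v' j)"
    "mixed_solution \<alpha> c (\<lambda>j q. \<beta> j q + \<alpha>' j q) B
      (\<lambda>j q. G' j q - \<beta>' j q * v j q - (\<Sum>k\<in>UNIV - {j}. B' j k q * v k q))
      (\<lambda>j p. Ht j (fst p, out_trace c v (fst p))
        + (\<Sum>k\<in>UNIV. Hz j k (fst p, out_trace c v (fst p)) * snd p $ k)) v'"
proof -
  define F where "F j q = G j q - \<beta> j q * v j q - (\<Sum>k\<in>UNIV - {j}. B j k q * v k q)" for j q
  have per: "\<And>j. periodic_t (v j)" and tr: "\<And>j. transport (\<alpha> j) (v j) (F j)"
    and bc: "\<And>j t. v j (c j, t) = H j (t, out_trace c v t)"
    using sol by (auto simp: mixed_solution_def F_def[abs_def])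
  note cv = transportD(1)[OF tr]
  let ?\<zeta> = "out_trace c v"
  note c\<zeta> = continuous_out_trace[of v, OF cv] and per\<zeta> = out_trace_periodic[of v, OF per]

  \<comment> \<open>All coupling terms of the \<open>j\<close>-th equation are absorbed at once; the pair \<open>X\<close> collects the correction to
    \<open>v j\<close> and the differentiable part of the right-hand side.\<close>
  have "\<exists>X. C1t (fst X) (partial_t (fst X)) \<and> C1t (snd X) (partial_t (snd X)) \<and>
    transport (\<alpha> j) (\<lambda>q. v j q + fst X q) (\<lambda>q. snd X q - \<beta> j q * v j q)" for j
  proof -
    have "\<exists>Y. k \<noteq> j \<longrightarrow> C1t (fst Y) (partial_t (fst Y)) \<and> C1t (snd Y) (partial_t (snd Y)) \<and>
        transport (\<alpha> j) (fst Y) (\<lambda>q. snd Y q + B j k q * v k q)" for k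
    proof (cases "k = j")
      case False
      show ?thesis
      proof (rule absorb_coupling[OF speed[of k] C1tD(1)[OF speed.C1[OF speed[of j]]] tr[of k]
            p(1)[OF False[symmetric]], of "B j k"])
        show "B j k q = p j k q * (\<alpha> j q - \<alpha> k q)" if "q \<in> strip" for q
          by (rule p(2)[OF False[symmetric] that])
        fix \<Phi> R
        assume "C1t \<Phi> (partial_t \<Phi>)" "C1t R (partial_t R)" "transport (\<alpha> j) \<Phi> (\<lambda>q. R q + B j k q * v k q)"
        then show ?thesis by (intro exI[of _ "(\<Phi>, R)"]) simp
      qed
    qed simp
    then have "\<forall>k. \<exists>Y. k \<noteq> j \<longrightarrow> C1t (fst Y) (partial_t (fst Y)) \<and> C1t (snd Y) (partial_t (snd Y)) \<and>
        transport (\<alpha> j) (fst Y) (\<lambda>q. snd Y q + B j k q * v k q)" ..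
    from choice[OF this] obtain Y where Y: "\<And>k. k \<in> UNIV - {j} \<Longrightarrow> C1t (fst (Y k)) (partial_t (fst (Y k)))"
      "\<And>k. k \<in> UNIV - {j} \<Longrightarrow> C1t (snd (Y k)) (partial_t (snd (Y k)))"
      "\<And>k. k \<in> UNIV - {j} \<Longrightarrow> transport (\<alpha> j) (fst (Y k)) (\<lambda>q. snd (Y k) q + B j k q * v k q)"
      by auto
    let ?S = "\<lambda>q. \<Sum>k\<in>UNIV - {j}. fst (Y k) q" and ?E = "\<lambda>q. G j q + (\<Sum>k\<in>UNIV - {j}. snd (Y k) q)"
    have "transport (\<alpha> j) (\<lambda>q. v j q + ?S q) (\<lambda>q. ?E q - \<beta> j q * v j q)"
      by (rule transport_cong[OF transport_add[OF tr[of j] transport_sum[of "UNIV - {j}" _ "\<lambda>k. fst (Y k)",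
                OF finite Y(3)]]])
        (simp_all add: F_def sum.distrib)
    with C1t_partial_t_self[OF C1t_sum[of "UNIV - {j}", OF _ Y(1)]]
      C1t_partial_t_self[OF C1t_add[OF G[of j] C1t_sum[of "UNIV - {j}", OF _ Y(2)]]]
    show ?thesis by (intro exI[of _ "(?S, ?E)"]) simp
  qed
  then have "\<forall>j. \<exists>X. C1t (fst X) (partial_t (fst X)) \<and> C1t (snd X) (partial_t (snd X)) \<and>
    transport (\<alpha> j) (\<lambda>q. v j q + fst X q) (\<lambda>q. snd X q - \<beta> j q * v j q)" ..
  from choice[OF this] obtain X where S: "\<And>j. C1t (fst (X j)) (partial_t (fst (X j)))"
    and E: "\<And>j. C1t (snd (X j)) (partial_t (snd (X j)))"
    and SE: "\<And>j. transport (\<alpha> j) (\<lambda>q. v j q + fst (X j) q) (\<lambda>q. snd (X j) q - \<beta> j q * v j q)"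
    by auto
  note damped = speed.damped_transport[OF speed SE S E \<beta>(1) end_point]

  define \<theta> where "\<theta> j = speed.backtrace (\<alpha> j) (c j)" for j
  define \<theta>' where "\<theta>' j = speed.backtrace_deriv (\<alpha> j) (\<alpha>' j) (c j)" for j
  define \<gamma> where "\<gamma> j = speed.damping (\<alpha> j) (c j) (\<beta> j)" for j
  have \<theta>: "(\<theta> j has_real_derivative \<theta>' j t) (at t)" "continuous_on UNIV (\<theta>' j)"
    "\<theta> j (t + 2 * pi) = \<theta> j t + 2 * pi" for j t
    unfolding \<theta>_def \<theta>'_def
    by (rule speed.backtrace_has_derivative[OF speed end_point]
        speed.continuous_backtrace_deriv[OF speed end_point] speed.backtrace_shift[OF speed periodic end_point])+
  have c\<theta>: "continuous_on UNIV (\<theta> j)" for j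
    by (rule DERIV_continuous_on[OF has_field_derivative_at_within[OF \<theta>(1)]])
  have "\<forall>j. \<exists>\<gamma>'. continuous_on UNIV \<gamma>' \<and> (\<forall>t. (\<gamma> j has_real_derivative \<gamma>' t) (at t))"
    unfolding \<gamma>_def using damped(1) by blast
  then obtain \<gamma>' where \<gamma>': "\<And>j. continuous_on UNIV (\<gamma>' j)" "\<And>j t. (\<gamma> j has_real_derivative \<gamma>' j t) (at t)"
    by metis
  have "\<forall>j. \<exists>g g'. continuous_on UNIV g' \<and> (\<forall>t. (g has_real_derivative g' t) (at t)) \<and>
      (\<forall>t. v j (1 - c j, t) = \<gamma> j t * v j (c j, \<theta> j t) + g t)"
    unfolding \<gamma>_def \<theta>_def using damped(2) by blast
  then obtain g g' where g': "\<And>j. continuous_on UNIV (g' j)" "\<And>j t. (g j has_real_derivative g' j t) (at t)"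
    "\<And>j t. v j (1 - c j, t) = \<gamma> j t * v j (c j, \<theta> j t) + g j t" by metis
  have c\<gamma>: "continuous_on UNIV (\<gamma> j)" for j
    by (rule DERIV_continuous_on[OF has_field_derivative_at_within[OF \<gamma>'(2)]])

  \<comment> \<open>Inserting the boundary condition into the damped and delayed copy turns it into a functional equation for
    the outflow values alone.\<close>
  define K where "K j p = \<gamma> j (fst p) * H j (\<theta> j (fst p), snd p) + g j (fst p)" for j p
  define Kt where "Kt j p = \<gamma>' j (fst p) * H j (\<theta> j (fst p), snd p)
    + \<gamma> j (fst p) * (Ht j (\<theta> j (fst p), snd p) * \<theta>' j (fst p)) + g' j (fst p)" for j p
  define Kz where "Kz j k p = \<gamma> j (fst p) * Hz j k (\<theta> j (fst p), snd p)" for j k p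
  have trace_eq: "?\<zeta> t $ j = K j (t, ?\<zeta> (\<theta> j t))" for t j
    using g'(3)[of j t] bc[of j "\<theta> j t"] by (simp add: K_def out_trace_def)
  have along: "\<exists>w. is_char (\<alpha> j) w \<and> w (c j) = \<theta> j t \<and>
      \<gamma> j t = exp ((2 * c j - 1) * integral {0..1} (\<lambda>\<eta>. \<beta> j (\<eta>, w \<eta>))) \<and>
      \<theta>' j t = exp ((2 * c j - 1) * integral {0..1} (\<lambda>\<eta>. \<alpha>' j (\<eta>, w \<eta>)))" for j t
  proof -
    interpret speed "\<alpha> j" "\<alpha>' j" by (rule speed)
    show ?thesis
      by (rule exI[of _ "\<lambda>\<eta>. flow (\<eta>, foot (1 - c j, t))"])
        (simp add: flow_char \<theta>_def \<theta>'_def \<gamma>_def damping_def backtrace_def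
          backtrace_deriv_eq_exp[OF end_point])
  qed
  have cH: "continuous_on UNIV (H j)" for j
    by (rule has_derivative_continuous_on[OF H(1)])
  obtain \<zeta>' where \<zeta>': "continuous_on UNIV \<zeta>'" "\<And>t k. ((\<lambda>t. ?\<zeta> t $ k) has_real_derivative \<zeta>' t $ k) (at t)"
  proof (rule functional_equation_C1[of K Kt Kz \<theta> \<theta>' ?\<zeta>])
    fix j k t y and q :: "real \<times> (real ^ 'n)"
    have fst': "(fst has_derivative fst) (at q)" "(snd has_derivative snd) (at q)"
      by (auto intro!: derivative_intros)
    have comp: "((\<lambda>p. f (fst p)) has_derivative (\<lambda>d. f' * fst d)) (at q)"
      if "(f has_real_derivative f') (at (fst q))" for f f'
      using has_derivative_compose[OF fst'(1) that[unfolded has_field_derivative_def]] .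
    have Hd: "((\<lambda>p. H j (\<theta> j (fst p), snd p)) has_derivative
        (\<lambda>d. Ht j (\<theta> j (fst q), snd q) * (\<theta>' j (fst q) * fst d)
          + (\<Sum>k\<in>UNIV. Hz j k (\<theta> j (fst q), snd q) * snd d $ k))) (at q)"
      using has_derivative_compose[OF has_derivative_Pair[OF comp[OF \<theta>(1)] fst'(2)] H(1)] by simp
    show "(K j has_derivative (\<lambda>d. Kt j q * fst d + (\<Sum>k\<in>UNIV. Kz j k q * snd d $ k))) (at q)"
      using has_derivative_add[OF has_derivative_mult[OF comp[OF \<gamma>'(2)] Hd] comp[OF g'(2)]]
      unfolding K_def[abs_def] Kt_def Kz_def
      by (rule has_derivative_eq_rhs) (auto simp: algebra_simps sum_distrib_left)
    have cf: "continuous_on UNIV (\<lambda>p :: real \<times> (real ^ 'n). f (fst p))" if "continuous_on UNIV f" for f :: "real \<Rightarrow> real"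
      by (rule continuous_on_compose2[OF that continuous_on_fst[OF continuous_on_id]]) simp
    have cH2: "continuous_on UNIV (\<lambda>p. f (\<theta> j (fst p), snd p))" if "continuous_on UNIV f"
      for f :: "real \<times> (real ^ 'n) \<Rightarrow> real"
      by (rule continuous_on_compose2[OF that continuous_on_Pair[OF cf[OF c\<theta>] continuous_on_snd[OF continuous_on_id]]]) simp
    show "continuous_on UNIV (Kt j)" unfolding Kt_def[abs_def]
      by (intro continuous_on_add continuous_on_mult cf \<gamma>' c\<gamma> g' \<theta> cH2 cH H)
    show "continuous_on UNIV (Kz j k)" unfolding Kz_def[abs_def]
      by (intro continuous_on_mult cf c\<gamma> cH2 H)
    have per\<gamma>: "\<gamma> j (t + 2 * pi) = \<gamma> j t" for t
      unfolding \<gamma>_def by (rule speed.damping_shift[OF speed periodic \<beta>(2) end_point])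
    have "g j t = v j (1 - c j, t) - \<gamma> j t * H j (\<theta> j t, ?\<zeta> (\<theta> j t))" for t
      using g'(3)[of j t] bc[of j "\<theta> j t"] by simp
    then have "g j (t + 2 * pi) = g j t"
      using per[of j] end_points(2)[of j] by (simp add: per\<gamma> \<theta>(3) H(4) per\<zeta> periodic_t_def)
    then show "K j (t + 2 * pi, y) = K j (t, y)" by (simp add: K_def per\<gamma> \<theta>(3) H(4))
    obtain w where w: "is_char (\<alpha> j) w" "w (c j) = \<theta> j t"
      "\<gamma> j t = exp ((2 * c j - 1) * integral {0..1} (\<lambda>\<eta>. \<beta> j (\<eta>, w \<eta>)))"
      "\<theta>' j t = exp ((2 * c j - 1) * integral {0..1} (\<lambda>\<eta>. \<alpha>' j (\<eta>, w \<eta>)))"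
      using along by blast
    have Kz_sum: "(\<Sum>k\<in>UNIV. \<bar>Kz j k (t, y)\<bar>) = \<gamma> j t * (\<Sum>k\<in>UNIV. \<bar>Hz j k (\<theta> j t, y)\<bar>)"
      by (simp add: Kz_def abs_mult sum_distrib_left w(3))
    show "(\<Sum>k\<in>UNIV. \<bar>Kz j k (t, y)\<bar>) < 1"
      using diss(1) w(1) unfolding dissipative_def Kz_sum w(3) w(2)[symmetric] by simp
    have "integral {0..1} (\<lambda>\<eta>. \<beta> j (\<eta>, w \<eta>) + \<alpha>' j (\<eta>, w \<eta>))
        = integral {0..1} (\<lambda>\<eta>. \<beta> j (\<eta>, w \<eta>)) + integral {0..1} (\<lambda>\<eta>. \<alpha>' j (\<eta>, w \<eta>))"
      by (intro Henstock_Kurzweil_Integration.integral_add integrable_continuous_interval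
          continuous_on_char[OF _ w(1)] C1tD(1)[OF \<beta>(1)] C1tD(2)[OF speed.C1[OF speed]])
    then have "\<gamma> j t * \<theta>' j t = exp ((2 * c j - 1) * integral {0..1} (\<lambda>\<eta>. \<beta> j (\<eta>, w \<eta>) + \<alpha>' j (\<eta>, w \<eta>)))"
      by (simp add: w(3,4) distrib_left flip: exp_add)
    moreover have "exp ((2 * c j - 1) * integral {0..1} (\<lambda>\<eta>. \<beta> j (\<eta>, w \<eta>) + \<alpha>' j (\<eta>, w \<eta>)))
        * (\<Sum>k\<in>UNIV. \<bar>Hz j k (w (c j), y)\<bar>) < 1"
      using diss(2) w(1) unfolding dissipative_def by simp
    moreover have "(\<Sum>k\<in>UNIV. \<bar>Kz j k (t, y)\<bar>) * \<bar>\<theta>' j t\<bar>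
        = (\<gamma> j t * \<theta>' j t) * (\<Sum>k\<in>UNIV. \<bar>Hz j k (w (c j), y)\<bar>)"
    proof -
      have "\<bar>\<theta>' j t\<bar> = \<theta>' j t" using w(4) by simp
      then show ?thesis by (simp only: Kz_sum w(2) mult_ac)
    qed
    ultimately show "(\<Sum>k\<in>UNIV. \<bar>Kz j k (t, y)\<bar>) * \<bar>\<theta>' j t\<bar> < 1" by simp
  qed (use \<theta> c\<zeta> per\<zeta> trace_eq in auto)

  have c\<zeta>2: "continuous_on UNIV (\<lambda>t. f (t, ?\<zeta> t))" if "continuous_on UNIV f" for f :: "real \<times> (real ^ 'n) \<Rightarrow> real"
    by (rule continuous_on_compose2[OF that continuous_on_Pair[OF continuous_on_id c\<zeta>]]) simp
  define b' where "b' j t = Ht j (t, ?\<zeta> t) + (\<Sum>k\<in>UNIV. Hz j k (t, ?\<zeta> t) * \<zeta>' t $ k)" for j t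
  have b'_deriv: "((\<lambda>s. v j (c j, s)) has_real_derivative b' j t) (at t)" for j t
  proof -
    have "(?\<zeta> has_derivative (\<lambda>s. \<chi> k. \<zeta>' t $ k * s)) (at t)"
      by (rule has_derivative_vec_components) (rule \<zeta>'(2)[unfolded has_field_derivative_def])
    from has_derivative_compose[OF has_derivative_Pair[OF has_derivative_ident this] H(1)[of j]]
    show ?thesis unfolding bc
      by (rule has_derivative_imp_has_field_derivative) (simp add: b'_def distrib_left sum_distrib_left mult_ac)
  qed
  have cb': "continuous_on UNIV (b' j)" for j unfolding b'_def[abs_def]
    by (intro continuous_on_add continuous_on_sum continuous_on_mult c\<zeta>2 H continuous_on_component \<zeta>')
  define w where "w j = partial_t (v j)" for j
  have w: "C1t (v j) (w j)" for j unfolding w_def by (rule damped(3)[OF cb' b'_deriv])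
  define F' where "F' j q = G' j q - (\<beta>' j q * v j q + w j q * \<beta> j q)
    - (\<Sum>k\<in>UNIV - {j}. B' j k q * v k q + w k q * B j k q)" for j q
  have CF: "C1t (F j) (F' j)" for j unfolding F_def[abs_def] F'_def[abs_def]
    by (intro C1t_diff G C1t_mult \<beta> w C1t_sum finite B) auto
  have w_tr: "transport (\<alpha> j) (w j) (\<lambda>q. F' j q - \<alpha>' j q * w j q)" for j
  proof -
    obtain v' where v': "C1t (v j) v'" "transport (\<alpha> j) v' (\<lambda>q. F' j q - \<alpha>' j q * v' q)"
      by (rule speed.transport_C1t[OF speed tr CF end_points(1) b'_deriv cb'])
    show ?thesis
      by (rule transport_cong[OF v'(2)]) (use C1t_unique[OF v'(1) w] in auto)
  qed
  have w_out: "\<zeta>' t = out_trace c w t" for t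
  proof -
    have "\<zeta>' t $ k = w k (1 - c k, t)" for k
      using \<zeta>'(2)[of k t] C1tD(3)[OF w[of k] end_points(2)] by (intro DERIV_unique) (simp_all add: out_trace_def)
    then show ?thesis by (simp add: out_trace_def vec_eq_iff)
  qed
  show ?thesis
  proof (rule that[of w, OF w])
    show "mixed_solution \<alpha> c (\<lambda>j q. \<beta> j q + \<alpha>' j q) B
      (\<lambda>j q. G' j q - \<beta>' j q * v j q - (\<Sum>k\<in>UNIV - {j}. B' j k q * v k q))
      (\<lambda>j p. Ht j (fst p, ?\<zeta> (fst p)) + (\<Sum>k\<in>UNIV. Hz j k (fst p, ?\<zeta> (fst p)) * snd p $ k)) w"
      unfolding mixed_solution_def
    proof (intro conjI allI)
      show "periodic_t (w j)" for j by (rule periodic_t_C1t[OF w per])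
      show "transport (\<alpha> j) (w j) (\<lambda>q. G' j q - \<beta>' j q * v j q - (\<Sum>k\<in>UNIV - {j}. B' j k q * v k q)
          - (\<beta> j q + \<alpha>' j q) * w j q - (\<Sum>k\<in>UNIV - {j}. B j k q * w k q))" for j
        by (rule transport_cong[OF w_tr]) (simp_all add: F'_def sum.distrib algebra_simps)
      have "w j (c j, t) = b' j t" for j t
        by (rule DERIV_unique[OF C1tD(3)[OF w end_points(1)] b'_deriv])
      then show "w j (c j, t) = Ht j (fst (t, out_trace c w t), ?\<zeta> (fst (t, out_trace c w t)))
          + (\<Sum>k\<in>UNIV. Hz j k (fst (t, out_trace c w t), ?\<zeta> (fst (t, out_trace c w t))) * snd (t, out_trace c w t) $ k)"
        for j t by (simp add: b'_def w_out)
    qed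
  qed
qed

end

section \<open>Higher regularity of mixed problems\<close>

lemma Ck_on_real_deriv:
  fixes g :: "real \<Rightarrow> real"
  assumes "Ck_on (Suc i) g UNIV"
  shows "(g has_real_derivative deriv g t) (at t)" "Ck_on i (deriv g) UNIV"
proof -
  obtain g' where g': "\<And>t. t \<in> UNIV \<Longrightarrow> (g has_derivative g' t) (at t)"
    by (rule Ck_on_SucE[OF assms]) (rule that)
  have d: "(g has_real_derivative deriv g t) (at t)" for t
  proof -
    have "g differentiable (at t)" using g'[of t] by (auto simp: differentiable_def)
    then show ?thesis by (simp add: DERIV_deriv_iff_real_differentiable)
  qed
  from d show "(g has_real_derivative deriv g t) (at t)" .
  show "Ck_on i (deriv g) UNIV" by (rule Ck_on_real_SucD[OF assms d])
qed

lemma smooth_on_partial: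
  fixes h :: "real ^ 'n \<Rightarrow> real"
  assumes "smooth_on h UNIV"
  shows "(h has_derivative (\<lambda>y. \<Sum>k\<in>UNIV. partial k h z * y $ k)) (at z)" "Ck_on i (partial k h) UNIV"
proof -
  have C: "Ck_on (Suc i) h UNIV" using assms by (simp add: smooth_on_def)
  obtain h' where h': "\<And>z. z \<in> UNIV \<Longrightarrow> (h has_derivative h' z) (at z)"
    "\<And>v. Ck_on i (\<lambda>z. h' z v) UNIV" by (rule Ck_on_SucE[OF C]) (rule that)
  have p: "partial k h z = h' z (axis k 1)" for k z
  proof -
    have "((\<lambda>s. z + s *\<^sub>R axis k 1) has_derivative (\<lambda>s. s *\<^sub>R axis k 1)) (at 0)"
      by (auto intro!: derivative_eq_intros)
    moreover have "(h has_derivative h' z) (at (z + 0 *\<^sub>R axis k 1))" using h'(1) by simp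
    ultimately have "((\<lambda>s. h (z + s *\<^sub>R axis k 1)) has_derivative (\<lambda>s. h' z (s *\<^sub>R axis k 1))) (at 0)"
      by (rule has_derivative_compose)
    then have "((\<lambda>s. h (z + s *\<^sub>R axis k 1)) has_real_derivative h' z (axis k 1)) (at 0)"
      by (rule has_derivative_imp_has_field_derivative)
        (simp add: linear_scale[OF has_derivative_linear[OF h'(1)[OF UNIV_I]]])
    then show ?thesis unfolding partial_def by (rule DERIV_imp_deriv)
  qed
  have "h' z = (\<lambda>y. \<Sum>k\<in>UNIV. partial k h z * y $ k)" for z
  proof
    fix y :: "real ^ 'n"
    interpret bounded_linear "h' z" using h'(1)[OF UNIV_I] by (rule has_derivative_bounded_linear)
    have "y = (\<Sum>k\<in>UNIV. y $ k *\<^sub>R axis k 1)"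
      using basis_expansion[of y] by (simp add: scalar_mult_eq_scaleR)
    then have "h' z y = h' z (\<Sum>k\<in>UNIV. y $ k *\<^sub>R axis k 1)" by simp
    then show "h' z y = (\<Sum>k\<in>UNIV. partial k h z * y $ k)"
      by (simp only: sum scaleR real_scaleR_def mult.commute p)
  qed
  with h'(1)[of z] show "(h has_derivative (\<lambda>y. \<Sum>k\<in>UNIV. partial k h z * y $ k)) (at z)" by simp
  have "partial k h = (\<lambda>z. h' z (axis k 1))" by (rule ext) (rule p)
  then show "Ck_on i (partial k h) UNIV" by (simp only: h'(2))
qed

context hyperbolic
begin

lemma out_trace_Ck:
  assumes "\<And>j. Ck_on i (v j) strip"
  shows "Ck_on i (\<lambda>t. out_trace c v t $ k) UNIV"
  using Ck_on_strip_trace[OF assms end_points(2)] by (simp add: out_trace_def)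

text \<open>Only a further \<open>t\<close>-derivative has to be known: the equation expresses the \<open>x\<close>-derivative by terms of the
  order already reached.\<close>

lemma mixed_solution_Ck_Suc:
  assumes sol: "mixed_solution \<alpha> c \<beta> B G H v" and smooth: "\<And>j. smooth_on (\<alpha> j) strip"
    "\<And>j. smooth_on (\<beta> j) strip" "\<And>j k. smooth_on (B j k) strip"
    and G: "\<And>j. Ck_on i (G j) strip" and v: "\<And>j. Ck_on i (v j) strip"
    and v': "C1t (v j) v'" "Ck_on i v' strip"
  shows "Ck_on (Suc i) (v j) strip"
proof -
  let ?F = "\<lambda>q. G j q - \<beta> j q * v j q - (\<Sum>k\<in>UNIV - {j}. B j k q * v k q)"
  have C: "Ck_on i (\<alpha> j) strip" "Ck_on i (\<beta> j) strip" "\<And>k. Ck_on i (B j k) strip"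
    using smooth by (auto simp: smooth_on_def)
  have T: "transport (\<alpha> j) (v j) ?F" using sol by (simp add: mixed_solution_def)
  show ?thesis
  proof (rule Ck_on_strip_SucI[OF speed.transport_C1t_joint[OF speed T v'(1)] _ v'(2)])
    show "Ck_on i (\<lambda>q. ?F q - \<alpha> j q * v' q) strip"
      by (rule Ck_on_diff[OF Ck_on_diff[OF Ck_on_diff[OF G Ck_on_mult[OF C(2) v]]
              Ck_on_sum[OF Ck_on_mult[OF C(3) v]]] Ck_on_mult[OF C(1) v'(2)]])
  qed
qed

lemma mixed_solution_continuous: "mixed_solution \<alpha> c \<beta> B G H v \<Longrightarrow> continuous_on strip (v j)"
  unfolding mixed_solution_def by (blast dest: transportD(1))

lemma next_damping:
  assumes "smooth_on (\<alpha> j) strip" "smooth_on (\<beta> j) strip" "periodic_t (\<beta> j)"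
  shows "smooth_on (\<lambda>q. \<beta> j q + \<alpha>' j q) strip" "periodic_t (\<lambda>q. \<beta> j q + \<alpha>' j q)"
proof -
  have C: "C1t (\<alpha> j) (\<alpha>' j)" by (rule speed.C1[OF speed])
  show "smooth_on (\<lambda>q. \<beta> j q + \<alpha>' j q) strip"
    using assms(1,2) Ck_on_strip_C1t[OF _ C] by (auto simp: smooth_on_def intro: Ck_on_add)
  show "periodic_t (\<lambda>q. \<beta> j q + \<alpha>' j q)"
    using assms(3) periodic_t_C1t[OF C periodic] by (simp add: periodic_t_def)
qed

lemma next_source:
  assumes "Ck_on (Suc i) (G j) strip" "\<And>j. smooth_on (\<beta> j) strip" "\<And>j k. smooth_on (B j k) strip"
    and v: "\<And>j. Ck_on i (v j) strip"
  shows "Ck_on i (\<lambda>q. partial_t (G j) q - partial_t (\<beta> j) q * v j q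
    - (\<Sum>k\<in>UNIV - {j}. partial_t (B j k) q * v k q)) strip"
proof -
  have "Ck_on i (partial_t (\<beta> j)) strip" "\<And>k. Ck_on i (partial_t (B j k)) strip"
    using assms(2,3)[THEN smooth_on_partial_t(2)] by (simp_all add: smooth_on_def)
  from Ck_on_diff[OF Ck_on_diff[OF Ck_on_strip_partial_t(2)[OF assms(1)] Ck_on_mult[OF this(1) v]]
      Ck_on_sum[OF Ck_on_mult[OF this(2) v]]]
  show ?thesis .
qed

lemma dissipative_shift:
  assumes "dissipative \<alpha> \<alpha>' c \<beta> Hz (Suc l)"
  shows "dissipative \<alpha> \<alpha>' c (\<lambda>j q. \<beta> j q + \<alpha>' j q) Hz l"
  using assms by (simp add: dissipative_def algebra_simps)

text \<open>Induction on the order for affine boundary conditions. The \<open>t\<close>-derivative solves a problem in the same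
  class, with sources of one order less and with \<open>\<alpha>'\<close> added to the damping; the linear part \<open>M\<close> of the boundary
  condition stays the same, and by \<open>dissipative_shift\<close> exactly the orders of dissipativity that the induction
  hypothesis asks for remain.\<close>

lemma affine_mixed_solution_Ck:
  assumes \<alpha>: "\<And>j. smooth_on (\<alpha> j) strip" and B: "\<And>j k. smooth_on (B j k) strip"
    and p: "\<And>j k. j \<noteq> k \<Longrightarrow> Ck_on 1 (p j k) strip"
      "\<And>j k q. j \<noteq> k \<Longrightarrow> q \<in> strip \<Longrightarrow> B j k q = p j k q * (\<alpha> j q - \<alpha> k q)"
    and M_per: "\<And>j k t. M j k (t + 2 * pi) = M j k t"
  shows "mixed_solution \<alpha> c \<beta> B G (\<lambda>j q. N j (fst q) + (\<Sum>k\<in>UNIV. M j k (fst q) * snd q $ k)) v \<Longrightarrow>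
    (\<And>j. smooth_on (\<beta> j) strip) \<Longrightarrow> (\<And>j. periodic_t (\<beta> j)) \<Longrightarrow> (\<And>j. Ck_on i (G j) strip) \<Longrightarrow>
    (\<And>j k. Ck_on i (M j k) UNIV) \<Longrightarrow> (\<And>j. Ck_on i (N j) UNIV) \<Longrightarrow> (\<And>j t. N j (t + 2 * pi) = N j t) \<Longrightarrow>
    (\<And>l. l \<le> i \<Longrightarrow> dissipative \<alpha> \<alpha>' c \<beta> (\<lambda>j k q. M j k (fst q)) l) \<Longrightarrow> Ck_on i (v j) strip"
proof (induction i arbitrary: \<beta> G N v j)
  case 0
  then show ?case using mixed_solution_continuous by simp
next
  case (Suc i)
  have vi: "Ck_on i (v j) strip" for j
    by (rule Suc.IH[OF Suc.prems(1,2,3)])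
      (use Suc.prems in \<open>auto intro: Ck_on_SucD\<close>)
  note M' = Ck_on_real_deriv[OF Suc.prems(5)] and N' = Ck_on_real_deriv[OF Suc.prems(6)]
  let ?H = "\<lambda>j q. N j (fst q) + (\<Sum>k\<in>UNIV. M j k (fst q) * snd q $ k)"
  let ?Ht = "\<lambda>j q. deriv (N j) (fst q) + (\<Sum>k\<in>UNIV. deriv (M j k) (fst q) * snd q $ k)"
  let ?\<beta> = "\<lambda>j q. \<beta> j q + \<alpha>' j q"
  let ?G = "\<lambda>j q. partial_t (G j) q - partial_t (\<beta> j) q * v j q
    - (\<Sum>k\<in>UNIV - {j}. partial_t (B j k) q * v k q)"
  let ?N = "\<lambda>j t. deriv (N j) t + (\<Sum>k\<in>UNIV. deriv (M j k) t * out_trace c v t $ k)"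
  have per: "\<And>j. periodic_t (v j)" using Suc.prems(1) by (simp add: mixed_solution_def)
  obtain w where w: "\<And>j. C1t (v j) (w j)" "mixed_solution \<alpha> c ?\<beta> B ?G
      (\<lambda>j q. ?Ht j (fst q, out_trace c v (fst q))
        + (\<Sum>k\<in>UNIV. (\<lambda>q. M j k (fst q)) (fst q, out_trace c v (fst q)) * snd q $ k)) w"
  proof (rule mixed_solution_C1t[OF Suc.prems(1), where \<beta>'="\<lambda>j. partial_t (\<beta> j)" and G'="\<lambda>j. partial_t (G j)"
        and B'="\<lambda>j k. partial_t (B j k)" and p=p and Ht="?Ht" and Hz="\<lambda>j k q. M j k (fst q)"])
    fix j k t y and q :: "real \<times> (real ^ 'n)"
    have cf: "continuous_on UNIV (\<lambda>p :: real \<times> (real ^ 'n). f (fst p))" if "continuous_on UNIV f" for f :: "real \<Rightarrow> real"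
      by (rule continuous_on_compose2[OF that continuous_on_fst[OF continuous_on_id]]) simp
    have cs: "continuous_on UNIV (\<lambda>p :: real \<times> (real ^ 'n). snd p $ k)" for k
      by (intro continuous_on_component continuous_on_snd continuous_on_id)
    have comp: "((\<lambda>p. f (fst p)) has_derivative (\<lambda>d. f' * fst d)) (at q)"
      if "(f has_real_derivative f') (at (fst q))" for f f'
      using has_derivative_compose[OF has_derivative_fst[OF has_derivative_ident] that[unfolded has_field_derivative_def]] .
    have sn: "((\<lambda>p :: real \<times> (real ^ 'n). snd p $ k) has_derivative (\<lambda>d. snd d $ k)) (at q)" for k
      by (rule bounded_linear.has_derivative[OF bounded_linear_vec_nth]) (auto intro!: derivative_intros)
    show "(?H j has_derivative (\<lambda>d. ?Ht j q * fst d + (\<Sum>k\<in>UNIV. M j k (fst q) * snd d $ k))) (at q)"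
      using has_derivative_add[OF comp[OF N'(1)] has_derivative_sum[OF has_derivative_mult[OF comp[OF M'(1)] sn]]]
      by (rule has_derivative_eq_rhs)
        (auto simp: algebra_simps sum.distrib sum_distrib_left sum_distrib_right)
    show "continuous_on UNIV (?Ht j)"
      by (rule continuous_on_add[OF cf[OF Ck_on_continuous_on[OF N'(2)]]
            continuous_on_sum[OF continuous_on_mult[OF cf[OF Ck_on_continuous_on[OF M'(2)]] cs]]])
    show "continuous_on UNIV (\<lambda>q :: real \<times> (real ^ 'n). M j k (fst q))"
      by (rule cf[OF Ck_on_continuous_on[OF Suc.prems(5)]])
    show "?H j (t + 2 * pi, y) = ?H j (t, y)" by (simp add: Suc.prems(7) M_per)
    show "C1t (\<beta> j) (partial_t (\<beta> j))" by (rule smooth_on_partial_t(1)[OF Suc.prems(2)])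
    show "C1t (B j k) (partial_t (B j k))" by (rule smooth_on_partial_t(1)[OF B])
    show "C1t (G j) (partial_t (G j))" by (rule Ck_on_strip_partial_t(1)[OF Suc.prems(4)])
    show "dissipative \<alpha> \<alpha>' c \<beta> (\<lambda>j k q. M j k (fst q)) 0" "dissipative \<alpha> \<alpha>' c \<beta> (\<lambda>j k q. M j k (fst q)) 1"
      using Suc.prems(8) by auto
  qed (use p Suc.prems(3) in auto)
  have wi: "Ck_on i (w j) strip" for j
  proof (rule Suc.IH[of ?\<beta> ?G ?N w])
    show "mixed_solution \<alpha> c ?\<beta> B ?G (\<lambda>j q. ?N j (fst q) + (\<Sum>k\<in>UNIV. M j k (fst q) * snd q $ k)) w"
      using w(2) by simp
    fix j k t l
    show "smooth_on (?\<beta> j) strip" "periodic_t (?\<beta> j)"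
      by (rule next_damping[OF \<alpha> Suc.prems(2,3)])+
    show "Ck_on i (?G j) strip" by (rule next_source[OF Suc.prems(4,2) B vi])
    show "Ck_on i (M j k) UNIV" by (rule Ck_on_SucD[OF Suc.prems(5)])
    show "Ck_on i (?N j) UNIV"
      by (rule Ck_on_add[OF N'(2) Ck_on_sum[OF Ck_on_mult[OF M'(2) out_trace_Ck[OF vi]]]])
    show "?N j (t + 2 * pi) = ?N j t"
      using deriv_periodic[OF N'(1) Suc.prems(7)] deriv_periodic[OF M'(1) M_per] out_trace_periodic[OF per] by simp
    show "dissipative \<alpha> \<alpha>' c ?\<beta> (\<lambda>j k q. M j k (fst q)) l" if "l \<le> i"
      by (rule dissipative_shift[OF Suc.prems(8)]) (use that in simp)
  qed
  show ?case
    by (rule mixed_solution_Ck_Suc[OF Suc.prems(1) \<alpha> Suc.prems(2) B Ck_on_SucD[OF Suc.prems(4)] vi w(1) wi])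
qed

text \<open>A nonlinear boundary condition becomes affine after one differentiation, with linear part
  \<open>\<partial>\<^sub>k h\<^sub>j (z(t))\<close>. This is as regular as the outflow values \<open>z\<close>, that is, as the order reached so far.\<close>

lemma mixed_solution_Ck:
  assumes sol: "mixed_solution \<alpha> c \<beta> B G (\<lambda>j q. h j (snd q)) v"
    and smooth: "\<And>j. smooth_on (\<alpha> j) strip" "\<And>j. smooth_on (\<beta> j) strip" "\<And>j k. smooth_on (B j k) strip"
      "\<And>j. smooth_on (G j) strip" "\<And>j. smooth_on (h j) UNIV"
    and p: "\<And>j k. j \<noteq> k \<Longrightarrow> Ck_on 1 (p j k) strip"
      "\<And>j k q. j \<noteq> k \<Longrightarrow> q \<in> strip \<Longrightarrow> B j k q = p j k q * (\<alpha> j q - \<alpha> k q)"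
    and \<beta>_per: "\<And>j. periodic_t (\<beta> j)"
    and diss: "\<And>l. l \<le> r \<Longrightarrow> dissipative \<alpha> \<alpha>' c \<beta> (\<lambda>j k q. partial k (h j) (snd q)) l"
  shows "Ck_on r (v j) strip"
proof -
  have per: "\<And>j. periodic_t (v j)" using sol by (simp add: mixed_solution_def)
  have "i \<le> r \<Longrightarrow> Ck_on i (v j) strip" for i j
  proof (induction i arbitrary: j)
    case 0
    show ?case using mixed_solution_continuous[OF sol] by simp
  next
    case (Suc i)
    then have vi: "Ck_on i (v j) strip" for j by simp
    let ?\<beta> = "\<lambda>j q. \<beta> j q + \<alpha>' j q"
    let ?G = "\<lambda>j q. partial_t (G j) q - partial_t (\<beta> j) q * v j q
      - (\<Sum>k\<in>UNIV - {j}. partial_t (B j k) q * v k q)"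
    let ?M = "\<lambda>j k t. partial k (h j) (out_trace c v t)"
    obtain w where w: "\<And>j. C1t (v j) (w j)" "mixed_solution \<alpha> c ?\<beta> B ?G
        (\<lambda>j q. (\<lambda>q. 0) (fst q, out_trace c v (fst q))
          + (\<Sum>k\<in>UNIV. (\<lambda>q. partial k (h j) (snd q)) (fst q, out_trace c v (fst q)) * snd q $ k)) w"
    proof (rule mixed_solution_C1t[OF sol, where \<beta>'="\<lambda>j. partial_t (\<beta> j)" and G'="\<lambda>j. partial_t (G j)"
          and B'="\<lambda>j k. partial_t (B j k)" and p=p and Ht="\<lambda>j q. 0" and Hz="\<lambda>j k q. partial k (h j) (snd q)"])
      fix j k and q :: "real \<times> (real ^ 'n)"
      show "((\<lambda>q. h j (snd q)) has_derivative (\<lambda>d. 0 * fst d + (\<Sum>k\<in>UNIV. partial k (h j) (snd q) * snd d $ k))) (at q)"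
        using has_derivative_compose[OF has_derivative_snd[OF has_derivative_ident] smooth_on_partial(1)[OF smooth(5)]]
        by simp
      show "continuous_on UNIV (\<lambda>q :: real \<times> (real ^ 'n). partial k (h j) (snd q))"
        by (rule continuous_on_compose2[OF Ck_on_continuous_on[OF smooth_on_partial(2)[OF smooth(5), of 0]]
              continuous_on_snd[OF continuous_on_id]]) simp
      show "C1t (\<beta> j) (partial_t (\<beta> j))" "C1t (B j k) (partial_t (B j k))" "C1t (G j) (partial_t (G j))"
        by (rule smooth_on_partial_t(1)[OF smooth(2)] smooth_on_partial_t(1)[OF smooth(3)]
            smooth_on_partial_t(1)[OF smooth(4)])+
      show "dissipative \<alpha> \<alpha>' c \<beta> (\<lambda>j k q. partial k (h j) (snd q)) 0"
        "dissipative \<alpha> \<alpha>' c \<beta> (\<lambda>j k q. partial k (h j) (snd q)) 1"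
        using diss Suc.prems by auto
    qed (use p \<beta>_per in auto)
    have wi: "Ck_on i (w j) strip" for j
    proof (rule affine_mixed_solution_Ck[OF smooth(1,3) p, of ?M ?\<beta> ?G "\<lambda>j t. 0" w])
      show "mixed_solution \<alpha> c ?\<beta> B ?G (\<lambda>j q. 0 + (\<Sum>k\<in>UNIV. ?M j k (fst q) * snd q $ k)) w"
        using w(2) by simp
      fix j k t l
      show "?M j k (t + 2 * pi) = ?M j k t" using out_trace_periodic[OF per] by simp
      show "smooth_on (?\<beta> j) strip" "periodic_t (?\<beta> j)"
        by (rule next_damping[OF smooth(1,2) \<beta>_per])+
      have "Ck_on (Suc i) (G j) strip" using smooth(4) by (simp add: smooth_on_def)
      then show "Ck_on i (?G j) strip" by (rule next_source[OF _ smooth(2,3) vi])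
      show "Ck_on i (?M j k) UNIV"
        by (rule Ck_on_compose_vec[OF smooth_on_partial(2)[OF smooth(5)] out_trace_Ck[OF vi]])
      have "dissipative \<alpha> \<alpha>' c ?\<beta> (\<lambda>j k q. partial k (h j) (snd q)) l" if "l \<le> i"
        by (rule dissipative_shift[OF diss]) (use that Suc.prems in simp)
      then show "dissipative \<alpha> \<alpha>' c ?\<beta> (\<lambda>j k q. ?M j k (fst q)) l" if "l \<le> i"
        using that unfolding dissipative_def by simp
    qed (simp_all add: Ck_on_const)
    show ?case
      by (rule mixed_solution_Ck_Suc[OF sol smooth(1,2,3) _ vi w(1) wi]) (use smooth(4) in \<open>simp add: smooth_on_def\<close>)
  qed
  then show ?thesis by blast
qed

end

section \<open>From the integral equations to the mixed problem\<close>

lemma periodic_strip_bounded: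
  assumes "continuous_on strip g" "periodic_t g"
  shows "\<exists>L. \<forall>q\<in>strip. \<bar>g q :: real\<bar> \<le> L"
proof -
  let ?Q = "{0..1 :: real} \<times> {0..2 * pi}"
  have "compact (g ` ?Q)"
    by (intro compact_continuous_image continuous_on_subset[OF assms(1)] compact_Times compact_Icc) auto
  from compact_imp_bounded[OF this] obtain L where "\<forall>y\<in>g ` ?Q. norm y \<le> L" unfolding bounded_iff ..
  then have L: "\<bar>g q\<bar> \<le> L" if "q \<in> ?Q" for q using that by (simp only: ball_simps real_norm_def)
  have "\<bar>g (x, t)\<bar> \<le> L" if "x \<in> {0..1}" for x t
  proof -
    have "g (x, t - 2 * pi * of_int \<lfloor>t / (2 * pi)\<rfloor>) = g (x, t)"
      by (rule periodic_reduce[of "\<lambda>t. g (x, t)"]) (use assms(2) that in \<open>simp add: periodic_t_def\<close>)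
    with L[of "(x, t - 2 * pi * of_int \<lfloor>t / (2 * pi)\<rfloor>)"] reduced_mem[of t] that show ?thesis by simp
  qed
  then show ?thesis by (intro exI[of _ L]) auto
qed

lemma is_char_iff_characteristic:
  "is_characteristic a x t w \<longleftrightarrow> is_char (\<lambda>q. 1 / a q) w \<and> w x = t"
  by (auto simp: is_characteristic_def is_char_def)

lemma LBINT_eq_prim:
  assumes "continuous_on {0..1} f" "\<And>\<eta>. \<eta> \<in> {0..1} \<Longrightarrow> g \<eta> = f \<eta>" "x \<in> {0..1}" "y \<in> {0..1}"
  shows "(LBINT \<eta>=x..y. g \<eta>) = prim f y - prim f x"
proof (rule interval_integral_FTC_finite)
  have sub: "{min x y..max x y} \<subseteq> {0..1}" using assms(3,4) by auto
  have "continuous_on {min x y..max x y} f" by (rule continuous_on_subset[OF assms(1) sub])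
  moreover have "continuous_on {min x y..max x y} g \<longleftrightarrow> continuous_on {min x y..max x y} f"
    by (rule continuous_on_cong[OF refl]) (use assms(2) sub in blast)
  ultimately show "continuous_on {min x y..max x y} g" by simp
  fix \<eta> assume "min x y \<le> \<eta>" "\<eta> \<le> max x y"
  then have \<eta>: "\<eta> \<in> {0..1}" using sub by auto
  have "(prim f has_real_derivative g \<eta>) (at \<eta> within {0..1})"
    using prim_deriv_Icc[OF assms(1) _ _ \<eta>] assms(2)[OF \<eta>] by simp
  from DERIV_subset[OF this sub]
  show "(prim f has_vector_derivative g \<eta>) (at \<eta> within {min x y..max x y})"
    by (simp add: has_real_derivative_iff_has_vector_derivative)
qed

lemma prim_cmult: "prim (\<lambda>r. k * f r) s = k * prim f s"
  by (simp add: prim_def)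

lemma prim_1: "prim f 1 = integral {0..1} f"
  by (simp add: prim_def)

definition duhamel :: "(real \<Rightarrow> real) \<Rightarrow> (real \<Rightarrow> real) \<Rightarrow> real \<Rightarrow> real \<Rightarrow> real" where
  "duhamel \<beta> s x0 x = prim (\<lambda>\<xi>. exp (prim \<beta> \<xi> - prim \<beta> x) * s \<xi>) x
    - prim (\<lambda>\<xi>. exp (prim \<beta> \<xi> - prim \<beta> x) * s \<xi>) x0"

text \<open>On a fixed characteristic \<open>w\<close> the integral equation is the variation of constants formula for the
  ordinary differential equation solved by \<open>x \<mapsto> v (x, w x)\<close>.\<close>

lemma variation_of_constants:
  fixes \<beta> f s v :: "real \<Rightarrow> real"
  assumes c: "continuous_on {0..1} \<beta>" "continuous_on {0..1} f" "continuous_on {0..1} s" and x0: "x0 \<in> {0..1}"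
    and v: "\<And>x. x \<in> {0..1} \<Longrightarrow>
      v x = exp (prim \<beta> x0 - prim \<beta> x) * H - duhamel \<beta> s x0 x + duhamel \<beta> f x0 x"
    and x: "x \<in> {0..1}"
  shows "(v has_real_derivative f x - \<beta> x * v x - s x) (at x within {0..1})"
proof -
  let ?b = "prim \<beta>"
  let ?Q = "prim (\<lambda>\<xi>. exp (?b \<xi>) * (f \<xi> - s \<xi>))"
  have b: "(?b has_real_derivative \<beta> y) (at y within {0..1})" if "y \<in> {0..1}" for y
    by (rule prim_deriv_Icc) (use c that in auto)
  have cb: "continuous_on {0..1} (\<lambda>y. exp (?b y))"
    by (intro continuous_on_exp DERIV_continuous_on[OF b])
  have Q: "(?Q has_real_derivative exp (?b x) * (f x - s x)) (at x within {0..1})"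
    by (rule prim_deriv_Icc) (use x in \<open>auto intro!: continuous_on_mult continuous_on_diff cb c\<close>)
  have veq: "v y = exp (- ?b y) * (exp (?b x0) * H + (?Q y - ?Q x0))" if "y \<in> {0..1}" for y
  proof -
    have int: "(\<lambda>\<tau>. exp (?b (\<tau> * z)) * k (\<tau> * z)) integrable_on {0..1}"
      if "z \<in> {0..1}" "continuous_on {0..1} k" for z k
    proof (rule integrable_continuous_interval)
      have "continuous_on {0..1} (\<lambda>\<tau>. \<tau> * z)" by (intro continuous_intros)
      moreover have "(\<lambda>\<tau>. \<tau> * z) ` {0..1} \<subseteq> {0..1}" using that(1) by (auto simp: mult_le_one)
      ultimately show "continuous_on {0..1} (\<lambda>\<tau>. exp (?b (\<tau> * z)) * k (\<tau> * z))"
        by (rule continuous_on_compose2[OF continuous_on_mult[OF cb that(2)]])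
    qed
    have split: "?Q z = prim (\<lambda>\<xi>. exp (?b \<xi>) * f \<xi>) z - prim (\<lambda>\<xi>. exp (?b \<xi>) * s \<xi>) z" if "z \<in> {0..1}" for z
      unfolding prim_def right_diff_distrib
      by (subst Henstock_Kurzweil_Integration.integral_diff) (use int[OF that] c in \<open>auto simp: right_diff_distrib prim_def\<close>)
    have scale: "prim (\<lambda>\<xi>. exp (?b \<xi> - ?b y) * k \<xi>) z = exp (- ?b y) * prim (\<lambda>\<xi>. exp (?b \<xi>) * k \<xi>) z" for k z
      unfolding prim_cmult[symmetric] by (simp add: exp_diff exp_minus field_simps)
    show ?thesis
      unfolding v[OF that] duhamel_def scale split[OF that] split[OF x0]
      by (simp add: algebra_simps exp_diff exp_minus divide_inverse)
  qed
  have "((\<lambda>y. exp (- ?b y) * (exp (?b x0) * H + (?Q y - ?Q x0))) has_real_derivative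
      - \<beta> x * (exp (- ?b x) * (exp (?b x0) * H + (?Q x - ?Q x0))) + exp (- ?b x) * (exp (?b x) * (f x - s x)))
      (at x within {0..1})"
    by (rule derivative_eq_intros b[OF x] Q refl)+ (simp add: algebra_simps)
  moreover have "exp (- ?b x) * (exp (?b x) * (f x - s x)) = f x - s x"
    by (simp flip: mult.assoc exp_add)
  ultimately have "((\<lambda>y. exp (- ?b y) * (exp (?b x0) * H + (?Q y - ?Q x0))) has_real_derivative
      - \<beta> x * v x + (f x - s x)) (at x within {0..1})"
    by (simp only: veq[OF x])
  then have "((\<lambda>y. exp (- ?b y) * (exp (?b x0) * H + (?Q y - ?Q x0))) has_real_derivative
      f x - \<beta> x * v x - s x) (at x within {0..1})"
    by (simp add: algebra_simps)
  then show ?thesis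
    by (rule has_field_derivative_transform_within[OF _ zero_less_one x]) (simp add: veq)
qed

lemma omega_eq_char:
  assumes "speed (\<lambda>q. 1 / a q) \<alpha>'" "is_char (\<lambda>q. 1 / a q) w" "w x = t" "x \<in> {0..1}" "\<xi> \<in> {0..1}"
  shows "omega a \<xi> x t = w \<xi>"
proof -
  have "\<exists>w. is_characteristic a x t w" using assms by (auto simp: is_char_iff_characteristic)
  from someI_ex[OF this] have "is_char (\<lambda>q. 1 / a q) (SOME w. is_characteristic a x t w)"
    "(SOME w. is_characteristic a x t w) x = t" by (simp_all add: is_char_iff_characteristic)
  then have "(SOME w. is_characteristic a x t w) \<xi> = w \<xi>"
    by (intro speed.char_unique[OF assms(1) _ assms(2) _ assms(4,5)]) (simp_all only: assms(3))
  then show ?thesis by (simp only: omega_def)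
qed

lemma smooth_on_divide:
  assumes "smooth_on f S" "smooth_on g S" "\<And>q. q \<in> S \<Longrightarrow> g q \<noteq> 0"
  shows "smooth_on (\<lambda>q. f q / g q) S"
  using assms unfolding smooth_on_def by (blast intro: Ck_on_divide)

theorem theorem2p5:
  fixes num :: "'n::finite \<Rightarrow> nat" and m r :: nat
    and a f :: "'n \<Rightarrow> real \<times> real \<Rightarrow> real"
    and b :: "'n \<Rightarrow> 'n \<Rightarrow> real \<times> real \<Rightarrow> real"
    and h :: "'n \<Rightarrow> real ^ 'n \<Rightarrow> real"
    and u :: "real \<times> real \<Rightarrow> real ^ 'n"
  assumes "bij_betw num UNIV {1..CARD('n)}"
    and "m \<le> CARD('n)"
    and "\<And>j. smooth_on (a j) strip" and "\<And>j. periodic_t (a j)"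
    and "\<And>j k. smooth_on (b j k) strip" and "\<And>j k. periodic_t (b j k)"
    and "\<And>j. smooth_on (f j) strip" and "\<And>j. periodic_t (f j)"
    and "\<And>j. smooth_on (h j) UNIV"
    and "\<And>j q. num j \<le> m \<Longrightarrow> q \<in> strip \<Longrightarrow> a j q > 0"
    and "\<And>j q. num j > m \<Longrightarrow> q \<in> strip \<Longrightarrow> a j q < 0"
    and "\<And>j. (INF q\<in>strip. \<bar>a j q\<bar>) > 0"
    and "\<And>j k. j \<noteq> k \<Longrightarrow>
           \<exists>p. Ck_on 1 p strip
             \<and> (\<forall>q\<in>strip. b j k q = p q * (a k q - a j q))
             \<and> (\<forall>q\<in>interior {q \<in> strip. a j q = a k q}. p q = 0)"
    and "\<And>j x t z l. x \<in> {0..1} \<Longrightarrow> l \<le> r \<Longrightarrow>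
           exp (LBINT \<eta>=x..inflow num m j.
                  b j j (\<eta>, omega (a j) \<eta> x t) / a j (\<eta>, omega (a j) \<eta> x t)
                  - real l * (partial_t (a j) (\<eta>, omega (a j) \<eta> x t)
                              / (a j (\<eta>, omega (a j) \<eta> x t))\<^sup>2))
             * (\<Sum>k\<in>UNIV. \<bar>partial k (h j) z\<bar>) < 1"
    and "continuous_solution num m a b f h u"
  shows "\<forall>j. Ck_on r (\<lambda>q. u q $ j) ({0<..<1} \<times> UNIV)"
proof -
  define \<alpha> where "\<alpha> j q = 1 / a j q" for j q
  define \<alpha>' where "\<alpha>' j = partial_t (\<alpha> j)" for j
  define \<beta> where "\<beta> j q = b j j q / a j q" for j q
  define B where "B j k q = b j k q / a j q" for j k q
  define G where "G j q = f j q / a j q" for j q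
  define c where "c j = inflow num m j" for j
  define v where "v j q = u q $ j" for j q

  have nz: "a j q \<noteq> 0" if "q \<in> strip" for j q
    using assms(10)[of j q] assms(11)[of j q] that by (cases "num j \<le> m") force+
  have quotient: "smooth_on (\<lambda>q. g q / a j q) strip" if "smooth_on g strip" for g j
    by (rule smooth_on_divide[OF that assms(3) nz])
  have s\<alpha>: "smooth_on (\<alpha> j) strip" for j unfolding \<alpha>_def[abs_def]
    by (rule quotient) (simp add: smooth_on_def Ck_on_const)
  have s\<beta>: "smooth_on (\<beta> j) strip" and sB: "smooth_on (B j k) strip" and sG: "smooth_on (G j) strip" for j k
    unfolding \<beta>_def[abs_def] B_def[abs_def] G_def[abs_def]
    by (rule quotient[OF assms(5)] quotient[OF assms(7)])+
  have per: "periodic_t (\<alpha> j)" "periodic_t (\<beta> j)" for j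
    using assms(4)[of j] assms(6)[of j j] by (simp_all add: periodic_t_def \<alpha>_def \<beta>_def)
  have c01: "c j \<in> {0, 1}" "c j \<in> {0..1}" "1 - c j \<in> {0..1}" for j by (auto simp: c_def inflow_def)
  note C\<alpha> = smooth_on_partial_t(1)[OF s\<alpha>, folded \<alpha>'_def]
  have sp: "speed (\<alpha> j) (\<alpha>' j)" for j
  proof
    show "C1t (\<alpha> j) (\<alpha>' j)" by (rule C\<alpha>)
    obtain K K' where "\<forall>q\<in>strip. \<bar>\<alpha> j q\<bar> \<le> K" "\<forall>q\<in>strip. \<bar>\<alpha>' j q\<bar> \<le> K'"
      using periodic_strip_bounded[OF C1tD(1)[OF C\<alpha>] per(1)]
        periodic_strip_bounded[OF C1tD(2)[OF C\<alpha>] periodic_t_C1t[OF C\<alpha> per(1)]] by blast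
    then show "\<exists>L. \<forall>q\<in>strip. \<bar>\<alpha> j q\<bar> \<le> L \<and> \<bar>\<alpha>' j q\<bar> \<le> L"
      by (intro exI[of _ "max K K'"]) (auto simp: le_max_iff_disj)
  qed
  interpret hyperbolic \<alpha> \<alpha>' c by (rule hyperbolic.intro) (rule sp per c01)+
  have \<alpha>'_eq: "\<alpha>' j q = - (partial_t (a j) q / (a j q)\<^sup>2)" if q: "q \<in> strip" for j q
  proof -
    obtain x t where xt: "q = (x, t)" "x \<in> {0..1}" using q by auto
    have "((\<lambda>s. 1 / a j (x, s)) has_real_derivative - (partial_t (a j) q / (a j q)\<^sup>2)) (at t)"
      using DERIV_divide[OF DERIV_const[of 1] C1tD(3)[OF smooth_on_partial_t(1)[OF assms(3)] xt(2)], of j t] nz[OF q, of j]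
      by (simp add: xt(1) power2_eq_square)
    moreover have "((\<lambda>s. 1 / a j (x, s)) has_real_derivative \<alpha>' j q) (at t)"
      using C1tD(3)[OF C\<alpha> xt(2), of j t] by (simp add: \<alpha>_def[abs_def] xt(1))
    ultimately show ?thesis by (rule DERIV_unique[symmetric])
  qed
  have om: "omega (a j) \<xi> x t = w \<xi>" if "is_char (\<alpha> j) w" "w x = t" "x \<in> {0..1}" "\<xi> \<in> {0..1}" for j w x t \<xi>
    by (rule omega_eq_char[of "a j" "\<alpha>' j"]) (use that sp[of j] in \<open>simp_all add: \<alpha>_def[abs_def]\<close>)
  have cu: "continuous_on strip u" and pu: "periodic_t u"
    and ueq: "\<And>j x t. x \<in> {0..1} \<Longrightarrow> u (x, t) $ j =
          c_coeff (a j) (b j j) (c j) x t * h j (outflow_trace num m u (omega (a j) (c j) x t))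
          - (LBINT \<xi>=c j..x. d_coeff (a j) (b j j) \<xi> x t *
               (\<Sum>k\<in>UNIV - {j}. b j k (\<xi>, omega (a j) \<xi> x t) * u (\<xi>, omega (a j) \<xi> x t) $ k))
          + (LBINT \<xi>=c j..x. d_coeff (a j) (b j j) \<xi> x t * f j (\<xi>, omega (a j) \<xi> x t))"
    using assms(15) by (auto simp: continuous_solution_def c_def)
  have cv: "continuous_on strip (v j)" for j
    unfolding v_def[abs_def] by (rule continuous_on_component[OF cu])
  have trace: "outflow_trace num m u t = out_trace c v t" for t
    by (simp add: outflow_trace_def out_trace_def v_def c_def inflow_def vec_eq_iff)
  define S where "S j q = (\<Sum>k\<in>UNIV - {j}. B j k q * v k q)" for j q
  have cont: "continuous_on strip (\<beta> j)" "continuous_on strip (G j)" "continuous_on strip (S j)" for j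
  proof -
    have C: "continuous_on strip g" if "smooth_on g strip" for g :: "real \<times> real \<Rightarrow> real"
      using that Ck_on_continuous_on unfolding smooth_on_def by blast
    show "continuous_on strip (\<beta> j)" "continuous_on strip (G j)" by (rule C[OF s\<beta>] C[OF sG])+
    show "continuous_on strip (S j)" unfolding S_def[abs_def]
      by (intro continuous_on_sum continuous_on_mult C[OF sB] cv)
  qed

  \<comment> \<open>On a characteristic \<open>w\<close> the functions \<open>omega\<close> in the integral equation all reduce to \<open>w\<close>, whatever the base
    point on it.\<close>
  have formula: "v j (x, w x) = exp (prim (\<lambda>\<eta>. \<beta> j (\<eta>, w \<eta>)) (c j) - prim (\<lambda>\<eta>. \<beta> j (\<eta>, w \<eta>)) x)
        * h j (out_trace c v (w (c j)))
      - duhamel (\<lambda>\<eta>. \<beta> j (\<eta>, w \<eta>)) (\<lambda>\<xi>. S j (\<xi>, w \<xi>)) (c j) x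
      + duhamel (\<lambda>\<eta>. \<beta> j (\<eta>, w \<eta>)) (\<lambda>\<xi>. G j (\<xi>, w \<xi>)) (c j) x"
    if w: "is_char (\<alpha> j) w" and x: "x \<in> {0..1}" for j w x
  proof -
    let ?b = "prim (\<lambda>\<eta>. \<beta> j (\<eta>, w \<eta>))"
    note omw = om[OF w refl x]
    have c\<beta>: "continuous_on {0..1} (\<lambda>\<eta>. \<beta> j (\<eta>, w \<eta>))" by (rule continuous_on_char[OF cont(1) w])
    have cc: "c_coeff (a j) (b j j) \<xi> x (w x) = exp (?b \<xi> - ?b x)" if "\<xi> \<in> {0..1}" for \<xi>
      unfolding c_coeff_def
      by (subst LBINT_eq_prim[OF c\<beta> _ x that]) (simp_all add: omw \<beta>_def)
    have ce: "continuous_on {0..1} (\<lambda>\<xi>. exp (?b \<xi> - ?b x) * g (\<xi>, w \<xi>))" if "continuous_on strip g" for g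
    proof -
      have "continuous_on {0..1} ?b"
        by (rule DERIV_continuous_on[OF prim_deriv_Icc[OF c\<beta>]]) auto
      then show ?thesis
        by (intro continuous_on_mult continuous_on_exp continuous_on_diff continuous_on_const
            continuous_on_char[OF that w])
    qed
    have iS: "(LBINT \<xi>=c j..x. d_coeff (a j) (b j j) \<xi> x (w x) *
        (\<Sum>k\<in>UNIV - {j}. b j k (\<xi>, omega (a j) \<xi> x (w x)) * u (\<xi>, omega (a j) \<xi> x (w x)) $ k))
        = duhamel (\<lambda>\<eta>. \<beta> j (\<eta>, w \<eta>)) (\<lambda>\<xi>. S j (\<xi>, w \<xi>)) (c j) x" unfolding duhamel_def
      by (rule LBINT_eq_prim[OF ce[OF cont(3)] _ c01(2) x])
        (simp add: d_coeff_def cc omw S_def B_def v_def sum_divide_distrib sum_distrib_left)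
    have iG: "(LBINT \<xi>=c j..x. d_coeff (a j) (b j j) \<xi> x (w x) * f j (\<xi>, omega (a j) \<xi> x (w x)))
        = duhamel (\<lambda>\<eta>. \<beta> j (\<eta>, w \<eta>)) (\<lambda>\<xi>. G j (\<xi>, w \<xi>)) (c j) x" unfolding duhamel_def
      by (rule LBINT_eq_prim[OF ce[OF cont(2)] _ c01(2) x]) (simp add: d_coeff_def cc omw G_def)
    show ?thesis
      using ueq[OF x, of "w x" j] unfolding iS iG cc[OF c01(2)] omw[OF c01(2)] trace by (simp only: v_def)
  qed

  have sol: "mixed_solution \<alpha> c \<beta> B G (\<lambda>j q. h j (snd q)) v"
    unfolding mixed_solution_def
  proof (intro conjI allI)
    fix j t
    show "periodic_t (v j)" using pu by (simp add: periodic_t_def v_def)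
    show "transport (\<alpha> j) (v j) (\<lambda>q. G j q - \<beta> j q * v j q - (\<Sum>k\<in>UNIV - {j}. B j k q * v k q))"
      unfolding S_def[symmetric]
    proof (rule transportI[OF cv])
      show "continuous_on strip (\<lambda>q. G j q - \<beta> j q * v j q - S j q)"
        by (intro continuous_on_diff continuous_on_mult cont cv)
      fix w x assume w: "is_char (\<alpha> j) w" and x: "x \<in> {0..(1::real)}"
      show "((\<lambda>x. v j (x, w x)) has_real_derivative G j (x, w x) - \<beta> j (x, w x) * v j (x, w x) - S j (x, w x))
          (at x within {0..1})"
        by (rule variation_of_constants[OF continuous_on_char[OF cont(1) w] continuous_on_char[OF cont(2) w]
              continuous_on_char[OF cont(3) w] c01(2) formula[OF w] x])
    qed
    obtain w where w: "is_char (\<alpha> j) w" "w (c j) = t" by (rule speed.char_through[OF sp c01(2)])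
    from formula[OF w(1) c01(2)[of j]] show "v j (c j, t) = h j (snd (t, out_trace c v t))"
      by (simp add: w(2) duhamel_def)
  qed

  \<comment> \<open>The hypothesis is used for base points at the outflow end \<open>1 - c j\<close>, so that the integral runs over a whole
    characteristic.\<close>
  have diss: "dissipative \<alpha> \<alpha>' c \<beta> (\<lambda>j k q. partial k (h j) (snd q)) l" if l: "l \<le> r" for l
    unfolding dissipative_def
  proof (intro allI impI)
    fix j w and z :: "real ^ 'n" assume w: "is_char (\<alpha> j) w"
    let ?f = "\<lambda>\<eta>. \<beta> j (\<eta>, w \<eta>) + real l * \<alpha>' j (\<eta>, w \<eta>)"
    note omw = om[OF w refl c01(3)]
    have cf: "continuous_on {0..1} ?f"
      by (intro continuous_on_add continuous_on_mult continuous_on_const continuous_on_char[OF cont(1) w]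
          continuous_on_char[OF C1tD(2)[OF C\<alpha>] w])
    have "(LBINT \<eta>=1 - c j..c j. b j j (\<eta>, omega (a j) \<eta> (1 - c j) (w (1 - c j)))
          / a j (\<eta>, omega (a j) \<eta> (1 - c j) (w (1 - c j)))
        - real l * (partial_t (a j) (\<eta>, omega (a j) \<eta> (1 - c j) (w (1 - c j)))
          / (a j (\<eta>, omega (a j) \<eta> (1 - c j) (w (1 - c j))))\<^sup>2)) = prim ?f (c j) - prim ?f (1 - c j)"
      by (rule LBINT_eq_prim[OF cf _ c01(3,2)]) (simp add: omw \<beta>_def \<alpha>'_eq)
    also have "\<dots> = (2 * c j - 1) * integral {0..1} ?f"
      using c01(1)[of j] by (auto simp: prim_1)
    finally show "exp ((2 * c j - 1) * integral {0..1} ?f) * (\<Sum>k\<in>UNIV. \<bar>partial k (h j) (snd (w (c j), z))\<bar>) < 1"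
      using assms(14)[where j=j and x="1 - c j" and t="w (1 - c j)" and z=z and l=l, OF c01(3) l] by (simp only: c_def snd_conv)
  qed

  \<comment> \<open>\<open>b\<^sub>j\<^sub>k / a\<^sub>j = p (a\<^sub>k - a\<^sub>j) / a\<^sub>j = p a\<^sub>k (1 / a\<^sub>j - 1 / a\<^sub>k)\<close>\<close>
  have "\<exists>p. j \<noteq> k \<longrightarrow> Ck_on 1 p strip \<and> (\<forall>q\<in>strip. B j k q = p q * (\<alpha> j q - \<alpha> k q))" for j k
  proof (cases "j = k")
    case False
    obtain p where p: "Ck_on 1 p strip" "\<forall>q\<in>strip. b j k q = p q * (a k q - a j q)"
      using assms(13)[OF False] by blast
    have "Ck_on 1 (a k) strip" using assms(3) by (simp add: smooth_on_def)
    from Ck_on_mult[OF p(1) this] have "Ck_on 1 (\<lambda>q. p q * a k q) strip" .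
    moreover have "B j k q = p q * a k q * (\<alpha> j q - \<alpha> k q)" if "q \<in> strip" for q
    proof -
      have "a k q * (\<alpha> j q - \<alpha> k q) = (a k q - a j q) / a j q"
        using nz[OF that, of j] nz[OF that, of k] by (simp add: \<alpha>_def field_simps)
      with bspec[OF p(2) that] show ?thesis by (simp add: B_def mult.assoc)
    qed
    ultimately show ?thesis by blast
  qed simp
  then have "\<forall>i. \<exists>p. fst i \<noteq> snd i \<longrightarrow> Ck_on 1 p strip \<and>
      (\<forall>q\<in>strip. B (fst i) (snd i) q = p q * (\<alpha> (fst i) q - \<alpha> (snd i) q))" by simp
  from choice[OF this] obtain p where p: "\<And>i. fst i \<noteq> snd i \<Longrightarrow> Ck_on 1 (p i) strip \<and>
      (\<forall>q\<in>strip. B (fst i) (snd i) q = p i q * (\<alpha> (fst i) q - \<alpha> (snd i) q))" by blast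
  have "Ck_on r (v j) strip" for j
  proof (rule mixed_solution_Ck[OF sol s\<alpha> s\<beta> sB sG assms(9)])
    show "Ck_on 1 (p (j, k)) strip" if "j \<noteq> k" for j k using p[of "(j, k)"] that by simp
    show "B j k q = p (j, k) q * (\<alpha> j q - \<alpha> k q)" if "j \<noteq> k" "q \<in> strip" for j k q
      using bspec[OF conjunct2[OF p[of "(j, k)"]] that(2)] that(1) by simp
  qed (use per diss in auto)
  then have "Ck_on r (v j) ({0<..<1} \<times> UNIV)" for j
    by (rule Ck_on_subset) auto
  then show ?thesis by (simp add: v_def[abs_def])
qed

end
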